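(* Let $\Omega\subseteq\mathbb{R}^n$ be open, let $w:\mathbb{R}^n\to(0,\infty]$ be lower semicontinuous, and let $f\in BV_{\mathrm{loc}}(\Omega;w)$. Then there exist a Radon measure $\lVert Df\rVert_w$ on $\Omega$ and a $\lVert Df\rVert_w$-measurable function $\nu:\Omega\to\mathbb{R}^n$ such that (i) $|\nu(x)|=1$ for $\lVert Df\rVert_w$-a.e. $x$, and (ii) for all $\varphi\in\mathrm{Lip}_c(\Omega;\mathbb{R}^n)$, $$\int_\Omega f\operatorname{div}\varphi\,dx=-\int_\Omega(\varphi\cdot\nu)\,\frac{1}{w}\,d\lVert Df\rVert_w .$$ In particular, $d\lVert Df\rVert_w=w\,d\lVert Df\rVert$, where $\lVert Df\rVert$ is the (unweighted) variation measure of $f$.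
   Context: $\mathrm{Lip}_c(V;\mathbb{R}^n)$ is the space of compactly supported Lipschitz maps $V\to\mathbb{R}^n$; $V\Subset\Omega$ means $V$ is open with compact closure contained in $\Omega$. $L^1_{\mathrm{loc}}(\Omega;w)$ is the space of measurable $f$ with $\int_K|f|\,w\,dx<\infty$ for all compact $K\subseteq\Omega$. $BV_{\mathrm{loc}}(\Omega;w)$ is the space of $f\in L^1_{\mathrm{loc}}(\Omega;w)$ (functions agreeing a.e. are identified) such that for all $V\Subset\Omega$ $$\lVert Df\rVert_w(V):=\sup\left\{\int_V f\operatorname{div}\varphi\,dx:\varphi\in\mathrm{Lip}_c(V;\mathbb{R}^n),\ |\varphi|\le w\right\}<\infty .$$ The unweighted space $BV_{\mathrm{loc}}(\Omega)$ consists of $f\in L^1_{\mathrm{loc}}(\Omega)$ satisfying this with $w\equiv1$. For lower semicontinuous $w:\mathbb{R}^n\to(0,\infty]$ one has $BV_{\mathrm{loc}}(\Omega;w)\subseteq BV_{\mathrm{loc}}(\Omega)$. For $f\in BV_{\mathrm{loc}}(\Omega)$, $\lVert Df\rVert$ denotes the Radon measure on $\Omega$ given by the classical structure theorem: there is a $\lVert Df\rVert$-measurable $\sigma:\Omega\to\mathbb{R}^n$ with $|\sigma|=1$ $\lVert Df\rVert$-a.e. and $\int_\Omega f\operatorname{div}\varphi\,dx=-\int_\Omega\varphi\cdot\sigma\,d\lVert Df\rVert$ for all $\varphi\in\mathrm{Lip}_c(\Omega;\mathbb{R}^n)$. *)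

theory Defs
  imports "HOL-Analysis.Analysis"
begin

definition lower_semicontinuous :: "('a::topological_space \<Rightarrow> ennreal) \<Rightarrow> bool" where
  "lower_semicontinuous w \<longleftrightarrow> (\<forall>a. open {x. a < w x})"

definition compactly_contained :: "'a::topological_space set \<Rightarrow> 'a set \<Rightarrow> bool" where
  "compactly_contained V \<Omega> \<longleftrightarrow> open V \<and> compact (closure V) \<and> closure V \<subseteq> \<Omega>"

text \<open>Maps \<open>V \<rightarrow> \<real>\<^sup>n\<close> are represented by total functions; a compactly supported map on \<open>V\<close> is
  represented by its extension by zero, so that the support condition forces \<open>\<phi> = 0\<close> off \<open>V\<close>.\<close>

definition Lip_c :: "(real^'n) set \<Rightarrow> (real^'n \<Rightarrow> real^'n) set" where
  "Lip_c V = {\<phi>. (\<exists>L. L-lipschitz_on V \<phi>) \<and>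
                 compact (closure {x. \<phi> x \<noteq> 0}) \<and> closure {x. \<phi> x \<noteq> 0} \<subseteq> V}"

text \<open>For Lipschitz \<open>\<phi>\<close> the partial derivatives exist almost everywhere; on the exceptional
  null set \<open>deriv\<close> takes an unspecified value, which no integral below depends on.\<close>

definition divergence :: "(real^'n \<Rightarrow> real^'n) \<Rightarrow> real^'n \<Rightarrow> real" where
  "divergence \<phi> x = (\<Sum>i\<in>UNIV. deriv (\<lambda>t. \<phi> (x + t *\<^sub>R axis i 1) $ i) 0)"

definition L1_loc :: "(real^'n) set \<Rightarrow> (real^'n \<Rightarrow> ennreal) \<Rightarrow> (real^'n \<Rightarrow> real) set" where
  "L1_loc \<Omega> w = {f. f \<in> borel_measurable (lebesgue_on \<Omega>) \<and>
     (\<forall>K. compact K \<and> K \<subseteq> \<Omega> \<longrightarrow> (\<integral>\<^sup>+x\<in>K. ennreal \<bar>f x\<bar> * w x \<partial>lebesgue) < \<infinity>)}"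

definition weighted_variation ::
    "(real^'n \<Rightarrow> ennreal) \<Rightarrow> (real^'n \<Rightarrow> real) \<Rightarrow> (real^'n) set \<Rightarrow> ereal" where
  "weighted_variation w f V =
     (SUP \<phi>\<in>{\<phi>\<in>Lip_c V. \<forall>x\<in>V. ennreal (norm (\<phi> x)) \<le> w x}.
        ereal (LINT x:V|lebesgue. f x * divergence \<phi> x))"

text \<open>Elements are functions, not classes modulo a.e. equality; all notions here depend only on
  the class of \<open>f\<close> on \<open>\<Omega>\<close>.\<close>

definition BV_loc :: "(real^'n) set \<Rightarrow> (real^'n \<Rightarrow> ennreal) \<Rightarrow> (real^'n \<Rightarrow> real) set" where
  "BV_loc \<Omega> w = {f \<in> L1_loc \<Omega> w.
     \<forall>V. compactly_contained V \<Omega> \<longrightarrow> weighted_variation w f V < \<infinity>}"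

text \<open>Radon measures are kept on the Borel sets of \<open>\<Omega>\<close>, so that \<open>\<mu>\<close>-measurable functions are
  Borel functions (every function measurable for the completion has a Borel version).\<close>

definition radon_measure_on :: "'a::topological_space set \<Rightarrow> 'a measure \<Rightarrow> bool" where
  "radon_measure_on \<Omega> \<mu> \<longleftrightarrow>
     space \<mu> = \<Omega> \<and> sets \<mu> = sets (restrict_space borel \<Omega>) \<and>
     (\<forall>K. compact K \<and> K \<subseteq> \<Omega> \<longrightarrow> emeasure \<mu> K < \<infinity>) \<and>
     (\<forall>B\<in>sets \<mu>. emeasure \<mu> B = (INF U\<in>{U. open U \<and> B \<subseteq> U \<and> U \<subseteq> \<Omega>}. emeasure \<mu> U)) \<and>
     (\<forall>B\<in>sets \<mu>. emeasure \<mu> B = (SUP K\<in>{K. compact K \<and> K \<subseteq> B}. emeasure \<mu> K))"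

definition is_variation_measure ::
    "(real^'n) set \<Rightarrow> (real^'n \<Rightarrow> real) \<Rightarrow> (real^'n) measure \<Rightarrow> bool" where
  "is_variation_measure \<Omega> f \<mu> \<longleftrightarrow> radon_measure_on \<Omega> \<mu> \<and>
     (\<exists>\<sigma>\<in>borel_measurable \<mu>. (AE x in \<mu>. norm (\<sigma> x) = 1) \<and>
        (\<forall>\<phi>\<in>Lip_c \<Omega>. (LINT x:\<Omega>|lebesgue. f x * divergence \<phi> x)
                      = - (LINT x|\<mu>. \<phi> x \<bullet> \<sigma> x)))"

text \<open>The total variation measure \<open>\<parallel>Df\<parallel>\<close> of \<open>f \<in> BV_loc \<Omega> (\<lambda>_. 1)\<close>. It exists by the structure
  theorem for BV functions, and it is unique because the integral identity determines the
  \<open>\<real>\<^sup>n\<close>-valued measure \<open>\<sigma> \<mu>\<close>, whose total variation is \<open>\<mu>\<close>.\<close>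

definition variation_measure ::
    "(real^'n) set \<Rightarrow> (real^'n \<Rightarrow> real) \<Rightarrow> (real^'n) measure" where
  "variation_measure \<Omega> f = (THE \<mu>. is_variation_measure \<Omega> f \<mu>)"

end

theory Submission
  imports Defs
begin

text \<open>
  Write \<open>L \<phi> = \<integral>\<^sub>\<Omega> f div \<phi>\<close>. The theorem says that bounding \<open>L\<close> on the fields with
  \<open>|\<phi>| \<le> w\<close> is the same as integrating the weight \<open>w\<close> against the total variation of the
  vector measure that represents \<open>L\<close>.

  A lower semicontinuous positive weight is bounded below by a positive constant on every compact
  set, so locally bounded weighted variation makes \<open>L\<close> locally bounded in the supremum norm
  (\<open>BV_loc_subset_unweighted\<close>). A locally bounded linear functional on compactly
  supported Lipschitz fields is integration against \<open>h N\<close>, with \<open>N\<close> a locally finite measure and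
  \<open>|h| = 1\<close> almost everywhere (\<open>vector_riesz\<close>). This gives \<open>\<parallel>Df\<parallel> = N\<close> and \<open>\<sigma> = - h\<close>.
  To prove it, let \<open>|L|(g)\<close> be the supremum of \<open>L\<close> over the fields dominated by \<open>g \<ge> 0\<close>. Then
  \<open>|L|\<close> is additive, and so are the \<open>|L| + L\<^sub>i\<close>, where \<open>L\<^sub>i\<close> is the \<open>i\<close>-th component of \<open>L\<close>.
  All of them are positive, so they are represented by measures obtained by Caratheodory's
  construction (\<open>integral_riesz\<close>). The measures of \<open>|L| + L\<^sub>i\<close> are absolutely
  continuous with respect to that of \<open>|L|\<close>, and their Radon-Nikodym densities give the components
  of \<open>h\<close>, up to normalisation.

  Conversely, let \<open>L \<phi> = \<integral> \<phi> \<bullet> h dN\<close> be any such representation. The supremum of \<open>L\<close> over the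
  fields supported in an open set \<open>V\<close> with \<open>|\<phi>| \<le> w\<close> equals \<open>\<integral>\<^sub>V w dN\<close>
  (\<open>SUP_weighted_fields\<close>). The upper bound is the Cauchy-Schwarz inequality. For the lower
  bound, \<open>w\<close> is the increasing limit of Lipschitz functions, and \<open>h\<close> can be approximated in the mean
  by Lipschitz fields with values in the unit ball. With \<open>w = 1\<close> this formula shows that
  \<open>\<parallel>Df\<parallel>\<close> is determined by \<open>f\<close>. With the given \<open>w\<close> it shows that \<open>w \<parallel>Df\<parallel>\<close> is finite on compact
  sets and has the weighted variation as its value on each \<open>V\<close>. In particular
  \<open>w < \<infinity>\<close> holds \<open>\<parallel>Df\<parallel>\<close>-almost everywhere, so that \<open>1/w\<close> cancels the density \<open>w\<close> in the integral
  identity.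

  The divergence is defined through difference quotients at single points, so even the linearity of
  \<open>L\<close> rests on an analytic fact: a Lipschitz function has partial derivatives almost everywhere
  (\<open>lipschitz_differentiable_along_AE\<close>).
\<close>

section \<open>Lipschitz functions with compact support\<close>

text \<open>Test functions are total functions that vanish off a compact subset of \<open>\<Omega>\<close>. Asking for
  the Lipschitz bound on the whole space makes sums, products and compositions immediate; for
  open \<open>\<Omega>\<close> it follows from the Lipschitz bound on \<open>\<Omega>\<close> alone.\<close>

definition lipc :: "'a::metric_space set \<Rightarrow> ('a \<Rightarrow> 'b::real_normed_vector) set" where
  "lipc \<Omega> = {g. (\<exists>L. L-lipschitz_on UNIV g) \<and> (\<exists>K. compact K \<and> K \<subseteq> \<Omega> \<and> (\<forall>x. x \<notin> K \<longrightarrow> g x = 0))}"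

lemma lipcI:
  assumes "L-lipschitz_on UNIV g" "compact K" "K \<subseteq> \<Omega>" "\<And>x. x \<notin> K \<Longrightarrow> g x = 0"
  shows "g \<in> lipc \<Omega>"
  using assms unfolding lipc_def by blast

lemma lipcE:
  assumes "g \<in> lipc \<Omega>"
  obtains L K where "L-lipschitz_on UNIV g" "compact K" "K \<subseteq> \<Omega>" "\<And>x. x \<notin> K \<Longrightarrow> g x = 0"
  using assms unfolding lipc_def by blast

lemma lipc_mono: "g \<in> lipc U \<Longrightarrow> U \<subseteq> V \<Longrightarrow> g \<in> lipc V"
  unfolding lipc_def by blast

lemma lipc_support:
  assumes "g \<in> lipc \<Omega>"
  shows "compact (closure {x. g x \<noteq> 0})" "closure {x. g x \<noteq> 0} \<subseteq> \<Omega>"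
proof -
  obtain L K where K: "L-lipschitz_on UNIV g" "compact K" "K \<subseteq> \<Omega>" "\<And>x. x \<notin> K \<Longrightarrow> g x = 0"
    using assms by (rule lipcE, blast)
  have *: "closure {x. g x \<noteq> 0} \<subseteq> K"
    using K by (intro closure_minimal compact_imp_closed) auto
  then show "closure {x. g x \<noteq> 0} \<subseteq> \<Omega>" using K by blast
  show "compact (closure {x. g x \<noteq> 0})"
    using * K(2) by (metis closed_closure compact_Int_closed inf.absorb_iff2)
qed

lemma lipc_zero: "(\<lambda>x. 0) \<in> lipc \<Omega>"
  by (rule lipcI[where K="{}" and L=0]) (auto intro: lipschitz_intros)

lemma lipc_continuous: "g \<in> lipc \<Omega> \<Longrightarrow> continuous_on A g"
  by (meson continuous_on_subset lipcE lipschitz_on_continuous_on subset_UNIV)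

lemma lipc_borel [measurable_dest]:
  "(g::'a::metric_space \<Rightarrow> 'b::real_normed_vector) \<in> lipc \<Omega> \<Longrightarrow> g \<in> borel_measurable borel"
  by (intro borel_measurable_continuous_onI lipc_continuous)

lemma lipc_bounded:
  assumes "g \<in> lipc \<Omega>"
  obtains B where "B > 0" "\<And>x. norm (g x) \<le> B"
proof -
  obtain L K where K: "L-lipschitz_on UNIV g" "compact K" "K \<subseteq> \<Omega>" "\<And>x. x \<notin> K \<Longrightarrow> g x = 0"
    using assms by (rule lipcE, blast)
  have "compact (g ` K)"
    by (intro compact_continuous_image lipc_continuous[OF assms] K)
  then obtain B where B: "B > 0" "\<And>y. y \<in> g ` K \<Longrightarrow> norm y \<le> B"
    using compact_imp_bounded bounded_pos by metis
  have "norm (g x) \<le> B" for x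
    using B K(4)[of x] by (cases "x \<in> K") auto
  with B(1) show ?thesis using that by blast
qed

lemma lipc_compose:
  assumes "g \<in> lipc \<Omega>" "L-lipschitz_on UNIV F" "F 0 = 0"
  shows "(\<lambda>x. F (g x)) \<in> lipc \<Omega>"
proof -
  obtain M K where K: "M-lipschitz_on UNIV g" "compact K" "K \<subseteq> \<Omega>" "\<And>x. x \<notin> K \<Longrightarrow> g x = 0"
    using assms(1) by (rule lipcE, blast)
  show ?thesis
  proof (rule lipcI[OF _ K(2,3)])
    show "(L * M)-lipschitz_on UNIV (\<lambda>x. F (g x))"
      using K(1) assms(2) by (intro lipschitz_on_compose2) (auto intro: lipschitz_on_subset)
  qed (use K assms in auto)
qed

lemma lipc_scaleR: "g \<in> lipc \<Omega> \<Longrightarrow> (\<lambda>x. c *\<^sub>R g x) \<in> lipc \<Omega>"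
  by (erule lipc_compose[where F="\<lambda>y. c *\<^sub>R y"]) (auto intro: lipschitz_intros)

lemma lipc_cmult: "g \<in> lipc \<Omega> \<Longrightarrow> (\<lambda>x. c * g x :: real) \<in> lipc \<Omega>"
  using lipc_scaleR[of g \<Omega> c] by simp

lemma lipc_uminus: "g \<in> lipc \<Omega> \<Longrightarrow> (\<lambda>x. - g x) \<in> lipc \<Omega>"
  using lipc_scaleR[of g \<Omega> "-1"] by simp

lemma lipc_scaleR_left:
  assumes "(g :: _ \<Rightarrow> real) \<in> lipc \<Omega>"
  shows "(\<lambda>x. g x *\<^sub>R v) \<in> lipc \<Omega>"
proof -
  obtain B where B: "B-lipschitz_on UNIV (\<lambda>t. t *\<^sub>R v)"
    using bounded_linear.lipschitz_boundE[OF bounded_linear_scaleR_left] .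
  show ?thesis
    using lipc_compose[OF assms B] by simp
qed

lemma lipc_inner:
  assumes "g \<in> lipc \<Omega>"
  shows "(\<lambda>x. g x \<bullet> v) \<in> lipc \<Omega>"
proof -
  obtain B where B: "B-lipschitz_on UNIV (\<lambda>y. y \<bullet> v)"
    using bounded_linear.lipschitz_boundE[OF bounded_linear_inner_left] .
  show ?thesis
    using lipc_compose[OF assms B] by simp
qed

lemma lipc_add:
  assumes "g \<in> lipc \<Omega>" "h \<in> lipc \<Omega>"
  shows "(\<lambda>x. g x + h x) \<in> lipc \<Omega>"
proof -
  obtain L K where K: "L-lipschitz_on UNIV g" "compact K" "K \<subseteq> \<Omega>" "\<And>x. x \<notin> K \<Longrightarrow> g x = 0"
    using assms(1) by (rule lipcE, blast)
  obtain L' K' where K': "L'-lipschitz_on UNIV h" "compact K'" "K' \<subseteq> \<Omega>" "\<And>x. x \<notin> K' \<Longrightarrow> h x = 0"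
    using assms(2) by (rule lipcE, blast)
  show ?thesis
  proof (rule lipcI)
    show "compact (K \<union> K')" "K \<union> K' \<subseteq> \<Omega>" using K K' by auto
    show "(L + L')-lipschitz_on UNIV (\<lambda>x. g x + h x)"
      using K K' by (intro lipschitz_intros)
  qed (use K K' in auto)
qed

lemma lipc_diff: "g \<in> lipc \<Omega> \<Longrightarrow> h \<in> lipc \<Omega> \<Longrightarrow> (\<lambda>x. g x - h x) \<in> lipc \<Omega>"
  using lipc_add[of g \<Omega> "\<lambda>x. - h x"] lipc_uminus[of h \<Omega>] by simp

lemma lipc_sum: "(\<And>i. i \<in> I \<Longrightarrow> g i \<in> lipc \<Omega>) \<Longrightarrow> (\<lambda>x. \<Sum>i\<in>I. g i x) \<in> lipc \<Omega>"
  by (induction I rule: infinite_finite_induct) (auto intro: lipc_add lipc_zero)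

lemma lipschitz_min: "L-lipschitz_on X f \<Longrightarrow> M-lipschitz_on X g \<Longrightarrow> (max L M)-lipschitz_on X (\<lambda>x. min (f x) (g x :: real))"
proof (rule lipschitz_onI)
  assume *: "L-lipschitz_on X f" "M-lipschitz_on X g"
  then show "0 \<le> max L M" using lipschitz_on_nonneg by fastforce
  fix x y assume "x \<in> X" "y \<in> X"
  then have "dist (f x) (f y) \<le> L * dist x y" "dist (g x) (g y) \<le> M * dist x y"
    using * by (auto dest: lipschitz_onD)
  moreover have "L * dist x y \<le> max L M * dist x y" "M * dist x y \<le> max L M * dist x y"
    by (auto intro: mult_right_mono)
  ultimately show "dist (min (f x) (g x)) (min (f y) (g y)) \<le> max L M * dist x y"
    unfolding dist_real_def by linarith
qed

lemma lipschitz_max: "L-lipschitz_on X f \<Longrightarrow> M-lipschitz_on X g \<Longrightarrow> (max L M)-lipschitz_on X (\<lambda>x. max (f x) (g x :: real))"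
  using lipschitz_min[of L X "\<lambda>x. - f x" M "\<lambda>x. - g x"]
  by (subst lipschitz_on_minus_iff[symmetric]) (simp add: minus_max_eq_min)

lemma lipc_pos_part: "g \<in> lipc \<Omega> \<Longrightarrow> (\<lambda>x. max (g x) (0::real)) \<in> lipc \<Omega>"
  by (erule lipc_compose[where F="\<lambda>y. max y 0"])
     (auto intro: lipschitz_max lipschitz_intros)

lemma lipc_above: "g \<in> lipc \<Omega> \<Longrightarrow> 0 \<le> c \<Longrightarrow> (\<lambda>x. max (g x - c) (0::real)) \<in> lipc \<Omega>"
  by (erule lipc_compose[where F="\<lambda>y. max (y - c) 0"])
     (auto intro!: lipschitz_max lipschitz_intros)

lemma lipc_below: "g \<in> lipc \<Omega> \<Longrightarrow> 0 \<le> c \<Longrightarrow> (\<lambda>x. min (g x) (c::real)) \<in> lipc \<Omega>"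
  by (erule lipc_compose[where F="\<lambda>y. min y c"])
     (auto intro!: lipschitz_min lipschitz_intros)

lemma lipc_min:
  assumes "g \<in> lipc \<Omega>" "h \<in> lipc \<Omega>"
  shows "(\<lambda>x. min (g x) (h x :: real)) \<in> lipc \<Omega>"
proof -
  have "(\<lambda>x. g x - max (g x - h x) 0) \<in> lipc \<Omega>"
    by (intro lipc_diff assms lipc_pos_part)
  moreover have "(\<lambda>x. g x - max (g x - h x) 0) = (\<lambda>x. min (g x) (h x))"
    by auto
  ultimately show ?thesis by simp
qed

lemma lipc_mult:
  fixes g :: "'a::metric_space \<Rightarrow> real"
  assumes g: "g \<in> lipc \<Omega>" and h: "L-lipschitz_on UNIV h" and bd: "\<And>x. norm (h x) \<le> B"
  shows "(\<lambda>x. g x *\<^sub>R h x) \<in> lipc \<Omega>"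
proof -
  obtain M K where K: "M-lipschitz_on UNIV g" "compact K" "K \<subseteq> \<Omega>" "\<And>x. x \<notin> K \<Longrightarrow> g x = 0"
    using g by (rule lipcE, blast)
  obtain C where C: "C > 0" "\<And>x. norm (g x) \<le> C"
    using g by (rule lipc_bounded, blast)
  have L: "L \<ge> 0" "M \<ge> 0" using h K lipschitz_on_nonneg by auto
  have B: "B \<ge> 0" using bd[of undefined] norm_ge_zero order_trans by blast
  show ?thesis
  proof (rule lipcI[OF _ K(2,3)])
    show "(M * B + C * L)-lipschitz_on UNIV (\<lambda>x. g x *\<^sub>R h x)"
    proof (rule lipschitz_onI)
      fix x y
      have "g x *\<^sub>R h x - g y *\<^sub>R h y = (g x - g y) *\<^sub>R h x + g y *\<^sub>R (h x - h y)"
        by (simp add: algebra_simps)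
      then have "norm (g x *\<^sub>R h x - g y *\<^sub>R h y) \<le> norm (g x - g y) * norm (h x) + norm (g y) * norm (h x - h y)"
        by (metis norm_scaleR norm_triangle_ineq real_norm_def)
      also have "\<dots> \<le> (M * dist x y) * B + C * (L * dist x y)"
        using lipschitz_onD[OF K(1), of x y] lipschitz_onD[OF h, of x y] C L B bd
        by (intro add_mono mult_mono) (auto simp: dist_norm)
      finally show "dist (g x *\<^sub>R h x) (g y *\<^sub>R h y) \<le> (M * B + C * L) * dist x y"
        by (simp add: dist_norm algebra_simps)
    qed (use B L C in auto)
  qed (use K in auto)
qed

text \<open>The cutoff is equal to 1 on a neighbourhood of \<open>K\<close>, not just on \<open>K\<close>: a function
  vanishing off \<open>K'\<close> that is cut off in this way has the remaining part supported in the compact set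
  \<open>K' - W\<close>, which is what splitting a test function over two open sets requires.\<close>

lemma lipc_cutoff:
  fixes K :: "'a::heine_borel set"
  assumes "compact K" "open U" "K \<subseteq> U"
  obtains h W where "h \<in> lipc U" "\<And>x. 0 \<le> h x" "\<And>x. h x \<le> (1::real)"
    "open W" "K \<subseteq> W" "\<And>x. x \<in> W \<Longrightarrow> h x = 1"
proof (cases "K = {}")
  case True
  show ?thesis
    by (rule that[of "\<lambda>x. 0" "{}"]) (use True lipc_zero in auto)
next
  case False
  obtain \<epsilon> where e: "\<epsilon> > 0" "{x. infdist x K \<le> \<epsilon>} \<subseteq> U"
    using compact_in_open_separated[OF False assms] .
  define h where "h = (\<lambda>x. max (min (2 - 2 / \<epsilon> * infdist x K) 1) 0)"
  have inf: "1-lipschitz_on UNIV (\<lambda>x. infdist x K)"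
    by (rule lipschitz_onI) (auto simp: dist_real_def infdist_triangle_abs)
  have "(max (max (0 + (2 / \<epsilon>) * 1) 0) 0)-lipschitz_on UNIV h"
    unfolding h_def
    by (intro lipschitz_max lipschitz_min lipschitz_on_diff lipschitz_on_constant
       lipschitz_on_cmult_real_nonneg inf) (use e in auto)
  then obtain L where L: "L-lipschitz_on UNIV h" by blast
  show ?thesis
  proof (rule that[of h "{x. infdist x K < \<epsilon> / 2}"])
    show "h \<in> lipc U"
    proof (rule lipcI[OF L _ e(2)])
      show "compact {x. infdist x K \<le> \<epsilon>}"
        using compact_infdist_le[OF False assms(1) e(1)] .
      show "h x = 0" if "x \<notin> {x. infdist x K \<le> \<epsilon>}" for x
        using that e(1) by (simp add: h_def max_def min_def field_simps)
    qed
    show "open {x. infdist x K < \<epsilon> / 2}"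
      by (intro open_Collect_less continuous_on_infdist continuous_intros)
    show "h x = 1" if "x \<in> {x. infdist x K < \<epsilon> / 2}" for x
      using that e(1) by (simp add: h_def field_simps)
    show "K \<subseteq> {x. infdist x K < \<epsilon> / 2}"
      using e(1) by (auto)
  qed (auto simp: h_def)
qed

section \<open>Positive functionals on Lipschitz functions\<close>

text \<open>Positive functionals are only considered on nonnegative functions, because the modulus of a
  vector functional is naturally defined there.\<close>

locale positive_lipc_functional =
  fixes \<Omega> :: "'a::euclidean_space set" and J :: "('a \<Rightarrow> real) \<Rightarrow> real"
  assumes open_Omega: "open \<Omega>"
    and J_nonneg: "\<And>g. g \<in> lipc \<Omega> \<Longrightarrow> (\<And>x. 0 \<le> g x) \<Longrightarrow> 0 \<le> J g"
    and J_add: "\<And>g h. g \<in> lipc \<Omega> \<Longrightarrow> h \<in> lipc \<Omega> \<Longrightarrow> (\<And>x. 0 \<le> g x) \<Longrightarrow> (\<And>x. 0 \<le> h x)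
      \<Longrightarrow> J (\<lambda>x. g x + h x) = J g + J h"
    and J_scale: "\<And>g c. g \<in> lipc \<Omega> \<Longrightarrow> (\<And>x. 0 \<le> g x) \<Longrightarrow> 0 \<le> c \<Longrightarrow> J (\<lambda>x. c * g x) = c * J g"
begin

lemma J_mono:
  assumes "g \<in> lipc \<Omega>" "h \<in> lipc \<Omega>" "\<And>x. 0 \<le> g x" "\<And>x. g x \<le> h x"
  shows "J g \<le> J h"
proof -
  have "J (\<lambda>x. g x + (h x - g x)) = J g + J (\<lambda>x. h x - g x)"
    using assms by (intro J_add lipc_diff) auto
  moreover have "0 \<le> J (\<lambda>x. h x - g x)"
    using assms by (intro J_nonneg lipc_diff) auto
  ultimately show ?thesis by simp
qed

lemma J_zero: "J (\<lambda>x. 0) = 0"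
  using J_scale[OF lipc_zero, of 0] by simp

definition test :: "'a set \<Rightarrow> ('a \<Rightarrow> real) set" where
  "test U = {g \<in> lipc (U \<inter> \<Omega>). \<forall>x. 0 \<le> g x \<and> g x \<le> 1}"

text \<open>Intersecting with \<open>\<Omega>\<close> allows a measure on all Borel sets of the space, carried by \<open>\<Omega>\<close>.\<close>

definition content :: "'a set \<Rightarrow> ennreal" where
  "content U = (SUP g\<in>test U. ennreal (J g))"

definition outer :: "'a set \<Rightarrow> ennreal" where
  "outer A = (INF U\<in>{U. open U \<and> A \<inter> \<Omega> \<subseteq> U}. content U)"

lemma testD: "g \<in> test U \<Longrightarrow> g \<in> lipc (U \<inter> \<Omega>)" "g \<in> test U \<Longrightarrow> g \<in> lipc \<Omega>"
    "g \<in> test U \<Longrightarrow> 0 \<le> g x" "g \<in> test U \<Longrightarrow> g x \<le> 1"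
  unfolding test_def by (auto intro: lipc_mono)

lemma content_upper: "g \<in> test U \<Longrightarrow> ennreal (J g) \<le> content U"
  unfolding content_def by (rule SUP_upper)

lemma zero_test: "(\<lambda>x. 0) \<in> test U"
  unfolding test_def by (simp add: lipc_zero)

lemma content_mono: "U \<inter> \<Omega> \<subseteq> V \<Longrightarrow> content U \<le> content V"
  unfolding content_def test_def
  by (intro SUP_subset_mono) (auto intro: lipc_mono)

lemma content_empty: "content {} = 0"
proof -
  have "g = (\<lambda>x. 0)" if "g \<in> test {}" for g
    using that by (auto simp: test_def elim!: lipcE)
  then have "test {} = {\<lambda>x. 0}" using zero_test by blast
  then show ?thesis unfolding content_def by (simp add: J_zero)
qed

text \<open>A test function \<open>g\<close> for \<open>U \<union> V\<close> with support in \<open>K\<close> is split without division: \<open>K - V\<close> is a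
  compact subset of \<open>U\<close>, and with a cutoff \<open>h\<close> for it, \<open>min g h\<close> lives in \<open>U\<close> while
  \<open>g - min g h\<close> vanishes near \<open>K - V\<close>, hence lives in \<open>V\<close>.\<close>

lemma content_Un:
  assumes "open U" "open V"
  shows "content (U \<union> V) \<le> content U + content V"
  unfolding content_def[of "U \<union> V"]
proof (rule SUP_least)
  fix g assume g: "g \<in> test (U \<union> V)"
  obtain L K where K: "L-lipschitz_on UNIV g" "compact K" "K \<subseteq> (U \<union> V) \<inter> \<Omega>" "\<And>x. x \<notin> K \<Longrightarrow> g x = 0"
    using testD(1)[OF g] by (rule lipcE, blast)
  have "compact (K - V)" using K(2) assms(2) by (rule compact_diff)
  moreover have "open (U \<inter> \<Omega>)" using assms open_Omega by auto
  moreover have "K - V \<subseteq> U \<inter> \<Omega>" using K(3) by auto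
  ultimately obtain h W where h: "h \<in> lipc (U \<inter> \<Omega>)" "\<And>x. 0 \<le> h x" "\<And>x. h x \<le> (1::real)"
    "open W" "K - V \<subseteq> W" "\<And>x. x \<in> W \<Longrightarrow> h x = 1"
    by (rule lipc_cutoff, blast)
  define g1 where "g1 = (\<lambda>x. min (g x) (h x))"
  define g2 where "g2 = (\<lambda>x. g x - g1 x)"
  have "h \<in> lipc \<Omega>" using h(1) by (rule lipc_mono) auto
  then have g1: "g1 \<in> lipc \<Omega>" unfolding g1_def by (intro lipc_min testD(2)[OF g])
  then have g2: "g2 \<in> lipc \<Omega>" unfolding g2_def by (intro lipc_diff testD(2)[OF g])
  obtain L' K' where K': "L'-lipschitz_on UNIV h" "compact K'" "K' \<subseteq> U \<inter> \<Omega>" "\<And>x. x \<notin> K' \<Longrightarrow> h x = 0"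
    using h(1) by (rule lipcE, blast)
  obtain L1 where L1: "L1-lipschitz_on UNIV g1" using g1 by (rule lipcE, blast)
  obtain L2 where L2: "L2-lipschitz_on UNIV g2" using g2 by (rule lipcE, blast)
  have "g1 \<in> lipc (U \<inter> \<Omega>)"
    by (rule lipcI[OF L1 K'(2,3)]) (use K'(4) testD(3)[OF g] in \<open>auto simp: g1_def min_def intro: antisym\<close>)
  then have t1: "g1 \<in> test U"
    using testD(3,4)[OF g] h(2,3) by (auto simp: test_def g1_def min_le_iff_disj)
  have "g2 \<in> lipc (V \<inter> \<Omega>)"
  proof (rule lipcI[OF L2])
    show "compact (K - W)" using K(2) h(4) by (rule compact_diff)
    show "K - W \<subseteq> V \<inter> \<Omega>" using K(3) h(5) by auto
    show "g2 x = 0" if "x \<notin> K - W" for x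
      using that K(4)[of x] h(6)[of x] testD(3,4)[OF g, of x] h(2)[of x]
      by (auto simp: g2_def g1_def)
  qed
  then have t2: "g2 \<in> test V"
    using testD(3,4)[OF g] h(2,3)
    by (auto simp: test_def g2_def g1_def min_def) (smt (verit, best))+
  have "J (\<lambda>x. g1 x + g2 x) = J g1 + J g2"
    using t1 t2 by (intro J_add g1 g2) (auto dest: testD)
  then have "J g = J g1 + J g2" by (simp add: g2_def)
  then have "ennreal (J g) = ennreal (J g1) + ennreal (J g2)"
    using t1 t2 g1 g2 by (simp add: J_nonneg testD(3))
  also have "\<dots> \<le> content U + content V"
    by (intro add_mono content_upper t1 t2)
  finally show "ennreal (J g) \<le> content U + content V" .
qed

lemma content_UN_finite:
  assumes "\<And>i::nat. open (U i)"
  shows "content (\<Union>i<n. U i) \<le> (\<Sum>i<n. content (U i))"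
proof (induction n)
  case (Suc n)
  have "content (\<Union>i<Suc n. U i) = content ((\<Union>i<n. U i) \<union> U n)"
    by (simp add: lessThan_Suc Un_commute)
  also have "\<dots> \<le> content (\<Union>i<n. U i) + content (U n)"
    using assms by (intro content_Un) auto
  finally show ?case using Suc by (simp add: order_trans[OF _ add_right_mono])
qed (simp add: content_empty)

text \<open>Compactness of the support reduces the countable union to a finite one.\<close>

lemma content_UN:
  assumes "\<And>i::nat. open (U i)"
  shows "content (\<Union>i. U i) \<le> (\<Sum>i. content (U i))"
  unfolding content_def[of "\<Union>i. U i"]
proof (rule SUP_least)
  fix g assume g: "g \<in> test (\<Union>i. U i)"
  obtain L K where K: "L-lipschitz_on UNIV g" "compact K" "K \<subseteq> (\<Union>i. U i) \<inter> \<Omega>" "\<And>x. x \<notin> K \<Longrightarrow> g x = 0"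
    using testD(1)[OF g] by (rule lipcE, blast)
  obtain C where C: "finite C" "K \<subseteq> (\<Union>i\<in>C. U i)"
    using compactE_image[OF K(2), of UNIV U] assms K(3) by auto
  then obtain n where n: "C \<subseteq> {..<n}" using finite_nat_iff_bounded by blast
  have "g \<in> lipc ((\<Union>i<n. U i) \<inter> \<Omega>)"
    by (rule lipcI[OF K(1,2) _ K(4)]) (use C n K(3) in blast)
  then have "g \<in> test (\<Union>i<n. U i)" using g by (simp add: test_def)
  then have "ennreal (J g) \<le> content (\<Union>i<n. U i)" by (rule content_upper)
  also have "\<dots> \<le> (\<Sum>i<n. content (U i))" using assms by (rule content_UN_finite)
  also have "\<dots> \<le> (\<Sum>i. content (U i))" by (intro sum_le_suminf) auto
  finally show "ennreal (J g) \<le> (\<Sum>i. content (U i))" .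
qed

lemma outer_le: "open U \<Longrightarrow> A \<inter> \<Omega> \<subseteq> U \<Longrightarrow> outer A \<le> content U"
  unfolding outer_def by (rule INF_lower) auto

lemma outer_open: "open U \<Longrightarrow> outer U = content U"
  by (rule antisym, simp add: outer_le)
     (auto simp: outer_def intro!: INF_greatest content_mono)

lemma outer_mono: "A \<subseteq> B \<Longrightarrow> outer A \<le> outer B"
  unfolding outer_def by (rule INF_superset_mono) auto

lemma outer_space: "outer_measure_space (Pow UNIV) outer"
  unfolding outer_measure_space_def
proof safe
  show "positive (Pow UNIV) outer"
    by (simp add: positive_def outer_open content_empty)
  show "increasing (Pow UNIV) outer"
    by (auto simp: increasing_def intro: outer_mono)
  show "countably_subadditive (Pow UNIV) outer"
    unfolding countably_subadditive_def
  proof safe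
    fix A :: "nat \<Rightarrow> 'a set"
    show "outer (\<Union>i. A i) \<le> (\<Sum>i. outer (A i))"
    proof (rule ennreal_le_epsilon)
      fix e :: real assume e: "0 < e" "(\<Sum>i. outer (A i)) < top"
      then have "\<And>n. outer (A n) < outer (A n) + e * (1/2)^Suc n"
        by (auto simp add: less_top dest!: ennreal_suminf_lessD)
      then have "(INF U\<in>{U. open U \<and> A n \<inter> \<Omega> \<subseteq> U}. content U) < outer (A n) + e * (1/2)^Suc n" for n
        unfolding outer_def .
      then have "\<exists>U. open U \<and> A n \<inter> \<Omega> \<subseteq> U \<and> content U < outer (A n) + e * (1/2)^Suc n" for n
        unfolding INF_less_iff by auto
      then obtain U where U: "\<And>n. open (U n)" "\<And>n. A n \<inter> \<Omega> \<subseteq> U n"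
        "\<And>n. content (U n) < outer (A n) + e * (1/2)^Suc n"
        by metis
      have "outer (\<Union>i. A i) \<le> content (\<Union>i. U i)"
        using U by (intro outer_le) auto
      also have "\<dots> \<le> (\<Sum>i. content (U i))" using U(1) by (rule content_UN)
      also have "\<dots> \<le> (\<Sum>n. outer (A n) + e * (1/2) ^ Suc n)"
        using U(3) by (intro suminf_le summableI) (auto intro: less_imp_le)
      also have "... = (\<Sum>n. outer (A n)) + (\<Sum>n. ennreal e * ennreal ((1/2) ^ Suc n))"
        using \<open>0 < e\<close> by (subst suminf_add[symmetric])
                         (auto simp del: ennreal_suminf_cmult simp add: ennreal_mult[symmetric])
      also have "\<dots> = (\<Sum>n. outer (A n)) + e"
        unfolding ennreal_suminf_cmult
        by (subst suminf_ennreal_eq[OF zero_le_power power_half_series]) auto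
      finally show "outer (\<Union>i. A i) \<le> (\<Sum>n. outer (A n)) + e" .
    qed
  qed
qed

text \<open>If \<open>g\<close> is a test function for \<open>V \<inter> U\<close> with support in \<open>K\<close>, any test function for \<open>V - K\<close> can be
  added to it without exceeding 1. Hence the Caratheodory condition for open sets.\<close>

lemma content_split:
  assumes "open U" "open V"
  shows "content (V \<inter> U) + outer (V - U) \<le> content V"
proof -
  have "outer (V - U) + ennreal (J g) \<le> content V" if g: "g \<in> test (V \<inter> U)" for g
  proof -
    obtain L K where K: "L-lipschitz_on UNIV g" "compact K" "K \<subseteq> (V \<inter> U) \<inter> \<Omega>" "\<And>x. x \<notin> K \<Longrightarrow> g x = 0"
      using testD(1)[OF g] by (rule lipcE, blast)
    have "open (V - K)" using assms(2) K(2) by (auto intro: compact_imp_closed)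
    then have "outer (V - U) \<le> content (V - K)" using K(3) by (intro outer_le) auto
    also have "content (V - K) + ennreal (J g) \<le> content V"
      unfolding content_def[of "V - K"]
    proof (subst ennreal_SUP_add_left[symmetric])
      show "(SUP h\<in>test (V - K). ennreal (J h) + ennreal (J g)) \<le> content V"
      proof (rule SUP_least)
        fix h assume h: "h \<in> test (V - K)"
        have gh: "g x = 0 \<or> h x = 0" for x
        proof (cases "x \<in> K")
          case True
          have "h x = 0" using testD(1)[OF h] True by (auto elim!: lipcE)
          then show ?thesis ..
        qed (use K(4) in auto)
        have "(\<lambda>x. h x + g x) \<in> lipc (V \<inter> \<Omega>)"
          using testD(1)[OF g] testD(1)[OF h] by (intro lipc_add) (auto intro: lipc_mono)
        moreover have "0 \<le> h x + g x \<and> h x + g x \<le> 1" for x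
          using gh[of x] testD(3,4)[OF g, of x] testD(3,4)[OF h, of x] by auto
        ultimately have t: "(\<lambda>x. h x + g x) \<in> test V" by (auto simp: test_def)
        have "ennreal (J h) + ennreal (J g) = ennreal (J h + J g)"
          using testD[OF g] testD[OF h] by (intro ennreal_plus[symmetric] J_nonneg)
        also have "J h + J g = J (\<lambda>x. h x + g x)"
          using testD[OF g] testD[OF h] by (intro J_add[symmetric])
        also have "ennreal \<dots> \<le> content V" using t by (rule content_upper)
        finally show "ennreal (J h) + ennreal (J g) \<le> content V" .
      qed
    qed (use zero_test in auto)
    finally show ?thesis by (simp add: add_right_mono)
  qed
  then have "(SUP g\<in>test (V \<inter> U). outer (V - U) + ennreal (J g)) \<le> content V"
    by (intro SUP_least)
  moreover have "(SUP g\<in>test (V \<inter> U). outer (V - U) + ennreal (J g)) = outer (V - U) + content (V \<inter> U)"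
    unfolding content_def using zero_test by (intro ennreal_SUP_add_right[symmetric]) auto
  ultimately show ?thesis by (simp add: add.commute)
qed

lemma open_lambda:
  assumes "open U"
  shows "U \<in> lambda_system UNIV (Pow UNIV) outer"
proof -
  have sub: "outer (A \<inter> U) + outer (A - U) \<le> outer A" for A
    unfolding outer_def[of A]
  proof (rule INF_greatest)
    fix V assume V: "V \<in> {V. open V \<and> A \<inter> \<Omega> \<subseteq> V}"
    have "outer (A \<inter> U) \<le> content (V \<inter> U)" using V assms by (intro outer_le) auto
    moreover have "outer (A - U) \<le> outer (V - U)"
      unfolding outer_def by (rule INF_superset_mono) (use V in auto)
    ultimately have "outer (A \<inter> U) + outer (A - U) \<le> content (V \<inter> U) + outer (V - U)"
      by (rule add_mono)
    also have "\<dots> \<le> content V" using V assms by (intro content_split) auto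
    finally show "outer (A \<inter> U) + outer (A - U) \<le> content V" .
  qed
  have "subadditive (Pow UNIV) outer"
    using outer_space by (intro ring_of_sets.countably_subadditive_subadditive[OF ring_of_sets_Pow])
      (auto simp: outer_measure_space_def)
  then have sup: "outer A \<le> outer (A \<inter> U) + outer (A - U)" for A
    using subadditiveD[of "Pow UNIV" outer "A \<inter> U" "A - U"]
    by (metis Int_Diff Int_Un_distrib Diff_disjoint Int_Diff_disjoint Int_Diff_Un PowI subset_UNIV)
  show ?thesis
    using antisym[OF sub sup]
    unfolding algebra.lambda_system_eq[OF algebra_Pow] by blast
qed

definition riesz :: "'a measure" where
  "riesz = measure_of UNIV (sets borel) outer"

lemma sets_riesz [measurable_cong, simp]: "sets riesz = sets borel"
  unfolding riesz_def by (simp add: sigma_algebra.sigma_sets_eq[OF sets.sigma_algebra_axioms[of borel, simplified]])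

text \<open>The Borel sets are Caratheodory measurable because the open sets are.\<close>

lemma emeasure_riesz:
  assumes "A \<in> sets borel"
  shows "emeasure riesz A = outer A"
proof -
  have ms: "measure_space UNIV (lambda_system UNIV (Pow UNIV) outer) outer"
    using sigma_algebra.caratheodory_lemma[OF sigma_algebra_Pow outer_space] .
  then have sa: "sigma_algebra UNIV (lambda_system UNIV (Pow UNIV) outer)"
    by (simp add: measure_space_def)
  have "sets borel \<subseteq> lambda_system UNIV (Pow UNIV) outer"
    unfolding borel_def using open_lambda
    by (subst sets_measure_of, simp, intro sigma_algebra.sigma_sets_subset[OF sa]) auto
  then have "measure_space UNIV (sets borel) outer"
    using measure_down[OF ms] sets.sigma_algebra_axioms[of borel] by simp
  then have "countably_additive (sets borel) outer" "positive (sets borel) outer"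
    by (auto simp: measure_space_def)
  then show ?thesis
    using assms by (intro emeasure_measure_of[OF riesz_def]) (simp_all)
qed

lemma emeasure_riesz_open: "open U \<Longrightarrow> emeasure riesz U = content U"
  by (simp add: emeasure_riesz outer_open)

lemma riesz_outside: "emeasure riesz (- \<Omega>) = 0"
proof -
  have "outer (- \<Omega>) \<le> content {}" by (rule outer_le) auto
  then show ?thesis using open_Omega by (simp add: emeasure_riesz content_empty)
qed

lemma content_le:
  assumes "h \<in> lipc \<Omega>" "\<And>x. 0 \<le> h x" "\<And>x. x \<in> W \<Longrightarrow> 1 \<le> h x"
  shows "content W \<le> ennreal (J h)"
  unfolding content_def
proof (rule SUP_least)
  fix g assume g: "g \<in> test W"
  have "g x \<le> h x" for x
  proof (cases "x \<in> W")
    case True then show ?thesis using testD(4)[OF g, of x] assms(3)[of x] by linarith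
  next
    case False
    then have "g x = 0" using testD(1)[OF g] by (auto elim!: lipcE)
    then show ?thesis using assms(2) by simp
  qed
  then have "J g \<le> J h" using assms testD[OF g] by (intro J_mono)
  then show "ennreal (J g) \<le> ennreal (J h)" by (rule ennreal_leI)
qed

lemma riesz_compact:
  assumes "compact K" "K \<subseteq> \<Omega>"
  shows "emeasure riesz K < \<infinity>"
proof -
  obtain h W where h: "h \<in> lipc \<Omega>" "\<And>x. 0 \<le> h x" "\<And>x. h x \<le> (1::real)"
    "open W" "K \<subseteq> W" "\<And>x. x \<in> W \<Longrightarrow> h x = 1"
    using lipc_cutoff[OF assms(1) open_Omega assms(2)] by blast
  have "emeasure riesz K \<le> emeasure riesz W"
    using h by (intro emeasure_mono) auto
  also have "\<dots> = content W" using h by (simp add: emeasure_riesz_open)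
  also have "\<dots> \<le> ennreal (J h)" using h by (intro content_le) auto
  also have "\<dots> < \<infinity>" by simp
  finally show ?thesis .
qed

text \<open>A Chebyshev inequality for \<open>J\<close>: a test function \<open>h\<close> for \<open>{g > c}\<close> satisfies
  \<open>c h \<le> min g c\<close>.\<close>

lemma level_set_le:
  assumes g: "g \<in> lipc \<Omega>" "\<And>x. 0 \<le> g x" and c: "0 < c"
  shows "ennreal c * emeasure riesz {x. g x > c} \<le> ennreal (J (\<lambda>x. min (g x) c))"
proof -
  have op: "open {x. g x > c}"
    using lipc_continuous[OF g(1)] by (intro open_Collect_less) auto
  have m: "(\<lambda>x. min (g x) c) \<in> lipc \<Omega>" using g c by (intro lipc_below) auto
  have "content {x. g x > c} \<le> ennreal (J (\<lambda>x. (1 / c) * min (g x) c))"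
    using g c m by (intro content_le lipc_cmult) (auto simp: field_simps min_def)
  also have "J (\<lambda>x. (1 / c) * min (g x) c) = (1 / c) * J (\<lambda>x. min (g x) c)"
    using g c m by (intro J_scale) auto
  finally have "ennreal c * content {x. g x > c} \<le> ennreal c * ennreal ((1 / c) * J (\<lambda>x. min (g x) c))"
    by (rule mult_left_mono) simp
  also have "\<dots> = ennreal (J (\<lambda>x. min (g x) c))"
    using c m g by (subst ennreal_mult[symmetric]) (auto intro!: divide_nonneg_pos J_nonneg)
  finally show ?thesis by (simp add: emeasure_riesz_open[OF op])
qed

text \<open>Slicing \<open>g\<close> into layers of height \<open>c\<close>: by the Chebyshev inequality \<open>J\<close> of each
  layer bounds the integral of the layer above it. The induction is on the number of layers,
  which costs exactly one layer, the lowest.\<close>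

lemma nn_integral_above_le:
  assumes "0 < c" "g \<in> lipc \<Omega>" "\<And>x. 0 \<le> g x" "\<And>x. g x \<le> real k * c"
  shows "(\<integral>\<^sup>+x. ennreal (max (g x - c) 0) \<partial>riesz) \<le> ennreal (J g)"
  using assms(2-)
proof (induction k arbitrary: g)
  case 0
  then have "max (g x - c) 0 = 0" for x using assms(1) by (smt (verit) mult_eq_0_iff of_nat_0)
  then show ?case by simp
next
  case (Suc k)
  define g' where "g' = (\<lambda>x. max (g x - c) 0)"
  have g': "g' \<in> lipc \<Omega>" "\<And>x. 0 \<le> g' x"
    unfolding g'_def using Suc assms(1) by (auto intro: lipc_above)
  have le: "g' x \<le> real k * c" for x
    using Suc.prems(3)[of x] assms(1) by (simp add: g'_def algebra_simps)
  have m: "(\<lambda>x. min (g x) c) \<in> lipc \<Omega>" "\<And>x. 0 \<le> min (g x) c"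
    using Suc assms(1) by (auto intro!: lipc_below)
  have "(\<integral>\<^sup>+x. ennreal (g' x) \<partial>riesz) \<le>
      (\<integral>\<^sup>+x. ennreal (max (g' x - c) 0) + ennreal c * indicator {x. g x > c} x \<partial>riesz)"
  proof (rule nn_integral_mono)
    fix x
    show "ennreal (g' x) \<le> ennreal (max (g' x - c) 0) + ennreal c * indicator {x. g x > c} x"
    proof (cases "g x > c")
      case True
      have "ennreal (g' x) \<le> ennreal (max (g' x - c) 0 + c)"
        by (rule ennreal_leI) auto
      also have "\<dots> = ennreal (max (g' x - c) 0) + ennreal c"
        using assms(1) by (intro ennreal_plus) auto
      finally show ?thesis using True by simp
    qed (simp add: g'_def)
  qed
  also have "\<dots> = (\<integral>\<^sup>+x. ennreal (max (g' x - c) 0) \<partial>riesz) + ennreal c * emeasure riesz {x. g x > c}"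
    using lipc_borel[OF g'(1)] lipc_borel[OF Suc.prems(1)]
    by (subst nn_integral_add) (auto intro!: borel_measurable_indicator nn_integral_cmult_indicator)
  also have "\<dots> \<le> ennreal (J g') + ennreal (J (\<lambda>x. min (g x) c))"
    by (intro add_mono Suc.IH[OF g' le] level_set_le Suc.prems assms(1))
  also have "\<dots> = ennreal (J g' + J (\<lambda>x. min (g x) c))"
    using g' m by (intro ennreal_plus[symmetric] J_nonneg)
  also have "J g' + J (\<lambda>x. min (g x) c) = J (\<lambda>x. g' x + min (g x) c)"
    using g' m by (intro J_add[symmetric])
  also have "(\<lambda>x. g' x + min (g x) c) = g" by (auto simp: g'_def)
  finally show ?case by (simp add: g'_def)
qed

text \<open>The lowest layer contributes at most \<open>c\<close> times the measure of the support, and \<open>c\<close> is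
  arbitrary.\<close>

lemma nn_integral_riesz_le:
  assumes g: "g \<in> lipc \<Omega>" "\<And>x. 0 \<le> g x"
  shows "(\<integral>\<^sup>+x. ennreal (g x) \<partial>riesz) \<le> ennreal (J g)"
proof -
  obtain L K where K: "L-lipschitz_on UNIV g" "compact K" "K \<subseteq> \<Omega>" "\<And>x. x \<notin> K \<Longrightarrow> g x = 0"
    using g(1) by (rule lipcE, blast)
  obtain B where B: "B > 0" "\<And>x. norm (g x) \<le> B" using g(1) by (rule lipc_bounded, blast)
  obtain M where M: "emeasure riesz K = ennreal M" "M \<ge> 0"
    using riesz_compact[OF K(2,3)] by (cases "emeasure riesz K") auto
  have *: "(\<integral>\<^sup>+x. ennreal (g x) \<partial>riesz) \<le> ennreal (J g) + ennreal (c * M)" if c: "0 < c" for c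
  proof -
    obtain k where k: "B < real k * c" using reals_Archimedean3[OF c] by blast
    have "(\<integral>\<^sup>+x. ennreal (g x) \<partial>riesz) \<le>
        (\<integral>\<^sup>+x. ennreal (max (g x - c) 0) + ennreal c * indicator K x \<partial>riesz)"
    proof (rule nn_integral_mono)
      fix x
      show "ennreal (g x) \<le> ennreal (max (g x - c) 0) + ennreal c * indicator K x"
      proof (cases "x \<in> K")
        case True
        have "ennreal (g x) \<le> ennreal (max (g x - c) 0 + c)"
          by (rule ennreal_leI) auto
        also have "\<dots> = ennreal (max (g x - c) 0) + ennreal c"
          using c by (intro ennreal_plus) auto
        finally show ?thesis using True by simp
      qed (simp add: K(4))
    qed
    also have "\<dots> = (\<integral>\<^sup>+x. ennreal (max (g x - c) 0) \<partial>riesz) + ennreal c * emeasure riesz K"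
      using lipc_borel[OF g(1)] borel_compact[OF K(2)]
      by (subst nn_integral_add) (auto intro!: borel_measurable_indicator nn_integral_cmult_indicator)
    also have "\<dots> \<le> ennreal (J g) + ennreal c * emeasure riesz K"
      using B k by (intro add_right_mono nn_integral_above_le[OF c g, of k])
        (metis abs_le_D1 less_imp_le order_trans real_norm_def)
    also have "ennreal c * emeasure riesz K = ennreal (c * M)"
      using c M by (simp add: ennreal_mult)
    finally show ?thesis .
  qed
  show ?thesis
  proof (rule ennreal_le_epsilon)
    fix e :: real assume "0 < e"
    then have e: "0 < e / (M + 1)" using M(2) by simp
    have "ennreal (e / (M + 1) * M) \<le> ennreal e"
      using \<open>0 < e\<close> M(2) by (intro ennreal_leI) (simp add: field_simps)
    then show "(\<integral>\<^sup>+x. ennreal (g x) \<partial>riesz) \<le> ennreal (J g) + ennreal e"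
      using *[OF e] by (meson add_left_mono order_trans)
  qed
qed

lemma integrable_riesz: 
  assumes g: "g \<in> lipc \<Omega>" "\<And>x. 0 \<le> g x"
  shows "integrable riesz g" "(\<integral>x. g x \<partial>riesz) \<le> J g"
proof -
  have fin: "(\<integral>\<^sup>+x. ennreal (g x) \<partial>riesz) < \<infinity>"
    using nn_integral_riesz_le[OF g] by (simp add: le_less_trans)
  then show i: "integrable riesz g"
    using g lipc_borel[OF g(1)] by (intro integrableI_nonneg) auto
  have "ennreal (\<integral>x. g x \<partial>riesz) \<le> ennreal (J g)"
    using nn_integral_riesz_le[OF g] nn_integral_eq_integral[OF i] g(2) by simp
  then show "(\<integral>x. g x \<partial>riesz) \<le> J g"
    using J_nonneg[OF g] by (simp add: ennreal_le_iff)
qed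

text \<open>The reverse inequality follows from the proved one applied to \<open>B h - g\<close>, where \<open>B\<close> bounds \<open>g\<close>
  and \<open>h\<close> is a cutoff of the support for which \<open>J h\<close> and \<open>\<integral> h\<close> differ by at most \<open>e\<close>. Such a cutoff
  exists because the measure of the support is the infimum of the contents of its open
  neighbourhoods.\<close>

theorem integral_riesz:
  assumes g: "g \<in> lipc \<Omega>" "\<And>x. 0 \<le> g x"
  shows "(\<integral>x. g x \<partial>riesz) = J g"
proof (rule antisym[OF integrable_riesz(2)[OF g]])
  obtain L K where K: "L-lipschitz_on UNIV g" "compact K" "K \<subseteq> \<Omega>" "\<And>x. x \<notin> K \<Longrightarrow> g x = 0"
    using g(1) by (rule lipcE, blast)
  obtain B where B: "B > 0" "\<And>x. norm (g x) \<le> B" using g(1) by (rule lipc_bounded, blast)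
  have Kb: "K \<in> sets borel" using K(2) by (rule borel_compact)
  obtain M where M: "emeasure riesz K = ennreal M" "M \<ge> 0"
    using riesz_compact[OF K(2,3)] by (cases "emeasure riesz K") auto
  have *: "J g \<le> (\<integral>x. g x \<partial>riesz) + B * e" if e: "0 < e" for e
  proof -
    have "outer K < ennreal (M + e)"
      using M e by (simp add: emeasure_riesz[OF Kb, symmetric] ennreal_less_iff)
    \<comment> \<open>The cutoff is a test function for a neighbourhood of \<open>K\<close> of almost the same content.\<close>
    then obtain U where U: "open U" "K \<inter> \<Omega> \<subseteq> U" "content U < ennreal (M + e)"
      unfolding outer_def by (auto simp: INF_less_iff)
    have "K \<subseteq> U \<inter> \<Omega>" using U K by auto
    moreover have "open (U \<inter> \<Omega>)" using U open_Omega by auto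
    ultimately obtain h W where h: "h \<in> lipc (U \<inter> \<Omega>)" "\<And>x. 0 \<le> h x" "\<And>x. h x \<le> (1::real)"
      "open W" "K \<subseteq> W" "\<And>x. x \<in> W \<Longrightarrow> h x = 1"
      using lipc_cutoff[OF K(2)] by blast
    have h': "h \<in> lipc \<Omega>" using h(1) by (rule lipc_mono) auto
    have "h \<in> test U" using h by (auto simp: test_def)
    then have "ennreal (J h) < ennreal (M + e)"
      using content_upper U(3) le_less_trans by blast
    then have Jh: "J h < M + e" using J_nonneg[OF h' h(2)] by (simp add: ennreal_less_iff)
    have gh: "g x \<le> B * h x" for x
    proof (cases "x \<in> K")
      case True then show ?thesis using h(5,6) B(2)[of x] by auto
    qed (use K(4) h(2) B in auto)
    have d: "(\<lambda>x. B * h x - g x) \<in> lipc \<Omega>" by (intro lipc_diff lipc_cmult h' g)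
    have "M = measure riesz K" using M by (simp add: measure_def)
    also have "\<dots> = (\<integral>x. indicator K x \<partial>riesz)" using Kb by simp
    also have "\<dots> \<le> (\<integral>x. h x \<partial>riesz)"
    proof (rule integral_mono)
      show "integrable riesz (indicat_real K)" using M Kb by (simp add: integrable_indicator_iff)
      show "indicat_real K x \<le> h x" for x
        using h(2)[of x] h(5,6) by (auto simp: indicator_def)
    qed (rule integrable_riesz[OF h' h(2)])
    finally have "J h - (\<integral>x. h x \<partial>riesz) \<le> e" using Jh by simp
    then have "B * J h - B * (\<integral>x. h x \<partial>riesz) \<le> B * e"
      using B(1) by (simp add: right_diff_distrib[symmetric])
    moreover have "(\<integral>x. B * h x - g x \<partial>riesz) \<le> J (\<lambda>x. B * h x - g x)"
      using gh by (intro integrable_riesz(2)[OF d]) auto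
    moreover have "(\<integral>x. B * h x - g x \<partial>riesz) = B * (\<integral>x. h x \<partial>riesz) - (\<integral>x. g x \<partial>riesz)"
      using integrable_riesz(1)[OF g] integrable_riesz(1)[OF h' h(2)] by simp
    moreover have "J (\<lambda>x. (B * h x - g x) + g x) = J (\<lambda>x. B * h x - g x) + J g"
      using gh g by (intro J_add d) auto
    moreover have "J (\<lambda>x. B * h x) = B * J h" using B h' h by (intro J_scale) auto
    ultimately show ?thesis by simp
  qed
  show "J g \<le> (\<integral>x. g x \<partial>riesz)"
  proof (rule field_le_epsilon)
    fix e :: real assume "0 < e"
    then have "0 < e / B" using B(1) by simp
    from *[OF this] show "J g \<le> (\<integral>x. g x \<partial>riesz) + e" using B(1) by simp
  qed
qed

end

section \<open>Locally bounded functionals on vector fields\<close>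

lemma compact_exhaustion:
  fixes \<Omega> :: "'a::euclidean_space set"
  assumes "open \<Omega>"
  shows "\<exists>C::nat \<Rightarrow> 'a set. (\<forall>n. compact (C n)) \<and> (\<forall>n. C n \<subseteq> \<Omega>) \<and> (\<forall>n. C n \<subseteq> interior (C (Suc n))) \<and> \<Union>(range C) = \<Omega>"
proof (rule open_Union_compact_subsets[OF assms])
  fix C :: "nat \<Rightarrow> 'a set"
  assume C: "\<And>n. compact (C n)" "\<And>n. C n \<subseteq> \<Omega>" "\<And>n. C n \<subseteq> interior (C (Suc n))" "\<Union>(range C) = \<Omega>"
  show ?thesis
    by (rule exI[of _ C]) (simp add: C)
qed

text \<open>Measures on \<open>\<Omega>\<close> are handled as Borel measures on the whole space that give no mass to the
  complement, which avoids restricted \<open>\<sigma>\<close>-algebras in all integrals.\<close>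

definition locally_finite_on :: "'a::topological_space set \<Rightarrow> 'a measure \<Rightarrow> bool" where
  "locally_finite_on \<Omega> N \<longleftrightarrow> sets N = sets borel \<and> emeasure N (- \<Omega>) = 0 \<and>
     (\<forall>K. compact K \<and> K \<subseteq> \<Omega> \<longrightarrow> emeasure N K < \<infinity>)"

lemma locally_finite_onD:
  assumes "locally_finite_on \<Omega> N"
  shows "sets N = sets borel" "space N = UNIV" "emeasure N (- \<Omega>) = 0"
    "\<And>K. compact K \<Longrightarrow> K \<subseteq> \<Omega> \<Longrightarrow> emeasure N K < \<infinity>"
  using assms sets_eq_imp_space_eq[of N borel] unfolding locally_finite_on_def by auto

lemma locally_finite_sigma_finite:
  fixes \<Omega> :: "'a::euclidean_space set"
  assumes N: "locally_finite_on \<Omega> N" and "open \<Omega>"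
  shows "sigma_finite_measure N"
proof -
  obtain C :: "nat \<Rightarrow> 'a set" where "\<forall>n. compact (C n)" "\<forall>n. C n \<subseteq> \<Omega>" and C3: "\<Union>(range C) = \<Omega>"
    using compact_exhaustion[OF assms(2)] by (elim exE conjE) (rule that)
  then have C: "compact (C n)" "C n \<subseteq> \<Omega>" for n by auto
  show ?thesis
  proof
    have "countable (insert (- \<Omega>) (range C))" by (intro countable_insert countable_image) simp
    moreover have "insert (- \<Omega>) (range C) \<subseteq> sets N"
      using C(1) assms(2) by (auto simp: locally_finite_onD(1)[OF N] borel_compact)
    moreover have "\<Union> (insert (- \<Omega>) (range C)) = space N"
      using C3 by (simp add: locally_finite_onD(2)[OF N])
    moreover have "emeasure N a \<noteq> \<infinity>" if a: "a \<in> insert (- \<Omega>) (range C)" for a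
    proof (cases "a = - \<Omega>")
      case False
      then obtain n where "a = C n" using a by blast
      then show ?thesis using locally_finite_onD(4)[OF N C(1,2), of n] by simp
    qed (simp add: locally_finite_onD(3)[OF N])
    ultimately show "\<exists>A. countable A \<and> A \<subseteq> sets N \<and> \<Union> A = space N \<and> (\<forall>a\<in>A. emeasure N a \<noteq> \<infinity>)"
      by (intro exI[of _ "insert (- \<Omega>) (range C)"] conjI ballI)
  qed
qed

lemma lipc_integrable:
  fixes g :: "'a::euclidean_space \<Rightarrow> 'b::euclidean_space"
  assumes N: "locally_finite_on \<Omega> N" and g: "g \<in> lipc \<Omega>"
  shows "integrable N g"
proof -
  obtain L K where K: "L-lipschitz_on UNIV g" "compact K" "K \<subseteq> \<Omega>" "\<And>x. x \<notin> K \<Longrightarrow> g x = 0"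
    using g by (rule lipcE, blast)
  obtain B where B: "B > 0" "\<And>x. norm (g x) \<le> B" using g by (rule lipc_bounded, blast)
  have [measurable_cong]: "sets N = sets borel" using N by (rule locally_finite_onD)
  have [measurable]: "g \<in> borel_measurable borel" using g by (rule lipc_borel)
  have "K \<in> sets N" using locally_finite_onD(1)[OF N] K(2) by (simp add: borel_compact)
  then have "integrable N (\<lambda>x. B * indicat_real K x)"
    using locally_finite_onD(4)[OF N K(2,3)] by (simp add: integrable_indicator_iff)
  then show ?thesis
  proof (rule Bochner_Integration.integrable_bound)
    show "AE x in N. norm (g x) \<le> norm (B * indicat_real K x)"
      using B K(4) by (intro AE_I2) (auto simp: indicator_def)
  qed measurable
qed

text \<open>The quotient \<open>g / (g + h)\<close> need not be Lipschitz, but it occurs multiplied by \<open>\<phi>\<close>, which is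
  dominated by its denominator: with \<open>s = g + h\<close> and \<open>q = g / s\<close>, the difference
  \<open>s y * (q x - q y) = q x * (s y - s x) + (g x - g y)\<close> is Lipschitz. Where \<open>s\<close> vanishes, so
  does \<open>\<phi>\<close>, and division by zero is harmless.\<close>

lemma lipc_split:
  fixes \<phi> :: "'a::metric_space \<Rightarrow> 'b::real_normed_vector"
  assumes \<phi>: "\<phi> \<in> lipc \<Omega>" and g: "g \<in> lipc \<Omega>" and h: "h \<in> lipc \<Omega>"
    and nn: "\<And>x. 0 \<le> g x" "\<And>x. 0 \<le> h x" and le: "\<And>x. norm (\<phi> x) \<le> g x + h x"
  shows "(\<lambda>x. (g x / (g x + h x)) *\<^sub>R \<phi> x) \<in> lipc \<Omega>"
proof -
  obtain L K where K: "L-lipschitz_on UNIV \<phi>" "compact K" "K \<subseteq> \<Omega>" "\<And>x. x \<notin> K \<Longrightarrow> \<phi> x = 0"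
    using \<phi> by (rule lipcE, blast)
  obtain Lg where Lg: "Lg-lipschitz_on UNIV g" using g by (rule lipcE, blast)
  obtain Lh where Lh: "Lh-lipschitz_on UNIV h" using h by (rule lipcE, blast)
  define s where "s = (\<lambda>x. g x + h x)"
  have Ls: "(Lg + Lh)-lipschitz_on UNIV s" unfolding s_def by (intro lipschitz_intros Lg Lh)
  have L0: "0 \<le> L" "0 \<le> Lg" "0 \<le> Lh" using K(1) Lg Lh lipschitz_on_nonneg by auto
  define q where "q = (\<lambda>x. g x / s x)"
  have q: "0 \<le> q x" "q x \<le> 1" "q x * s x = g x" for x
    using nn[of x] by (auto simp: q_def s_def divide_le_eq_1)
  have s: "norm (\<phi> x) \<le> s x" "0 \<le> s x" for x using le nn by (auto simp: s_def)
  have "(L + (Lg + (Lg + Lh)))-lipschitz_on UNIV (\<lambda>x. q x *\<^sub>R \<phi> x)"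
  proof (rule lipschitz_onI)
    fix x y
    have "s y * (q x - q y) = q x * (s y - s x) + (g x - g y)"
      using q(3)[of x] q(3)[of y] by (simp add: algebra_simps)
    moreover have "\<bar>q x * (s y - s x)\<bar> \<le> 1 * ((Lg + Lh) * dist x y)"
      unfolding abs_mult using lipschitz_onD[OF Ls, of x y] q[of x]
      by (intro mult_mono) (auto simp: dist_real_def abs_minus_commute)
    moreover have "\<bar>g x - g y\<bar> \<le> Lg * dist x y"
      using lipschitz_onD[OF Lg, of x y] by (auto simp: dist_real_def)
    ultimately have A: "s y * \<bar>q x - q y\<bar> \<le> (Lg + (Lg + Lh)) * dist x y"
    proof -
      assume *: "s y * (q x - q y) = q x * (s y - s x) + (g x - g y)"
        "\<bar>q x * (s y - s x)\<bar> \<le> 1 * ((Lg + Lh) * dist x y)" "\<bar>g x - g y\<bar> \<le> Lg * dist x y"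
      have "s y * \<bar>q x - q y\<bar> = \<bar>s y * (q x - q y)\<bar>" using s(2)[of y] by (simp add: abs_mult)
      also have "\<dots> \<le> (Lg + Lh) * dist x y + Lg * dist x y" unfolding *(1) using *(2,3) by linarith
      finally show ?thesis by (simp add: algebra_simps)
    qed
    have "norm (q x *\<^sub>R \<phi> x - q y *\<^sub>R \<phi> y) = norm (q x *\<^sub>R (\<phi> x - \<phi> y) + (q x - q y) *\<^sub>R \<phi> y)"
      by (simp add: algebra_simps)
    also have "\<dots> \<le> q x * norm (\<phi> x - \<phi> y) + \<bar>q x - q y\<bar> * norm (\<phi> y)"
      using q(1)[of x] by (intro norm_triangle_le) auto
    also have "\<dots> \<le> 1 * (L * dist x y) + \<bar>q x - q y\<bar> * s y"
      using lipschitz_onD[OF K(1), of x y] q[of x] s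
      by (intro add_mono mult_mono) (auto simp: dist_norm)
    also have "\<dots> \<le> (L + (Lg + (Lg + Lh))) * dist x y"
      using A by (simp add: algebra_simps)
    finally show "dist (q x *\<^sub>R \<phi> x) (q y *\<^sub>R \<phi> y) \<le> (L + (Lg + (Lg + Lh))) * dist x y"
      by (simp add: dist_norm)
  qed (use L0 in auto)
  then show ?thesis
    unfolding q_def s_def by (rule lipcI[OF _ K(2,3)]) (use K(4) in auto)
qed

locale local_vector_functional =
  fixes \<Omega> :: "'a::euclidean_space set"
    and T :: "('a \<Rightarrow> 'b::euclidean_space) \<Rightarrow> real"
  assumes open_domain: "open \<Omega>"
    and T_add: "\<And>\<phi> \<psi>. \<phi> \<in> lipc \<Omega> \<Longrightarrow> \<psi> \<in> lipc \<Omega> \<Longrightarrow> T (\<lambda>x. \<phi> x + \<psi> x) = T \<phi> + T \<psi>"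
    and T_scale: "\<And>\<phi> c. \<phi> \<in> lipc \<Omega> \<Longrightarrow> T (\<lambda>x. c *\<^sub>R \<phi> x) = c * T \<phi>"
    and T_bounded: "\<And>K. compact K \<Longrightarrow> K \<subseteq> \<Omega> \<Longrightarrow>
      \<exists>C. \<forall>\<phi>\<in>lipc \<Omega>. (\<forall>x. x \<notin> K \<longrightarrow> \<phi> x = 0) \<longrightarrow> (\<forall>x. norm (\<phi> x) \<le> 1) \<longrightarrow> T \<phi> \<le> C"
begin

definition dominated :: "('a \<Rightarrow> real) \<Rightarrow> ('a \<Rightarrow> 'b) set" where
  "dominated g = {\<phi> \<in> lipc \<Omega>. \<forall>x. norm (\<phi> x) \<le> g x}"

text \<open>The modulus \<open>|T|\<close> in the sense of vector lattices.\<close>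

definition modulus :: "('a \<Rightarrow> real) \<Rightarrow> real" where
  "modulus g = (SUP \<phi>\<in>dominated g. T \<phi>)"

lemma T_zero: "T (\<lambda>x. 0) = 0"
  using T_scale[OF lipc_zero, of 0] by simp

lemma zero_dominated: "(\<And>x. 0 \<le> g x) \<Longrightarrow> (\<lambda>x. 0) \<in> dominated g"
  by (simp add: dominated_def lipc_zero)

text \<open>A field dominated by \<open>g\<close> is a bounded multiple of a field with values in the unit ball and
  support in that of \<open>g\<close>.\<close>

lemma bdd_above_dominated:
  assumes "g \<in> lipc \<Omega>"
  shows "bdd_above (T ` dominated g)"
proof -
  obtain L K where K: "L-lipschitz_on UNIV g" "compact K" "K \<subseteq> \<Omega>" "\<And>x. x \<notin> K \<Longrightarrow> g x = 0"
    using assms by (rule lipcE, blast)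
  obtain B where B: "B > 0" "\<And>x. norm (g x) \<le> B" using assms by (rule lipc_bounded, blast)
  obtain C where C: "\<And>\<phi>. \<phi> \<in> lipc \<Omega> \<Longrightarrow> (\<And>x. x \<notin> K \<Longrightarrow> \<phi> x = 0) \<Longrightarrow> (\<And>x. norm (\<phi> x) \<le> 1) \<Longrightarrow> T \<phi> \<le> C"
    using T_bounded[OF K(2,3)] by blast
  have "T \<phi> \<le> B * C" if "\<phi> \<in> dominated g" for \<phi>
  proof -
    have \<phi>: "\<phi> \<in> lipc \<Omega>" "\<And>x. norm (\<phi> x) \<le> g x" using that by (auto simp: dominated_def)
    have "T (\<lambda>x. (1 / B) *\<^sub>R \<phi> x) \<le> C"
    proof (rule C)
      show "(\<lambda>x. (1 / B) *\<^sub>R \<phi> x) \<in> lipc \<Omega>" using \<phi>(1) by (rule lipc_scaleR)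
      show "(1 / B) *\<^sub>R \<phi> x = 0" if "x \<notin> K" for x using K(4)[OF that] \<phi>(2)[of x] by simp
      show "norm ((1 / B) *\<^sub>R \<phi> x) \<le> 1" for x
        using \<phi>(2)[of x] B(2)[of x] B(1) by (simp add: field_simps)
    qed
    then show ?thesis using T_scale[OF \<phi>(1), of "1 / B"] B(1) by (simp add: field_simps)
  qed
  then show ?thesis by (auto intro!: bdd_aboveI)
qed

lemma T_le_modulus: "g \<in> lipc \<Omega> \<Longrightarrow> \<phi> \<in> dominated g \<Longrightarrow> T \<phi> \<le> modulus g"
  unfolding modulus_def by (intro cSUP_upper bdd_above_dominated)

lemma modulus_le: "(\<And>x. 0 \<le> g x) \<Longrightarrow> (\<And>\<phi>. \<phi> \<in> dominated g \<Longrightarrow> T \<phi> \<le> C) \<Longrightarrow> modulus g \<le> C"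
  unfolding modulus_def using zero_dominated[of g] by (intro cSUP_least) auto

lemma modulus_nonneg: "g \<in> lipc \<Omega> \<Longrightarrow> (\<And>x. 0 \<le> g x) \<Longrightarrow> 0 \<le> modulus g"
  using T_le_modulus[OF _ zero_dominated] T_zero by fastforce

text \<open>Superadditivity adds dominated fields; for subadditivity a field dominated by \<open>g + h\<close> is
  decomposed in the ratio \<open>g : h\<close>.\<close>

lemma modulus_add:
  assumes g: "g \<in> lipc \<Omega>" "\<And>x. 0 \<le> g x" and h: "h \<in> lipc \<Omega>" "\<And>x. 0 \<le> h x"
  shows "modulus (\<lambda>x. g x + h x) = modulus g + modulus h"
proof (rule antisym)
  show "modulus (\<lambda>x. g x + h x) \<le> modulus g + modulus h"
  proof (rule modulus_le)
    fix \<phi> assume "\<phi> \<in> dominated (\<lambda>x. g x + h x)"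
    then have \<phi>: "\<phi> \<in> lipc \<Omega>" "\<And>x. norm (\<phi> x) \<le> g x + h x" by (auto simp: dominated_def)
    define \<phi>1 where "\<phi>1 = (\<lambda>x. (g x / (g x + h x)) *\<^sub>R \<phi> x)"
    define \<phi>2 where "\<phi>2 = (\<lambda>x. \<phi> x - \<phi>1 x)"
    have l1: "\<phi>1 \<in> lipc \<Omega>" unfolding \<phi>1_def by (intro lipc_split \<phi> g h)
    have l2: "\<phi>2 \<in> lipc \<Omega>" unfolding \<phi>2_def by (intro lipc_diff l1 \<phi>)
    have "norm (\<phi>1 x) \<le> g x" for x
    proof (cases "g x + h x = 0")
      case False
      then have "norm (\<phi>1 x) \<le> (g x / (g x + h x)) * (g x + h x)"
        unfolding \<phi>1_def norm_scaleR using g(2)[of x] h(2)[of x] \<phi>(2)[of x] by (intro mult_mono) auto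
      then show ?thesis using False by simp
    qed (use g in \<open>simp add: \<phi>1_def\<close>)
    moreover have "norm (\<phi>2 x) \<le> h x" for x
    proof (cases "g x + h x = 0")
      case False
      then have "\<phi>2 x = (h x / (g x + h x)) *\<^sub>R \<phi> x"
      proof -
        have "h x / (g x + h x) = 1 - g x / (g x + h x)" using False by (simp add: field_simps)
        then show ?thesis by (simp add: \<phi>2_def \<phi>1_def scaleR_left_diff_distrib)
      qed
      then have "norm (\<phi>2 x) \<le> (h x / (g x + h x)) * (g x + h x)"
        using g(2)[of x] h(2)[of x] \<phi>(2)[of x] by (simp only: norm_scaleR) (intro mult_mono, auto)
      then show ?thesis using False by simp
    next
      case True
      then show ?thesis using \<phi>(2)[of x] h(2)[of x] by (simp add: \<phi>2_def \<phi>1_def)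
    qed
    ultimately have "T \<phi>1 \<le> modulus g" "T \<phi>2 \<le> modulus h"
      by (intro T_le_modulus g h; simp add: dominated_def l1 l2)+
    moreover have "T (\<lambda>x. \<phi>1 x + \<phi>2 x) = T \<phi>1 + T \<phi>2" by (intro T_add l1 l2)
    ultimately show "T \<phi> \<le> modulus g + modulus h" by (simp add: \<phi>2_def)
  qed (use g h in auto)
next
  have gh: "(\<lambda>x. g x + h x) \<in> lipc \<Omega>" by (intro lipc_add g h)
  have "T \<phi> \<le> modulus (\<lambda>x. g x + h x) - T \<psi>" if "\<phi> \<in> dominated g" "\<psi> \<in> dominated h" for \<phi> \<psi>
  proof -
    have "(\<lambda>x. \<phi> x + \<psi> x) \<in> dominated (\<lambda>x. g x + h x)"
      using that by (simp add: dominated_def lipc_add norm_triangle_mono)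
    then have "T (\<lambda>x. \<phi> x + \<psi> x) \<le> modulus (\<lambda>x. g x + h x)" by (rule T_le_modulus[OF gh])
    moreover have "T (\<lambda>x. \<phi> x + \<psi> x) = T \<phi> + T \<psi>"
      using that by (intro T_add) (auto simp: dominated_def)
    ultimately show ?thesis by simp
  qed
  then have "modulus g \<le> modulus (\<lambda>x. g x + h x) - T \<psi>" if "\<psi> \<in> dominated h" for \<psi>
    using that by (intro modulus_le g)
  then have "T \<psi> \<le> modulus (\<lambda>x. g x + h x) - modulus g" if "\<psi> \<in> dominated h" for \<psi>
    by (smt (verit) that)
  then have "modulus h \<le> modulus (\<lambda>x. g x + h x) - modulus g" by (intro modulus_le h)
  then show "modulus g + modulus h \<le> modulus (\<lambda>x. g x + h x)" by simp
qed

lemma modulus_scale_le: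
  assumes g: "g \<in> lipc \<Omega>" "\<And>x. 0 \<le> g x" and c: "0 < c"
  shows "modulus (\<lambda>x. c * g x) \<le> c * modulus g"
proof (rule modulus_le)
  fix \<phi> assume "\<phi> \<in> dominated (\<lambda>x. c * g x)"
  then have \<phi>: "\<phi> \<in> lipc \<Omega>" "\<And>x. norm (\<phi> x) \<le> c * g x" by (auto simp: dominated_def)
  then have "(\<lambda>x. (1 / c) *\<^sub>R \<phi> x) \<in> dominated g"
    using c by (auto simp: dominated_def field_simps intro!: lipc_scaleR)
  then have "T (\<lambda>x. (1 / c) *\<^sub>R \<phi> x) \<le> modulus g" by (rule T_le_modulus[OF g(1)])
  then show "T \<phi> \<le> c * modulus g" using T_scale[OF \<phi>(1), of "1 / c"] c by (simp add: field_simps)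
qed (use g c in auto)

lemma modulus_scale:
  assumes g: "g \<in> lipc \<Omega>" "\<And>x. 0 \<le> g x" and c: "0 \<le> c"
  shows "modulus (\<lambda>x. c * g x) = c * modulus g"
proof (cases "c = 0")
  case True
  have "dominated (\<lambda>x. 0) = {\<lambda>x. 0}" by (auto simp: dominated_def lipc_zero)
  then show ?thesis using True by (simp add: modulus_def T_zero)
next
  case False
  then have c: "0 < c" using c by simp
  have "modulus (\<lambda>x. (1 / c) * (c * g x)) \<le> (1 / c) * modulus (\<lambda>x. c * g x)"
    using c g by (intro modulus_scale_le lipc_cmult) auto
  then have "c * modulus g \<le> modulus (\<lambda>x. c * g x)" using c by (simp add: field_simps)
  then show ?thesis using modulus_scale_le[OF g c] by simp
qed

definition component :: "'b \<Rightarrow> ('a \<Rightarrow> real) \<Rightarrow> real" where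
  "component i g = T (\<lambda>x. g x *\<^sub>R i)"

lemma component_add: "g \<in> lipc \<Omega> \<Longrightarrow> h \<in> lipc \<Omega> \<Longrightarrow> component i (\<lambda>x. g x + h x) = component i g + component i h"
  unfolding component_def by (simp add: scaleR_left_distrib T_add lipc_scaleR_left)

lemma component_scale: "g \<in> lipc \<Omega> \<Longrightarrow> component i (\<lambda>x. c * g x) = c * component i g"
  unfolding component_def using T_scale[OF lipc_scaleR_left, of g c i] by simp

lemma component_abs_le:
  assumes g: "g \<in> lipc \<Omega>" "\<And>x. 0 \<le> g x" and i: "i \<in> Basis"
  shows "\<bar>component i g\<bar> \<le> modulus g"
proof -
  have "(\<lambda>x. g x *\<^sub>R i) \<in> dominated g" "(\<lambda>x. (-1) *\<^sub>R (g x *\<^sub>R i)) \<in> dominated g"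
    using g i lipc_uminus[OF lipc_scaleR_left[OF g(1), of i]]
    by (auto simp: dominated_def lipc_scaleR_left)
  from T_le_modulus[OF g(1) this(1)] T_le_modulus[OF g(1) this(2)] show ?thesis
    using T_scale[OF lipc_scaleR_left[OF g(1)], of "-1" i] unfolding component_def by simp
qed

lemma T_eq_sum_component:
  assumes "\<phi> \<in> lipc \<Omega>"
  shows "T \<phi> = (\<Sum>i\<in>Basis. component i (\<lambda>x. \<phi> x \<bullet> i))"
proof -
  have "T (\<lambda>x. \<Sum>i\<in>I. (\<phi> x \<bullet> i) *\<^sub>R i) = (\<Sum>i\<in>I. component i (\<lambda>x. \<phi> x \<bullet> i))" if "finite I" for I
    using that
    by induction (auto simp: T_zero component_def T_add assms lipc_scaleR_left lipc_inner lipc_sum)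
  from this[of Basis] show ?thesis by (simp add: euclidean_representation)
qed

lemma modulus_positive: "positive_lipc_functional \<Omega> modulus"
  by unfold_locales (simp_all add: open_domain modulus_nonneg modulus_add modulus_scale)

lemma modulus_plus_component_positive:
  assumes "i \<in> Basis"
  shows "positive_lipc_functional \<Omega> (\<lambda>g. modulus g + component i g)"
proof
  show "0 \<le> modulus g + component i g" if "g \<in> lipc \<Omega>" "\<And>x. 0 \<le> g x" for g
    using component_abs_le[OF that assms] by linarith
qed (simp_all add: open_domain modulus_add modulus_scale component_add component_scale algebra_simps)

end

lemma riesz_locally_finite:
  "positive_lipc_functional \<Omega> J \<Longrightarrow> locally_finite_on \<Omega> (positive_lipc_functional.riesz \<Omega> J)"
  using positive_lipc_functional.sets_riesz positive_lipc_functional.riesz_outside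
    positive_lipc_functional.riesz_compact
  unfolding locally_finite_on_def by blast

text \<open>Domination of functionals passes to contents, hence to the outer measures, whose infima run
  over the same open sets.\<close>

lemma riesz_absolutely_continuous:
  assumes J: "positive_lipc_functional \<Omega> J" and J': "positive_lipc_functional \<Omega> J'"
    and le: "\<And>g. g \<in> lipc \<Omega> \<Longrightarrow> (\<And>x. 0 \<le> g x) \<Longrightarrow> J' g \<le> c * J g" and c: "0 < c"
  shows "absolutely_continuous (positive_lipc_functional.riesz \<Omega> J) (positive_lipc_functional.riesz \<Omega> J')"
proof -
  interpret J: positive_lipc_functional \<Omega> J by fact
  interpret J': positive_lipc_functional \<Omega> J' by fact
  have "J'.content U \<le> ennreal c * J.content U" for U
    unfolding J'.content_def
  proof (rule SUP_least)
    fix g assume g: "g \<in> J'.test U"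
    then have g': "g \<in> J.test U" by (simp add: J.test_def J'.test_def)
    have "ennreal (J' g) \<le> ennreal (c * J g)"
      using J.testD[OF g'] by (intro ennreal_leI le)
    also have "\<dots> = ennreal c * ennreal (J g)"
      using c J.testD[OF g'] by (intro ennreal_mult J.J_nonneg) auto
    also have "\<dots> \<le> ennreal c * J.content U"
      using g' by (intro mult_left_mono J.content_upper) auto
    finally show "ennreal (J' g) \<le> ennreal c * J.content U" .
  qed
  then have c': "J'.content U / ennreal c \<le> J.content U" for U
    using c by (auto simp: divide_le_posI_ennreal mult.commute)
  have "J'.outer A = 0" if "J.outer A = 0" for A
  proof -
    have "J'.outer A / ennreal c \<le> J.outer A"
      unfolding J.outer_def
    proof (rule INF_greatest)
      fix U assume "U \<in> {U. open U \<and> A \<inter> \<Omega> \<subseteq> U}"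
      then have "J'.outer A \<le> J'.content U" by (intro J'.outer_le) auto
      then have "J'.outer A / ennreal c \<le> J'.content U / ennreal c" by (rule divide_right_mono_ennreal)
      then show "J'.outer A / ennreal c \<le> J.content U" using c' by (rule order_trans)
    qed
    then show ?thesis using that c by (simp add: ennreal_divide_eq_0_iff)
  qed
  then show ?thesis
    by (auto simp: absolutely_continuous_def null_sets_def J.emeasure_riesz J'.emeasure_riesz)
qed

section \<open>Polar decomposition\<close>

text \<open>Since \<open>|T\<^sub>i| \<le> |T|\<close>, the functional \<open>|T| + T\<^sub>i\<close> is positive and at most \<open>2|T|\<close>. Its measure has a
  density \<open>f\<close> with respect to that of \<open>|T|\<close>, and \<open>f - 1\<close> represents \<open>T\<^sub>i\<close>.\<close>

lemma (in local_vector_functional) component_representation: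
  assumes i: "i \<in> Basis"
  obtains s where "s \<in> borel_measurable borel"
    "\<And>g. g \<in> lipc \<Omega> \<Longrightarrow> integrable (positive_lipc_functional.riesz \<Omega> modulus) (\<lambda>x. s x * g x)"
    "\<And>g. g \<in> lipc \<Omega> \<Longrightarrow> component i g = (\<integral>x. s x * g x \<partial>(positive_lipc_functional.riesz \<Omega> modulus))"
proof -
  interpret T: positive_lipc_functional \<Omega> modulus by (rule modulus_positive)
  interpret J: positive_lipc_functional \<Omega> "\<lambda>g. modulus g + component i g"
    using i by (rule modulus_plus_component_positive)
  have lT: "locally_finite_on \<Omega> T.riesz" by (rule riesz_locally_finite[OF modulus_positive])
  have lJ: "locally_finite_on \<Omega> J.riesz" by (rule riesz_locally_finite[OF modulus_plus_component_positive[OF i]])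
  interpret sT: sigma_finite_measure T.riesz by (rule locally_finite_sigma_finite[OF lT open_domain])
  interpret sJ: sigma_finite_measure J.riesz by (rule locally_finite_sigma_finite[OF lJ open_domain])
  have "absolutely_continuous T.riesz J.riesz"
  proof (rule riesz_absolutely_continuous[OF modulus_positive modulus_plus_component_positive[OF i]])
    show "modulus g + component i g \<le> 2 * modulus g" if "g \<in> lipc \<Omega>" "\<And>x. 0 \<le> g x" for g
      using component_abs_le[OF that i] by linarith
  qed simp
  then obtain f where f: "f \<in> borel_measurable T.riesz" "density T.riesz f = J.riesz"
    using sT.Radon_Nikodym[of J.riesz] by auto
  have [measurable]: "f \<in> borel_measurable borel" using f(1) by simp
  have "AE x in T.riesz. f x \<noteq> \<infinity>"
    using sT.sigma_finite_iff_density_finite[OF f(1)] f(2) sJ.sigma_finite_measure_axioms by simp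
  then have eq: "J.riesz = density T.riesz (\<lambda>x. ennreal (enn2real (f x)))"
    unfolding f(2)[symmetric] by (intro density_cong) (auto simp: ennreal_enn2real_if)
  define s where "s = (\<lambda>x. enn2real (f x) - 1)"
  have int: "integrable T.riesz (\<lambda>x. enn2real (f x) * g x)"
    and cint: "(\<integral>x. g x \<partial>J.riesz) = (\<integral>x. enn2real (f x) * g x \<partial>T.riesz)" if g: "g \<in> lipc \<Omega>" for g
  proof -
    have [measurable]: "g \<in> borel_measurable borel" using g by (rule lipc_borel)
    have "integrable J.riesz g" using lJ g by (rule lipc_integrable)
    then show "integrable T.riesz (\<lambda>x. enn2real (f x) * g x)"
      unfolding eq by (subst (asm) integrable_density) auto
    show "(\<integral>x. g x \<partial>J.riesz) = (\<integral>x. enn2real (f x) * g x \<partial>T.riesz)"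
      unfolding eq by (subst integral_density) auto
  qed
  have ints: "integrable T.riesz (\<lambda>x. s x * g x)" if g: "g \<in> lipc \<Omega>" for g
    using int[OF g] lipc_integrable[OF lT g] by (simp add: s_def left_diff_distrib)
  have pos: "component i g = (\<integral>x. s x * g x \<partial>T.riesz)" if g: "g \<in> lipc \<Omega>" "\<And>x. 0 \<le> g x" for g
  proof -
    have "component i g = (\<integral>x. g x \<partial>J.riesz) - (\<integral>x. g x \<partial>T.riesz)"
      using J.integral_riesz[OF g] T.integral_riesz[OF g] by simp
    also have "\<dots> = (\<integral>x. s x * g x \<partial>T.riesz)"
      using int[OF g(1)] lipc_integrable[OF lT g(1)] unfolding cint[OF g(1)]
      by (simp add: s_def left_diff_distrib)
    finally show ?thesis .
  qed
  have "component i g = (\<integral>x. s x * g x \<partial>T.riesz)" if g: "g \<in> lipc \<Omega>" for g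
  proof -
    define p where "p = (\<lambda>x. max (g x) 0)"
    define n where "n = (\<lambda>x. max (- g x) 0)"
    have p: "p \<in> lipc \<Omega>" "\<And>x. 0 \<le> p x" unfolding p_def using lipc_pos_part[OF g] by auto
    have n: "n \<in> lipc \<Omega>" "\<And>x. 0 \<le> n x" unfolding n_def using lipc_pos_part[OF lipc_uminus[OF g]] by auto
    have gpn: "p x = g x + n x" for x by (simp add: p_def n_def)
    have "component i p = component i g + component i n"
      unfolding gpn[abs_def] using g n by (intro component_add)
    moreover have "(\<integral>x. s x * p x \<partial>T.riesz) = (\<integral>x. s x * g x \<partial>T.riesz) + (\<integral>x. s x * n x \<partial>T.riesz)"
      unfolding gpn using ints[OF g] ints[OF n(1)] by (simp add: distrib_left)
    ultimately show ?thesis using pos[OF p] pos[OF n] by simp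
  qed
  with ints show ?thesis by (intro that[of s]) (auto simp: s_def)
qed

text \<open>The components yield a representation by a vector field \<open>v\<close> and the measure of \<open>|T|\<close>. Moving the
  factor \<open>|v|\<close> into the measure makes the field a unit field.\<close>

theorem (in local_vector_functional) vector_riesz:
  obtains N h where "locally_finite_on \<Omega> N" "h \<in> borel_measurable borel"
    "AE x in N. norm (h x) = 1" "\<And>\<phi>. \<phi> \<in> lipc \<Omega> \<Longrightarrow> T \<phi> = (\<integral>x. \<phi> x \<bullet> h x \<partial>N)"
proof -
  interpret R: positive_lipc_functional \<Omega> modulus by (rule modulus_positive)
  let ?M = "R.riesz"
  have lM: "locally_finite_on \<Omega> ?M" by (rule riesz_locally_finite[OF modulus_positive])
  have "\<forall>i\<in>Basis. \<exists>s. s \<in> borel_measurable borel \<and>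
      (\<forall>g\<in>lipc \<Omega>. integrable ?M (\<lambda>x. s x * g x) \<and> component i g = (\<integral>x. s x * g x \<partial>?M))"
  proof
    fix i :: 'b assume i: "i \<in> Basis"
    show "\<exists>s. s \<in> borel_measurable borel \<and>
        (\<forall>g\<in>lipc \<Omega>. integrable ?M (\<lambda>x. s x * g x) \<and> component i g = (\<integral>x. s x * g x \<partial>?M))"
      by (rule component_representation[OF i], intro exI conjI ballI) auto
  qed
  from bchoice[OF this] obtain s where s: "\<forall>i\<in>Basis. s i \<in> borel_measurable borel \<and>
      (\<forall>g\<in>lipc \<Omega>. integrable ?M (\<lambda>x. s i x * g x) \<and> component i g = (\<integral>x. s i x * g x \<partial>?M))" ..
  have sm: "s i \<in> borel_measurable borel" if "i \<in> Basis" for i using s that by simp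
  have sf: "integrable ?M (\<lambda>x. s i x * g x)" "component i g = (\<integral>x. s i x * g x \<partial>?M)"
    if "i \<in> Basis" "g \<in> lipc \<Omega>" for i g using s that by simp_all
  define v where "v = (\<lambda>x. \<Sum>i\<in>Basis. s i x *\<^sub>R i)"
  have v[measurable]: "v \<in> borel_measurable borel"
    unfolding v_def by (intro borel_measurable_sum borel_measurable_scaleR sm borel_measurable_const)
  have T: "T \<phi> = (\<integral>x. \<phi> x \<bullet> v x \<partial>?M)" if \<phi>: "\<phi> \<in> lipc \<Omega>" for \<phi>
  proof -
    have "T \<phi> = (\<Sum>i\<in>Basis. \<integral>x. s i x * (\<phi> x \<bullet> i) \<partial>?M)"
      unfolding T_eq_sum_component[OF \<phi>] by (intro sum.cong refl sf(2) lipc_inner \<phi>)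
    also have "\<dots> = (\<integral>x. (\<Sum>i\<in>Basis. s i x * (\<phi> x \<bullet> i)) \<partial>?M)"
      by (intro Bochner_Integration.integral_sum[symmetric] sf(1) lipc_inner \<phi>)
    also have "\<dots> = (\<integral>x. \<phi> x \<bullet> v x \<partial>?M)"
      by (simp add: v_def inner_sum_right)
    finally show ?thesis .
  qed
  define N where "N = density ?M (\<lambda>x. ennreal (norm (v x)))"
  have "emeasure N K < \<infinity>" if K: "compact K" "K \<subseteq> \<Omega>" for K
  proof -
    obtain g W where g: "g \<in> lipc \<Omega>" "\<And>x. 0 \<le> g x" "\<And>x. g x \<le> (1::real)"
      "open W" "K \<subseteq> W" "\<And>x. x \<in> W \<Longrightarrow> g x = 1"
      by (rule lipc_cutoff[OF K(1) open_domain K(2)]) (rule that)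
    have "integrable ?M (\<lambda>x. g x *\<^sub>R v x)"
      unfolding v_def scaleR_sum_right scaleR_scaleR
      using sf(1)[OF _ g(1)] by (intro Bochner_Integration.integrable_sum integrable_scaleR_left) (simp add: mult.commute)
    then have fin: "(\<integral>\<^sup>+x. ennreal (norm (g x *\<^sub>R v x)) \<partial>?M) < \<infinity>"
      by (simp add: integrable_iff_bounded)
    have "emeasure N K = (\<integral>\<^sup>+x. ennreal (norm (v x)) * indicator K x \<partial>?M)"
      unfolding N_def using borel_compact[OF K(1)] by (intro emeasure_density) auto
    also have "\<dots> \<le> (\<integral>\<^sup>+x. ennreal (norm (g x *\<^sub>R v x)) \<partial>?M)"
    proof (rule nn_integral_mono)
      fix x
      show "ennreal (norm (v x)) * indicator K x \<le> ennreal (norm (g x *\<^sub>R v x))"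
        using g(5,6) by (cases "x \<in> K") auto
    qed
    finally show ?thesis using fin by simp
  qed
  moreover have "emeasure N (- \<Omega>) = 0"
  proof -
    have "- \<Omega> \<in> null_sets ?M"
      using locally_finite_onD(1,3)[OF lM] open_domain by (simp add: null_sets_def)
    moreover have "absolutely_continuous ?M N"
      unfolding N_def by (rule absolutely_continuousI_density) simp
    ultimately show ?thesis by (auto simp: absolutely_continuous_def)
  qed
  ultimately have lN: "locally_finite_on \<Omega> N"
    unfolding locally_finite_on_def by (simp add: N_def)
  define h where "h = (\<lambda>x. v x /\<^sub>R norm (v x))"
  show ?thesis
  proof (rule that[OF lN])
    show "h \<in> borel_measurable borel" unfolding h_def by measurable
    show "AE x in N. norm (h x) = 1"
      unfolding N_def by (subst AE_density) (auto simp: h_def)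
    show "T \<phi> = (\<integral>x. \<phi> x \<bullet> h x \<partial>N)" if \<phi>: "\<phi> \<in> lipc \<Omega>" for \<phi>
    proof -
      have [measurable]: "\<phi> \<in> borel_measurable borel" using \<phi> by (rule lipc_borel)
      have "(\<integral>x. \<phi> x \<bullet> h x \<partial>N) = (\<integral>x. norm (v x) *\<^sub>R (\<phi> x \<bullet> h x) \<partial>?M)"
        unfolding N_def by (intro integral_density) (auto simp: h_def)
      also have "\<dots> = (\<integral>x. \<phi> x \<bullet> v x \<partial>?M)"
      proof (intro Bochner_Integration.integral_cong refl)
        show "norm (v x) *\<^sub>R (\<phi> x \<bullet> h x) = \<phi> x \<bullet> v x" for x
          by (cases "v x = 0") (simp_all add: h_def)
      qed
      finally show ?thesis using T[OF \<phi>] by simp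
    qed
  qed
qed

section \<open>Regularity of locally finite Borel measures\<close>

lemma emeasure_restricted_density:
  assumes "sets N = sets borel" "C \<in> sets borel" "A \<in> sets borel"
  shows "emeasure (density N (indicator C)) A = emeasure N (C \<inter> A)"
  using assms by (intro emeasure_restricted) auto

text \<open>Finite Borel measures on a Euclidean space are inner regular; exhaust \<open>\<Omega>\<close> by compact sets.\<close>

lemma locally_finite_inner:
  fixes \<Omega> :: "'a::euclidean_space set"
  assumes N: "locally_finite_on \<Omega> N" and op: "open \<Omega>" and B: "B \<in> sets borel" "B \<subseteq> \<Omega>"
  shows "emeasure N B = (SUP K\<in>{K. compact K \<and> K \<subseteq> B}. emeasure N K)"
proof (rule antisym)
  have sN: "sets N = sets borel" using N by (rule locally_finite_onD)
  show "(SUP K\<in>{K. compact K \<and> K \<subseteq> B}. emeasure N K) \<le> emeasure N B"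
    using B sN by (intro SUP_least emeasure_mono) auto
  obtain C :: "nat \<Rightarrow> 'a set" where C: "\<forall>n. compact (C n)" "\<forall>n. C n \<subseteq> \<Omega>"
      "\<forall>n. C n \<subseteq> interior (C (Suc n))" "\<Union>(range C) = \<Omega>"
    using compact_exhaustion[OF op] by (elim exE conjE) (rule that)
  have Cb: "C n \<in> sets borel" for n using C(1) by (simp add: borel_compact)
  have inc: "incseq (\<lambda>n. B \<inter> C n)"
    using C(3) interior_subset by (intro incseq_SucI) blast
  have "emeasure N B = emeasure N (\<Union>n. B \<inter> C n)"
    using C(4) B(2) by (intro arg_cong[where f="emeasure N"]) blast
  also have "\<dots> = (SUP n. emeasure N (B \<inter> C n))"
    using B(1) Cb sN by (intro SUP_emeasure_incseq[symmetric] inc) auto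
  also have "\<dots> \<le> (SUP K\<in>{K. compact K \<and> K \<subseteq> B}. emeasure N K)"
  proof (rule SUP_least)
    fix n
    let ?M = "density N (indicator (C n))"
    have M: "emeasure ?M A = emeasure N (C n \<inter> A)" if "A \<in> sets borel" for A
      using sN Cb that by (rule emeasure_restricted_density)
    have "emeasure ?M (space ?M) \<noteq> \<infinity>"
      using M[of UNIV] C locally_finite_onD(4)[OF N, of "C n"] locally_finite_onD(2)[OF N] by simp
    then have "emeasure ?M B = (SUP K\<in>{K. K \<subseteq> B \<and> compact K}. emeasure ?M K)"
      using B(1) sN by (intro inner_regular) auto
    also have "\<dots> \<le> (SUP K\<in>{K. compact K \<and> K \<subseteq> B}. emeasure N K)"
    proof (rule SUP_mono)
      fix K assume K: "K \<in> {K. K \<subseteq> B \<and> compact K}"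
      then have "K \<in> sets borel" by (simp add: borel_compact)
      then have "emeasure ?M K \<le> emeasure N K"
        using M[of K] sN by (auto intro!: emeasure_mono)
      then show "\<exists>K'\<in>{K. compact K \<and> K \<subseteq> B}. emeasure ?M K \<le> emeasure N K'"
        using K by auto
    qed
    finally show "emeasure N (B \<inter> C n) \<le> (SUP K\<in>{K. compact K \<and> K \<subseteq> B}. emeasure N K)"
      using M[OF B(1)] by (simp add: Int_commute)
  qed
  finally show "emeasure N B \<le> (SUP K\<in>{K. compact K \<and> K \<subseteq> B}. emeasure N K)" .
qed

text \<open>With a compact exhaustion \<open>C n\<close> of \<open>\<Omega>\<close>, each \<open>B \<inter> C n\<close> has an open neighbourhood inside
  \<open>C (Suc n)\<close>, where the measure is finite, whose excess is at most \<open>e / 2 ^ Suc n\<close>. The union of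
  these neighbourhoods has excess at most \<open>e\<close>, even if \<open>B\<close> has infinite measure.\<close>

lemma locally_finite_outer:
  fixes \<Omega> :: "'a::euclidean_space set"
  assumes N: "locally_finite_on \<Omega> N" and op: "open \<Omega>" and B: "B \<in> sets borel" "B \<subseteq> \<Omega>"
  shows "emeasure N B = (INF U\<in>{U. open U \<and> B \<subseteq> U \<and> U \<subseteq> \<Omega>}. emeasure N U)"
proof (rule antisym)
  have sN: "sets N = sets borel" using N by (rule locally_finite_onD)
  show "emeasure N B \<le> (INF U\<in>{U. open U \<and> B \<subseteq> U \<and> U \<subseteq> \<Omega>}. emeasure N U)"
    using B sN by (intro INF_greatest emeasure_mono) auto
  obtain C :: "nat \<Rightarrow> 'a set" where C: "\<forall>n. compact (C n)" "\<forall>n. C n \<subseteq> \<Omega>"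
      "\<forall>n. C n \<subseteq> interior (C (Suc n))" "\<Union>(range C) = \<Omega>"
    using compact_exhaustion[OF op] by (elim exE conjE) (rule that)
  have Cb: "C n \<in> sets borel" for n using C(1) by (simp add: borel_compact)
  show "(INF U\<in>{U. open U \<and> B \<subseteq> U \<and> U \<subseteq> \<Omega>}. emeasure N U) \<le> emeasure N B"
  proof (rule ennreal_le_epsilon)
    fix e :: real assume e: "0 < e"
    have "\<exists>U. open U \<and> B \<inter> C n \<subseteq> U \<and> U \<subseteq> \<Omega> \<and>
        emeasure N (U - (B \<inter> C n)) \<le> ennreal e * ennreal ((1/2) ^ Suc n)" for n
    proof -
      let ?M = "density N (indicator (C (Suc n)))"
      have M: "emeasure ?M A = emeasure N (C (Suc n) \<inter> A)" if "A \<in> sets borel" for A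
        using sN Cb that by (rule emeasure_restricted_density)
      have "emeasure ?M (space ?M) \<noteq> \<infinity>"
        using M[of UNIV] C locally_finite_onD(4)[OF N, of "C (Suc n)"] locally_finite_onD(2)[OF N] by simp
      then have reg: "emeasure ?M (B \<inter> C n) = (INF U\<in>{U. B \<inter> C n \<subseteq> U \<and> open U}. emeasure ?M U)"
        using B(1) Cb sN by (intro outer_regular) auto
      have sub: "C n \<subseteq> C (Suc n)" using C(3) interior_subset by blast
      have Mn: "emeasure ?M (B \<inter> C n) = emeasure N (B \<inter> C n)"
        using M[of "B \<inter> C n"] B(1) Cb sub
        by (simp add: Int_absorb1 le_infI2)
      have "emeasure N (B \<inter> C n) \<le> emeasure N (C n)"
        using Cb sN by (intro emeasure_mono) auto
      also have "emeasure N (C n) < \<infinity>" using C locally_finite_onD(4)[OF N, of "C n"] by simp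
      finally have fin: "emeasure N (B \<inter> C n) < \<infinity>" .
      have "emeasure ?M (B \<inter> C n) < emeasure N (B \<inter> C n) + ennreal e * ennreal ((1/2) ^ Suc n)"
        using fin e unfolding Mn
        by (cases "emeasure N (B \<inter> C n)") (auto simp flip: ennreal_mult' ennreal_plus simp: ennreal_less_iff)
      then obtain U where U: "B \<inter> C n \<subseteq> U" "open U"
        "emeasure ?M U < emeasure N (B \<inter> C n) + ennreal e * ennreal ((1/2) ^ Suc n)"
        unfolding reg INF_less_iff by blast
      define U' where "U' = U \<inter> interior (C (Suc n))"
      have U': "open U'" "B \<inter> C n \<subseteq> U'" "U' \<subseteq> \<Omega>" "U' \<subseteq> C (Suc n) \<inter> U"
        using U C interior_subset[of "C (Suc n)"] unfolding U'_def by auto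
      have "emeasure N U' \<le> emeasure N (C (Suc n) \<inter> U)"
        using U' U(2) Cb sN by (intro emeasure_mono) auto
      also have "\<dots> = emeasure ?M U" using M U(2) by simp
      finally have le: "emeasure N U' \<le> emeasure N (B \<inter> C n) + ennreal e * ennreal ((1/2) ^ Suc n)"
        using U(3) by simp
      have "emeasure N (U' - (B \<inter> C n)) = emeasure N U' - emeasure N (B \<inter> C n)"
        using U' B(1) Cb sN fin by (intro emeasure_Diff) auto
      also have "\<dots> \<le> ennreal e * ennreal ((1/2) ^ Suc n)"
        using le fin by (intro ennreal_minus_le_iff[THEN iffD2]) auto
      finally show ?thesis using U' by blast
    qed
    then obtain U where U: "\<And>n. open (U n)" "\<And>n. B \<inter> C n \<subseteq> U n" "\<And>n. U n \<subseteq> \<Omega>"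
        "\<And>n. emeasure N (U n - (B \<inter> C n)) \<le> ennreal e * ennreal ((1/2) ^ Suc n)"
      by metis
    define V where "V = (\<Union>n. U n)"
    have V: "open V" "B \<subseteq> V" "V \<subseteq> \<Omega>"
    proof -
      show "open V" unfolding V_def using U(1) by auto
      show "V \<subseteq> \<Omega>" unfolding V_def using U(3) by (rule UN_least)
      show "B \<subseteq> V"
      proof
        fix x assume "x \<in> B"
        then obtain n where "x \<in> C n" using B(2) C(4) by auto
        then show "x \<in> V" unfolding V_def using U(2)[of n] \<open>x \<in> B\<close> by auto
      qed
    qed
    have Us: "U n - B \<inter> C n \<in> sets N" for n
      using U(1) B(1) Cb sN by auto
    have "emeasure N (V - B) \<le> emeasure N (\<Union>n. U n - (B \<inter> C n))"
      using Us by (intro emeasure_mono) (auto simp: V_def)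
    also have "\<dots> \<le> (\<Sum>n. emeasure N (U n - (B \<inter> C n)))"
      using Us by (intro emeasure_subadditive_countably) auto
    also have "\<dots> \<le> (\<Sum>n. ennreal e * ennreal ((1/2) ^ Suc n))"
      using U(4) by (intro suminf_le summableI) auto
    also have "\<dots> = ennreal e"
      unfolding ennreal_suminf_cmult
      by (subst suminf_ennreal_eq[OF zero_le_power power_half_series]) auto
    finally have VB: "emeasure N (V - B) \<le> ennreal e" .
    have "(INF U\<in>{U. open U \<and> B \<subseteq> U \<and> U \<subseteq> \<Omega>}. emeasure N U) \<le> emeasure N V"
      using V by (intro INF_lower) auto
    also have "V = B \<union> (V - B)" using V(2) by auto
    also have "emeasure N (B \<union> (V - B)) \<le> emeasure N B + emeasure N (V - B)"
      using V(1) B(1) sN by (intro emeasure_subadditive) auto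
    also have "\<dots> \<le> emeasure N B + ennreal e" using VB by (intro add_left_mono)
    finally show "(INF U\<in>{U. open U \<and> B \<subseteq> U \<and> U \<subseteq> \<Omega>}. emeasure N U) \<le> emeasure N B + ennreal e" .
  qed
qed

lemma locally_finite_imp_radon:
  fixes \<Omega> :: "'a::euclidean_space set"
  assumes N: "locally_finite_on \<Omega> N" and op: "open \<Omega>"
  shows "radon_measure_on \<Omega> (restrict_space N \<Omega>)"
proof -
  have sN: "sets N = sets borel" "space N = UNIV" using N by (rule locally_finite_onD)+
  have sr: "sets (restrict_space N \<Omega>) = sets (restrict_space borel \<Omega>)"
    using sN(1) by (rule sets_restrict_space_cong)
  have em: "emeasure (restrict_space N \<Omega>) A = emeasure N A" if "A \<subseteq> \<Omega>" for A
    using that op sN by (intro emeasure_restrict_space) auto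
  have B: "B \<in> sets borel \<and> B \<subseteq> \<Omega>" if "B \<in> sets (restrict_space N \<Omega>)" for B
    using that op unfolding sr by (subst (asm) sets_restrict_space_iff) auto
  show ?thesis
    unfolding radon_measure_on_def
  proof (intro conjI allI impI ballI)
    show "space (restrict_space N \<Omega>) = \<Omega>" by (simp add: space_restrict_space sN)
    show "emeasure (restrict_space N \<Omega>) K < \<infinity>" if "compact K \<and> K \<subseteq> \<Omega>" for K
      using that locally_finite_onD(4)[OF N] by (simp add: em)
    fix B assume "B \<in> sets (restrict_space N \<Omega>)"
    then have B': "B \<in> sets borel" "B \<subseteq> \<Omega>" using B by auto
    have "(INF U\<in>{U. open U \<and> B \<subseteq> U \<and> U \<subseteq> \<Omega>}. emeasure (restrict_space N \<Omega>) U) =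
        (INF U\<in>{U. open U \<and> B \<subseteq> U \<and> U \<subseteq> \<Omega>}. emeasure N U)"
      by (intro INF_cong refl em) auto
    then show "emeasure (restrict_space N \<Omega>) B =
        (INF U\<in>{U. open U \<and> B \<subseteq> U \<and> U \<subseteq> \<Omega>}. emeasure (restrict_space N \<Omega>) U)"
      using locally_finite_outer[OF N op B'] em[OF B'(2)] by simp
    have "(SUP K\<in>{K. compact K \<and> K \<subseteq> B}. emeasure (restrict_space N \<Omega>) K) =
        (SUP K\<in>{K. compact K \<and> K \<subseteq> B}. emeasure N K)"
      using B'(2) by (intro SUP_cong refl em) auto
    then show "emeasure (restrict_space N \<Omega>) B =
        (SUP K\<in>{K. compact K \<and> K \<subseteq> B}. emeasure (restrict_space N \<Omega>) K)"
      using locally_finite_inner[OF N op B'] em[OF B'(2)] by simp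
  qed (rule sr)
qed

text \<open>Extension by zero of a measure on a subset.\<close>

definition extend :: "'a::topological_space measure \<Rightarrow> 'a measure" where
  "extend \<mu> = distr \<mu> borel (\<lambda>x. x)"

lemma radon_measure_onD:
  assumes "radon_measure_on \<Omega> \<mu>"
  shows "space \<mu> = \<Omega>" "sets \<mu> = sets (restrict_space borel \<Omega>)"
    "\<And>K. compact K \<Longrightarrow> K \<subseteq> \<Omega> \<Longrightarrow> emeasure \<mu> K < \<infinity>"
    "\<And>B. B \<in> sets \<mu> \<Longrightarrow> emeasure \<mu> B = (INF U\<in>{U. open U \<and> B \<subseteq> U \<and> U \<subseteq> \<Omega>}. emeasure \<mu> U)"
  using assms unfolding radon_measure_on_def by simp_all

lemma measurable_id_radon:
  assumes "radon_measure_on \<Omega> \<mu>"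
  shows "(\<lambda>x. x) \<in> measurable \<mu> borel"
proof -
  have "(\<lambda>x. x) \<in> measurable (restrict_space borel \<Omega>) borel"
    by (rule measurable_restrict_space1) simp
  then show ?thesis
    using radon_measure_onD(2)[OF assms] by (simp cong: measurable_cong_sets)
qed

lemma extend_properties:
  assumes \<mu>: "radon_measure_on \<Omega> \<mu>" and op: "open \<Omega>"
  shows "locally_finite_on \<Omega> (extend (\<mu> :: 'a::euclidean_space measure))"
    "A \<in> sets borel \<Longrightarrow> emeasure (extend \<mu>) A = emeasure \<mu> (A \<inter> \<Omega>)"
proof -
  have em: "emeasure (extend \<mu>) A = emeasure \<mu> (A \<inter> \<Omega>)" if "A \<in> sets borel" for A
    using that unfolding extend_def
    by (subst emeasure_distr[OF measurable_id_radon[OF \<mu>]])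
       (simp_all add: radon_measure_onD(1)[OF \<mu>])
  then show "A \<in> sets borel \<Longrightarrow> emeasure (extend \<mu>) A = emeasure \<mu> (A \<inter> \<Omega>)" .
  have "emeasure (extend \<mu>) K < \<infinity>" if "compact K" "K \<subseteq> \<Omega>" for K
    using em[OF borel_compact[OF that(1)]] radon_measure_onD(3)[OF \<mu> that] that(2)
    by (simp add: Int_absorb2)
  then show "locally_finite_on \<Omega> (extend \<mu>)"
    unfolding locally_finite_on_def using op em[of "- \<Omega>"] by (simp add: extend_def)
qed

lemma radon_measure_eq_on_open:
  assumes "radon_measure_on \<Omega> \<mu>" "radon_measure_on \<Omega> \<mu>'"
    "\<And>U. open U \<Longrightarrow> U \<subseteq> \<Omega> \<Longrightarrow> emeasure \<mu> U = emeasure \<mu>' U"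
  shows "\<mu> = \<mu>'"
proof (rule measure_eqI)
  show s: "sets \<mu> = sets \<mu>'" using assms(1,2) by (simp add: radon_measure_onD(2))
  fix B assume "B \<in> sets \<mu>"
  then show "emeasure \<mu> B = emeasure \<mu>' B"
    using radon_measure_onD(4)[OF assms(1), of B] radon_measure_onD(4)[OF assms(2), of B] s
    by (simp add: assms(3) cong: INF_cong_simp)
qed

section \<open>Approximation in the mean by Lipschitz functions\<close>

definition lip_bdd :: "('a::metric_space \<Rightarrow> 'b::real_normed_vector) \<Rightarrow> bool" where
  "lip_bdd p \<longleftrightarrow> (\<exists>L. L-lipschitz_on UNIV p) \<and> (\<exists>B. \<forall>x. norm (p x) \<le> B)"

lemma lip_bddI: "L-lipschitz_on UNIV p \<Longrightarrow> (\<And>x. norm (p x) \<le> B) \<Longrightarrow> lip_bdd p"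
  unfolding lip_bdd_def by blast

lemma lip_bddE:
  assumes "lip_bdd p"
  obtains L B where "L-lipschitz_on UNIV p" "\<And>x. norm (p x) \<le> B"
  using assms unfolding lip_bdd_def by blast

lemma lip_bdd_const: "lip_bdd (\<lambda>x. c)"
  by (rule lip_bddI[OF lipschitz_on_constant order_refl])

lemma lip_bdd_add:
  assumes "lip_bdd p" "lip_bdd q"
  shows "lip_bdd (\<lambda>x. p x + q x)"
proof -
  obtain L B where p: "L-lipschitz_on UNIV p" "\<And>x. norm (p x) \<le> B" using assms(1) by (rule lip_bddE, blast)
  obtain L' B' where q: "L'-lipschitz_on UNIV q" "\<And>x. norm (q x) \<le> B'" using assms(2) by (rule lip_bddE, blast)
  show ?thesis
    by (rule lip_bddI[OF lipschitz_on_add[OF p(1) q(1)], of "B + B'"])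
       (intro norm_triangle_mono p q)
qed

lemma lip_bdd_scaleR_left:
  assumes "lip_bdd (p::_\<Rightarrow>real)"
  shows "lip_bdd (\<lambda>x. p x *\<^sub>R v)"
proof -
  obtain L B where p: "L-lipschitz_on UNIV p" "\<And>x. norm (p x) \<le> B" using assms(1) by (rule lip_bddE, blast)
  obtain M where M: "M-lipschitz_on UNIV (\<lambda>t::real. t *\<^sub>R v)"
    using bounded_linear.lipschitz_boundE[OF bounded_linear_scaleR_left] .
  show ?thesis
  proof (rule lip_bddI)
    show "(M * L)-lipschitz_on UNIV (\<lambda>x. p x *\<^sub>R v)"
      using lipschitz_on_compose2[OF p(1), of M "\<lambda>t. t *\<^sub>R v"] M by (auto intro: lipschitz_on_subset)
    show "norm (p x *\<^sub>R v) \<le> B * norm v" for x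
      using p(2)[of x] by (auto intro: mult_right_mono)
  qed
qed

lemma lip_bdd_borel: "lip_bdd (p::'a::metric_space \<Rightarrow> 'b::real_normed_vector) \<Longrightarrow> p \<in> borel_measurable borel"
  unfolding lip_bdd_def using lipschitz_on_continuous_on borel_measurable_continuous_onI by blast

lemma lip_bdd_integrable:
  fixes p :: "'a::metric_space \<Rightarrow> 'b::{banach, second_countable_topology}"
  assumes "lip_bdd p" "finite_measure M" "sets M = sets borel"
  shows "integrable M p"
proof -
  interpret finite_measure M by fact
  obtain L B where p: "L-lipschitz_on UNIV p" "\<And>x. norm (p x) \<le> B" using assms(1) by (rule lip_bddE, blast)
  show ?thesis
    using p(2) lip_bdd_borel[OF assms(1)] assms(3)
    by (intro integrable_const_bound[where B=B]) (auto cong: measurable_cong_sets)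
qed

text \<open>Approximability in the mean; integrability is included so that the closure properties below
  chain without side conditions.\<close>

definition lip_approximable :: "'a::metric_space measure \<Rightarrow> ('a \<Rightarrow> 'b::{banach, second_countable_topology}) \<Rightarrow> bool" where
  "lip_approximable M h \<longleftrightarrow> integrable M h \<and> (\<forall>e>0. \<exists>p. lip_bdd p \<and> (\<integral>x. norm (p x - h x) \<partial>M) < e)"

lemma lip_approximableE:
  assumes "lip_approximable M h" "0 < e"
  obtains p where "lip_bdd p" "(\<integral>x. norm (p x - h x) \<partial>M) < e"
  using assms unfolding lip_approximable_def by blast

context
  fixes M :: "'a::metric_space measure"
  assumes fin: "finite_measure M" and sM: "sets M = sets borel"
begin

lemma lip_approximable_lip_bdd:
  fixes p :: "'a \<Rightarrow> 'b::{banach, second_countable_topology}"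
  assumes "lip_bdd p"
  shows "lip_approximable M p"
  unfolding lip_approximable_def
  using assms lip_bdd_integrable[OF assms fin sM] by (auto intro!: exI[of _ p])

lemma lip_approximable_scaleR_left:
  fixes f :: "'a \<Rightarrow> real" and c :: "'b::{banach, second_countable_topology}"
  assumes f: "lip_approximable M f"
  shows "lip_approximable M (\<lambda>x. f x *\<^sub>R c)"
  unfolding lip_approximable_def
proof (intro conjI allI impI)
  show "integrable M (\<lambda>x. f x *\<^sub>R c)" using f by (simp add: lip_approximable_def)
  fix e :: real assume e: "0 < e"
  then have "0 < e / (norm c + 1)" by (smt (verit) divide_pos_pos norm_ge_zero)
  with f obtain p where p: "lip_bdd p" "(\<integral>x. norm (p x - f x) \<partial>M) < e / (norm c + 1)"
    by (rule lip_approximableE)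
  have "norm (p x *\<^sub>R c - f x *\<^sub>R c) = norm (p x - f x) * norm c" for x
    by (simp add: scaleR_left_diff_distrib[symmetric])
  then have "(\<integral>x. norm (p x *\<^sub>R c - f x *\<^sub>R c) \<partial>M) = (\<integral>x. norm (p x - f x) \<partial>M) * norm c"
    by simp
  also have "\<dots> \<le> e / (norm c + 1) * norm c"
    using p(2) by (intro mult_right_mono) auto
  also have "\<dots> < e"
    using e by (simp add: field_simps add_pos_nonneg)
  finally show "\<exists>p. lip_bdd p \<and> (\<integral>x. norm (p x - f x *\<^sub>R c) \<partial>M) < e"
    using lip_bdd_scaleR_left[OF p(1)] by blast
qed

lemma lip_approximable_add:
  fixes f g :: "'a \<Rightarrow> 'b::{banach, second_countable_topology}"
  assumes f: "lip_approximable M f" and g: "lip_approximable M g"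
  shows "lip_approximable M (\<lambda>x. f x + g x)"
  unfolding lip_approximable_def
proof (intro conjI allI impI)
  have fg: "integrable M f" "integrable M g" using f g by (simp_all add: lip_approximable_def)
  then show "integrable M (\<lambda>x. f x + g x)" by simp
  fix e :: real assume "0 < e"
  then have e2: "0 < e / 2" by simp
  obtain p where p: "lip_bdd p" "(\<integral>x. norm (p x - f x) \<partial>M) < e / 2"
    using f e2 by (rule lip_approximableE)
  obtain q where q: "lip_bdd q" "(\<integral>x. norm (q x - g x) \<partial>M) < e / 2"
    using g e2 by (rule lip_approximableE)
  have pq: "lip_bdd (\<lambda>x. p x + q x)" using p q by (intro lip_bdd_add)
  have i: "integrable M (\<lambda>x. norm (p x - f x))" "integrable M (\<lambda>x. norm (q x - g x))"
    "integrable M (\<lambda>x. norm (p x + q x - (f x + g x)))"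
    by (intro integrable_norm Bochner_Integration.integrable_diff Bochner_Integration.integrable_add
      lip_bdd_integrable p q fin sM fg)+
  have "(\<integral>x. norm (p x + q x - (f x + g x)) \<partial>M) \<le> (\<integral>x. norm (p x - f x) + norm (q x - g x) \<partial>M)"
    using i by (intro integral_mono Bochner_Integration.integrable_add norm_diff_triangle_ineq)
  also have "\<dots> < e" using i p q by simp
  finally show "\<exists>p. lip_bdd p \<and> (\<integral>x. norm (p x - (f x + g x)) \<partial>M) < e"
    using pq by blast
qed

lemma lip_approximable_limit:
  fixes f :: "'a \<Rightarrow> 'b::{banach, second_countable_topology}"
  assumes s: "\<And>n. lip_approximable M (s n)" and f: "integrable M f"
    and lim: "AE x in M. (\<lambda>n. s n x) \<longlonglongrightarrow> f x"
    and w: "integrable M w" "\<And>n. AE x in M. norm (s n x - f x) \<le> w x"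
  shows "lip_approximable M f"
  unfolding lip_approximable_def
proof (intro conjI allI impI)
  have si: "integrable M (s n)" for n using s by (simp add: lip_approximable_def)
  have "(\<lambda>n. \<integral>x. norm (s n x - f x) \<partial>M) \<longlonglongrightarrow> (\<integral>x. 0 \<partial>M)"
  proof (rule integral_dominated_convergence[where w=w])
    show "AE x in M. (\<lambda>n. norm (s n x - f x)) \<longlonglongrightarrow> 0"
      using lim by eventually_elim (intro tendsto_norm_zero LIM_zero)
    show "AE x in M. norm (norm (s n x - f x)) \<le> w x" for n using w(2) by simp
    show "(\<lambda>x. norm (s n x - f x)) \<in> borel_measurable M" for n
      using borel_measurable_integrable[OF si[of n]] borel_measurable_integrable[OF f] by measurable
  qed (use w in auto)
  then have l0: "(\<lambda>n. \<integral>x. norm (s n x - f x) \<partial>M) \<longlonglongrightarrow> 0" by simp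
  fix e :: real assume "0 < e"
  then have e2: "0 < e / 2" by simp
  from order_tendstoD(2)[OF l0 this]
  obtain n where n: "(\<integral>x. norm (s n x - f x) \<partial>M) < e / 2"
    by (auto simp: eventually_sequentially)
  obtain p where p: "lip_bdd p" "(\<integral>x. norm (p x - s n x) \<partial>M) < e / 2"
    using s e2 by (rule lip_approximableE)
  have i: "integrable M (\<lambda>x. norm (p x - s n x))" "integrable M (\<lambda>x. norm (s n x - f x))"
    "integrable M (\<lambda>x. norm (p x - f x))"
    by (intro integrable_norm Bochner_Integration.integrable_diff lip_bdd_integrable p fin sM si f)+
  have "(\<integral>x. norm (p x - f x) \<partial>M) \<le> (\<integral>x. norm (p x - s n x) + norm (s n x - f x) \<partial>M)"
    using i by (intro integral_mono Bochner_Integration.integrable_add norm_diff_triangle_le[OF order_refl order_refl])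
  also have "\<dots> < e" using i p n by simp
  finally show "\<exists>p. lip_bdd p \<and> (\<integral>x. norm (p x - f x) \<partial>M) < e" using p(1) by blast
qed (rule f)

text \<open>The functions \<open>min (n d) 1\<close>, with \<open>d\<close> the distance to the complement, increase to the indicator
  of \<open>U\<close>. For \<open>U = UNIV\<close> the distance to the empty complement is 0 by convention, so this case is
  separate.\<close>

lemma lip_approximable_open:
  assumes U: "open U"
  shows "lip_approximable M (indicat_real U)"
proof (cases "U = UNIV")
  case True
  then show ?thesis using lip_approximable_lip_bdd[OF lip_bdd_const[of "1::real"]] by simp
next
  case False
  interpret finite_measure M by (rule fin)
  define p where "p = (\<lambda>n x. min (real n * infdist x (- U)) 1)"
  have cl: "closed (- U)" "- U \<noteq> {}" using U False by auto
  have inf: "1-lipschitz_on UNIV (\<lambda>x. infdist x (- U))"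
    by (rule lipschitz_onI) (auto simp: dist_real_def infdist_triangle_abs)
  have p01: "0 \<le> p n x" "p n x \<le> 1" for n x by (auto simp: p_def infdist_nonneg)
  have pl: "lip_bdd (p n)" for n
  proof (rule lip_bddI)
    show "(max (real n * 1) 0)-lipschitz_on UNIV (p n)"
      unfolding p_def by (intro lipschitz_min lipschitz_on_cmult_real_nonneg inf lipschitz_on_constant) simp
    show "norm (p n x) \<le> 1" for x using p01[of n x] by simp
  qed
  have lim: "(\<lambda>n. p n x) \<longlonglongrightarrow> indicat_real U x" for x
  proof (cases "x \<in> U")
    case True
    then have "0 < infdist x (- U)" using cl by (intro infdist_pos_not_in_closed) auto
    then obtain n0 where "1 < real n0 * infdist x (- U)" using reals_Archimedean3 by blast
    then have "\<And>n. n \<ge> n0 \<Longrightarrow> p n x = 1"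
      unfolding p_def using infdist_nonneg[of x "- U"]
      by (auto simp: min_def) (smt (verit, best) mult_right_mono of_nat_le_iff)
    then have "eventually (\<lambda>n. p n x = indicat_real U x) sequentially"
      using True by (auto simp: eventually_sequentially intro!: exI[of _ n0])
    then show ?thesis by (rule tendsto_eventually)
  next
    case False
    then show ?thesis by (simp add: p_def)
  qed
  show ?thesis
  proof (rule lip_approximable_limit[where s=p and w="\<lambda>x. 1"])
    show "integrable M (indicat_real U)"
      using U sM by (simp add: integrable_indicator_iff emeasure_eq_measure)
    show "AE x in M. norm (p n x - indicat_real U x) \<le> 1" for n
    proof (rule AE_I2)
      show "norm (p n x - indicat_real U x) \<le> 1" for x
        using p01[of n x] by (cases "x \<in> U") auto
    qed
  qed (auto intro: lip_approximable_lip_bdd pl lim)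
qed

lemma lip_approximable_indicator:
  assumes "A \<in> sets borel"
  shows "lip_approximable M (indicat_real A)"
proof -
  interpret finite_measure M by (rule fin)
  have "Int_stable {S::'a set. open S}" by (auto simp: Int_stable_def)
  moreover have "{S::'a set. open S} \<subseteq> Pow UNIV" by simp
  moreover have "A \<in> sigma_sets UNIV {S. open S}"
    using assms by (simp add: borel_def)
  ultimately show ?thesis
  proof (induction rule: sigma_sets_induct_disjoint)
    case (basic U)
    then show ?case by (simp add: lip_approximable_open)
  next
    case empty
    show ?case using lip_approximable_lip_bdd[OF lip_bdd_const[of "0::real"]] by simp
  next
    case (compl A)
    have "indicat_real (UNIV - A) = (\<lambda>x. 1 + indicat_real A x *\<^sub>R (- 1))"
      by (auto simp: indicator_def)
    then show ?case
      using lip_approximable_add[OF lip_approximable_lip_bdd[OF lip_bdd_const[of "1::real"]]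
        lip_approximable_scaleR_left[OF compl.IH, of "-1::real"]] by simp
  next
    case (union A)
    then have Ab: "A i \<in> sets borel" for i by (auto simp: borel_def)
    have part: "lip_approximable M (indicat_real (\<Union>i<n. A i))" for n
    proof (induction n)
      case 0
      show ?case using lip_approximable_lip_bdd[OF lip_bdd_const[of "0::real"]] by simp
    next
      case (Suc n)
      have "x \<notin> A n" if "x \<in> A i" "i < n" for x i
        using union.hyps(1) that unfolding disjoint_family_on_def by (metis disjoint_iff UNIV_I less_irrefl)
      then have "indicat_real (\<Union>i<Suc n. A i) = (\<lambda>x. indicat_real (\<Union>i<n. A i) x + indicat_real (A n) x)"
        by (auto simp: fun_eq_iff indicator_def less_Suc_eq)
      then show ?case using lip_approximable_add[OF Suc union.IH[of n]] by simp
    qed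
    show ?case
    proof (rule lip_approximable_limit[OF part, where w="\<lambda>x. 1"])
      show "integrable M (indicat_real (\<Union>i. A i))"
        using Ab sM by (simp add: integrable_indicator_iff emeasure_eq_measure)
      show "AE x in M. (\<lambda>n. indicat_real (\<Union>i<n. A i) x) \<longlonglongrightarrow> indicat_real (\<Union>i. A i) x"
        by (intro AE_I2 LIMSEQ_indicator_UN)
    qed (auto simp: indicator_def)
  qed
qed

theorem integrable_imp_lip_approximable:
  fixes h :: "'a \<Rightarrow> 'b::{banach, second_countable_topology}"
  assumes "integrable M h"
  shows "lip_approximable M h"
  using assms
proof (induction rule: integrable_induct)
  case (base A c)
  then show ?case using sM by (intro lip_approximable_scaleR_left lip_approximable_indicator) simp
next
  case (add f g)
  then show ?case by (intro lip_approximable_add)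
next
  case (lim f s)
  show ?case
  proof (rule lip_approximable_limit[where s=s and w="\<lambda>x. 3 * norm (f x)"])
    show "lip_approximable M (s n)" for n by (rule lim.IH)
    show "AE x in M. norm (s n x - f x) \<le> 3 * norm (f x)" for n
    proof (rule AE_I2)
      fix x assume "x \<in> space M"
      then have "norm (s n x) \<le> 2 * norm (f x)" using lim.hyps by auto
      then show "norm (s n x - f x) \<le> 3 * norm (f x)"
        using norm_triangle_ineq4[of "s n x" "f x"] by simp
    qed
  qed (use lim.hyps in auto)
qed

end

section \<open>Suprema over weighted test fields\<close>

text \<open>The infimal convolution of the truncated weight \<open>min w k\<close> with the cone of slope \<open>k\<close>: the
  largest \<open>k\<close>-Lipschitz function below \<open>min w k\<close>.\<close>

definition lower_env :: "('a::metric_space \<Rightarrow> ennreal) \<Rightarrow> nat \<Rightarrow> 'a \<Rightarrow> real" where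
  "lower_env w k x = (INF y. enn2real (min (w y) (of_nat k)) + real k * dist x y)"

lemma enn2real_min_mono: "j \<le> k \<Longrightarrow> enn2real (min (w y) (of_nat j)) \<le> enn2real (min (w y) (of_nat k))"
  by (intro enn2real_mono min.mono) (auto simp: of_nat_less_top min_less_iff_disj)

lemma lower_env_bdd: "bdd_below (range (\<lambda>y. enn2real (min (w y) (of_nat k)) + real k * dist x y))"
  by (intro bdd_belowI2[where m=0]) auto

lemma lower_env_le: "lower_env w k x \<le> enn2real (min (w y) (of_nat k)) + real k * dist x y"
  unfolding lower_env_def by (rule cINF_lower[OF lower_env_bdd UNIV_I])

lemma lower_env_ge: "(\<And>y. c \<le> enn2real (min (w y) (of_nat k)) + real k * dist x y) \<Longrightarrow> c \<le> lower_env w k x"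
  unfolding lower_env_def by (rule cINF_greatest) auto

lemma lower_env_nonneg: "0 \<le> lower_env w k x"
  by (rule lower_env_ge) auto

lemma lower_env_le_nat: "lower_env w k x \<le> real k"
proof -
  have "enn2real (min (w x) (of_nat k)) \<le> enn2real (of_nat k)"
    by (rule enn2real_mono) (auto simp: of_nat_less_top)
  then show ?thesis using lower_env_le[of w k x x] by (simp add: enn2real_of_nat)
qed

lemma lower_env_le_weight: "ennreal (lower_env w k x) \<le> w x"
proof -
  have "ennreal (lower_env w k x) \<le> ennreal (enn2real (min (w x) (of_nat k)))"
    using lower_env_le[of w k x x] by (intro ennreal_leI) simp
  also have "\<dots> = min (w x) (of_nat k)"
    by (simp add: min_less_iff_disj of_nat_less_top)
  finally show ?thesis by simp
qed

lemma lower_env_lipschitz: "(real k)-lipschitz_on UNIV (lower_env w k)"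
proof (rule lipschitz_onI)
  have le: "lower_env w k x \<le> lower_env w k y + real k * dist x y" for x y
  proof -
    have "lower_env w k x - real k * dist x y \<le> lower_env w k y"
    proof (rule lower_env_ge)
      fix z
      have "real k * dist x z \<le> real k * (dist x y + dist y z)"
        by (intro mult_left_mono dist_triangle) auto
      then show "lower_env w k x - real k * dist x y \<le> enn2real (min (w z) (of_nat k)) + real k * dist y z"
        using lower_env_le[of w k x z] by (simp add: distrib_left)
    qed
    then show ?thesis by simp
  qed
  show "dist (lower_env w k x) (lower_env w k y) \<le> real k * dist x y" for x y
    using le[of x y] le[of y x] by (simp add: dist_real_def abs_le_iff dist_commute)
qed simp

lemma lower_env_mono: "j \<le> k \<Longrightarrow> lower_env w j x \<le> lower_env w k x"
proof (rule lower_env_ge)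
  fix y assume "j \<le> k"
  then have "enn2real (min (w y) (of_nat j)) \<le> enn2real (min (w y) (of_nat k))" "real j * dist x y \<le> real k * dist x y"
    by (auto intro: enn2real_min_mono mult_right_mono)
  then show "lower_env w j x \<le> enn2real (min (w y) (of_nat k)) + real k * dist x y"
    using lower_env_le[of w j x y] by simp
qed

text \<open>If \<open>a < w x\<close>, then \<open>a < w\<close> on a ball of radius \<open>\<delta>\<close> around \<open>x\<close>. For large \<open>k\<close> the truncated
  weight is still at least \<open>a\<close> on the ball, and outside of it the cone alone is.\<close>

lemma lower_env_SUP:
  assumes lsc: "lower_semicontinuous w"
  shows "(SUP k. ennreal (lower_env w k x)) = w x"
proof (rule antisym)
  show "(SUP k. ennreal (lower_env w k x)) \<le> w x" by (intro SUP_least lower_env_le_weight)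
  show "w x \<le> (SUP k. ennreal (lower_env w k x))"
  proof (rule dense_le)
    fix a assume a: "a < w x"
    then obtain r where r: "a = ennreal r" "0 \<le> r" by (cases a) auto
    have "open {x. a < w x}" using lsc by (simp add: lower_semicontinuous_def)
    then obtain \<delta> where \<delta>: "\<delta> > 0" "ball x \<delta> \<subseteq> {x. a < w x}" using a open_contains_ball by blast
    obtain k1 k2 :: nat where "r \<le> real k1" "r / \<delta> \<le> real k2" using real_arch_simple by metis
    define k where "k = max k1 k2"
    have k: "r \<le> real k" "r / \<delta> \<le> real k" using \<open>r \<le> real k1\<close> \<open>r / \<delta> \<le> real k2\<close> by (auto simp: k_def)
    have "r \<le> lower_env w k x"
    proof (rule lower_env_ge)
      fix y
      show "r \<le> enn2real (min (w y) (of_nat k)) + real k * dist x y"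
      proof (cases "dist x y < \<delta>")
        case True
        then have "a < w y" using \<delta>(2) by auto
        then have "ennreal r \<le> min (w y) (of_nat k)"
          using k(1) by (auto simp: r(1)[symmetric]) (simp add: r ennreal_of_nat_eq_real_of_nat ennreal_leI)
        then have "enn2real (ennreal r) \<le> enn2real (min (w y) (of_nat k))"
          by (intro enn2real_mono) (auto simp: min_less_iff_disj of_nat_less_top)
        then have "r \<le> enn2real (min (w y) (of_nat k))" using r(2) by simp
        moreover have "0 \<le> real k * dist x y" by simp
        ultimately show ?thesis by linarith
      next
        case False
        have "r \<le> real k * \<delta>" using k(2) \<delta>(1) by (simp add: field_simps)
        also have "\<dots> \<le> real k * dist x y" using False by (intro mult_left_mono) auto
        finally show ?thesis by (simp add: add_increasing)
      qed
    qed
    then have "a \<le> ennreal (lower_env w k x)" unfolding r(1) by (rule ennreal_leI)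
    then show "a \<le> (SUP k. ennreal (lower_env w k x))" by (rule SUP_upper2[OF UNIV_I])
  qed
qed

lemma lower_semicontinuous_borel:
  assumes "lower_semicontinuous w"
  shows "w \<in> borel_measurable borel"
  using assms unfolding lower_semicontinuous_def
  by (intro borel_measurableI_greater) auto

text \<open>Approximate \<open>h\<close> in the mean with respect to the finite measure \<open>g N\<close> by a Lipschitz field \<open>p\<close>,
  and project \<open>p\<close> to the unit ball. The projection \<open>P\<close> is Lipschitz and no farther from the unit
  vector \<open>h\<close>, and \<open>1 - P \<bullet> h = (h - P) \<bullet> h \<le> |p - h|\<close>.\<close>

lemma ex_field_almost_attaining:
  fixes N :: "'a::euclidean_space measure" and h :: "'a \<Rightarrow> 'b::euclidean_space"
  assumes N: "locally_finite_on \<Omega> N" and h: "h \<in> borel_measurable borel"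
    and h1: "AE x in N. norm (h x) = 1"
    and g: "g \<in> lipc V" "\<And>x. 0 \<le> g x" and V: "V \<subseteq> \<Omega>" and e: "0 < e"
  obtains \<phi> where "\<phi> \<in> lipc V" "\<And>x. norm (\<phi> x) \<le> g x" "(\<integral>x. g x \<partial>N) - e < (\<integral>x. \<phi> x \<bullet> h x \<partial>N)"
proof -
  note [measurable] = h lipc_borel[OF g(1)]
  have sN[measurable_cong]: "sets N = sets borel" using N by (rule locally_finite_onD)
  have ig: "integrable N g" using lipc_mono[OF g(1) V] by (rule lipc_integrable[OF N])
  define M where "M = density N (\<lambda>x. ennreal (g x))"
  have sM[measurable_cong]: "sets M = sets borel" by (simp add: M_def sN)
  have spM: "space M = UNIV" using sets_eq_imp_space_eq[OF sM] by simp
  have fin: "finite_measure M"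
  proof
    have "emeasure M (space M) = (\<integral>\<^sup>+x. ennreal (g x) \<partial>N)"
      unfolding M_def by (subst emeasure_density) (auto intro!: nn_integral_cong simp: indicator_def)
    also have "\<dots> < \<infinity>" using ig g(2) by (simp add: integrable_iff_bounded)
    finally show "emeasure M (space M) \<noteq> \<infinity>" by simp
  qed
  have h1M: "AE x in M. norm (h x) = 1"
    unfolding M_def using h1 by (subst AE_density) auto
  interpret finite_measure M by fact
  have ih: "integrable M h"
    using h1M by (intro integrable_const_bound[where B=1]) auto
  obtain p where p: "lip_bdd p" "(\<integral>x. norm (p x - h x) \<partial>M) < e"
    using integrable_imp_lip_approximable[OF fin sM ih] e by (rule lip_approximableE)
  define P where "P = (\<lambda>x. closest_point (cball 0 1) (p x))"
  obtain L B where L: "L-lipschitz_on UNIV p" using p(1) by (rule lip_bddE, blast)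
  have P1: "norm (P x) \<le> 1" for x
    using closest_point_in_set[of "cball 0 1" "p x"] by (simp add: P_def)
  have "1-lipschitz_on UNIV (closest_point (cball 0 (1::real)) :: 'b \<Rightarrow> 'b)"
    by (rule lipschitz_onI) (auto intro!: closest_point_lipschitz)
  then have "(1 * L)-lipschitz_on UNIV P"
    unfolding P_def by (intro lipschitz_on_compose2[OF L]) (auto intro: lipschitz_on_subset)
  then have LP: "L-lipschitz_on UNIV P" by simp
  then have Pb: "lip_bdd P" using P1 by (rule lip_bddI)
  define \<phi> where "\<phi> = (\<lambda>x. g x *\<^sub>R P x)"
  have \<phi>: "\<phi> \<in> lipc V" unfolding \<phi>_def by (rule lipc_mult[OF g(1) LP P1])
  have [measurable]: "P \<in> borel_measurable borel" using Pb by (rule lip_bdd_borel)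
  have n: "norm (\<phi> x) \<le> g x" for x
    using g(2)[of x] P1[of x] by (simp add: \<phi>_def mult_left_le)
  have iP: "integrable M (\<lambda>x. P x \<bullet> h x)"
  proof (intro integrable_const_bound[where B=1])
    show "AE x in M. norm (P x \<bullet> h x) \<le> 1"
      using h1M
    proof eventually_elim
      case (elim x)
      show ?case using Cauchy_Schwarz_ineq2[of "P x" "h x"] P1[of x] elim by simp
    qed
  qed measurable
  have ie: "integrable M (\<lambda>x. norm (p x - h x))"
    by (intro integrable_norm Bochner_Integration.integrable_diff lip_bdd_integrable p fin sM ih)
  have "(\<integral>x. 1 - P x \<bullet> h x \<partial>M) \<le> (\<integral>x. norm (p x - h x) \<partial>M)"
  proof (rule integral_mono_AE)
    show "AE x in M. 1 - P x \<bullet> h x \<le> norm (p x - h x)"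
      using h1M
    proof eventually_elim
      case (elim x)
      have "h x = closest_point (cball 0 1) (h x)" using elim by (simp add: closest_point_self)
      then have "dist (P x) (h x) \<le> dist (p x) (h x)"
        unfolding P_def using closest_point_lipschitz[of "cball 0 1" "p x" "h x"] by simp
      moreover have "1 - P x \<bullet> h x = (h x - P x) \<bullet> h x"
        using elim by (simp add: inner_diff_left dot_square_norm)
      moreover have "(h x - P x) \<bullet> h x \<le> norm (h x - P x) * norm (h x)"
        by (rule norm_cauchy_schwarz)
      ultimately show ?case using elim by (simp add: dist_norm norm_minus_commute)
    qed
  qed (use iP ie in auto)
  moreover have "(\<integral>x. 1 - P x \<bullet> h x \<partial>M) = (\<integral>x. 1 \<partial>M) - (\<integral>x. P x \<bullet> h x \<partial>M)"
    using iP by (intro Bochner_Integration.integral_diff) auto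
  moreover have "(\<integral>x. 1 \<partial>M) = (\<integral>x. g x *\<^sub>R (1::real) \<partial>N)"
    unfolding M_def by (rule integral_density) (use g(2) in auto)
  moreover have "(\<integral>x. P x \<bullet> h x \<partial>M) = (\<integral>x. g x *\<^sub>R (P x \<bullet> h x) \<partial>N)"
    unfolding M_def by (rule integral_density) (use g(2) in auto)
  ultimately have "(\<integral>x. g x \<partial>N) - e < (\<integral>x. \<phi> x \<bullet> h x \<partial>N)"
    using p(2) by (simp add: \<phi>_def)
  then show ?thesis using that \<phi> n by blast
qed

text \<open>For the lower bound, \<open>w\<close> is approximated on \<open>V\<close> from below by the products of its lower envelopes
  with the indicators of a compact exhaustion; these are dominated by admissible Lipschitz
  functions with compact support in \<open>V\<close>, to which the preceding lemma applies.\<close>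

theorem SUP_weighted_fields:
  fixes N :: "'a::euclidean_space measure" and h :: "'a \<Rightarrow> 'b::euclidean_space"
  assumes N: "locally_finite_on \<Omega> N" and h: "h \<in> borel_measurable borel"
    and h1: "AE x in N. norm (h x) = 1"
    and V: "open V" "V \<subseteq> \<Omega>" and w: "lower_semicontinuous w"
  shows "(SUP \<phi>\<in>{\<phi>\<in>lipc V. \<forall>x\<in>V. ennreal (norm (\<phi> x)) \<le> w x}. ereal (\<integral>x. \<phi> x \<bullet> h x \<partial>N))
     = enn2ereal (\<integral>\<^sup>+x. w x * indicator V x \<partial>N)" (is "?S = enn2ereal ?I")
proof (rule antisym)
  note [measurable] = h lower_semicontinuous_borel[OF w]
  have sN[measurable_cong]: "sets N = sets borel" using N by (rule locally_finite_onD)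
  have Vm[measurable]: "V \<in> sets borel" using V by simp
  show "?S \<le> enn2ereal ?I"
  proof (rule SUP_least)
    fix \<phi> :: "'a \<Rightarrow> 'b" assume "\<phi> \<in> {\<phi>\<in>lipc V. \<forall>x\<in>V. ennreal (norm (\<phi> x)) \<le> w x}"
    then have \<phi>: "\<phi> \<in> lipc V" "\<And>x. x \<in> V \<Longrightarrow> ennreal (norm (\<phi> x)) \<le> w x" by auto
    note [measurable] = lipc_borel[OF \<phi>(1)]
    have "integrable N \<phi>" using lipc_mono[OF \<phi>(1) V(2)] by (rule lipc_integrable[OF N])
    then have i: "integrable N (\<lambda>x. norm (\<phi> x))" by (rule integrable_norm)
    have "(\<integral>x. \<phi> x \<bullet> h x \<partial>N) \<le> (\<integral>x. norm (\<phi> x) \<partial>N)"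
    proof (rule integral_mono_AE[OF _ i])
      show le: "AE x in N. \<phi> x \<bullet> h x \<le> norm (\<phi> x)"
        using h1 by eventually_elim (metis mult.right_neutral norm_cauchy_schwarz)
      show "integrable N (\<lambda>x. \<phi> x \<bullet> h x)"
      proof (rule Bochner_Integration.integrable_bound[OF i])
        show "AE x in N. norm (\<phi> x \<bullet> h x) \<le> norm (norm (\<phi> x))"
          using h1
        proof eventually_elim
          case (elim x)
          show ?case using Cauchy_Schwarz_ineq2[of "\<phi> x" "h x"] elim by simp
        qed
      qed measurable
    qed
    then have "ereal (\<integral>x. \<phi> x \<bullet> h x \<partial>N) \<le> enn2ereal (ennreal (\<integral>x. norm (\<phi> x) \<partial>N))"
      by (simp add: integral_nonneg_AE)
    also have "ennreal (\<integral>x. norm (\<phi> x) \<partial>N) = (\<integral>\<^sup>+x. ennreal (norm (\<phi> x)) \<partial>N)"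
      using i by (intro nn_integral_eq_integral[symmetric]) auto
    also have "enn2ereal \<dots> \<le> enn2ereal ?I"
    proof -
      have "ennreal (norm (\<phi> x)) \<le> w x * indicator V x" for x
        using \<phi> by (cases "x \<in> V") (auto elim!: lipcE)
      then show ?thesis by (simp add: less_eq_ennreal.rep_eq[symmetric] nn_integral_mono)
    qed
    finally show "ereal (\<integral>x. \<phi> x \<bullet> h x \<partial>N) \<le> enn2ereal ?I" .
  qed
  have core: "ereal (\<integral>x. g x \<partial>N) \<le> ?S"
    if g: "g \<in> lipc V" "\<And>x. 0 \<le> g x" "\<And>x. ennreal (g x) \<le> w x" for g
  proof (rule ereal_le_epsilon2)
    fix e :: real assume "0 < e"
    obtain \<phi> where \<phi>: "\<phi> \<in> lipc V" "\<And>x. norm (\<phi> x) \<le> g x" "(\<integral>x. g x \<partial>N) - e < (\<integral>x. \<phi> x \<bullet> h x \<partial>N)"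
      by (rule ex_field_almost_attaining[OF N h h1 g(1,2) V(2) \<open>0 < e\<close>]) (rule that)
    have "ennreal (norm (\<phi> x)) \<le> w x" for x
      using ennreal_leI[OF \<phi>(2)[of x]] g(3)[of x] by simp
    then have "ereal (\<integral>x. \<phi> x \<bullet> h x \<partial>N) \<le> ?S"
      using \<phi>(1) by (intro SUP_upper) auto
    then have "ereal (\<integral>x. \<phi> x \<bullet> h x \<partial>N) + ereal e \<le> ?S + ereal e" by (intro add_right_mono)
    moreover have "ereal (\<integral>x. g x \<partial>N) \<le> ereal (\<integral>x. \<phi> x \<bullet> h x \<partial>N) + ereal e" using \<phi>(3) by simp
    ultimately show "ereal (\<integral>x. g x \<partial>N) \<le> ?S + ereal e" by (rule order_trans[rotated])
  qed
  have core_enn: "(\<integral>\<^sup>+x. ennreal (g x) \<partial>N) \<le> e2ennreal ?S"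
    if g: "g \<in> lipc V" "\<And>x. 0 \<le> g x" "\<And>x. ennreal (g x) \<le> w x" for g
  proof -
    have "integrable N g" using lipc_mono[OF g(1) V(2)] by (rule lipc_integrable[OF N])
    then have "(\<integral>\<^sup>+x. ennreal (g x) \<partial>N) = ennreal (\<integral>x. g x \<partial>N)"
      using g(2) by (intro nn_integral_eq_integral) auto
    also have "\<dots> = e2ennreal (ereal (\<integral>x. g x \<partial>N))" by (simp add: ennreal.rep_eq e2ennreal_def ennreal_def max_def)
    also have "\<dots> \<le> e2ennreal ?S" by (intro e2ennreal_mono core g)
    finally show ?thesis .
  qed
  obtain C :: "nat \<Rightarrow> 'a set" where C: "\<forall>n. compact (C n)" "\<forall>n. C n \<subseteq> V"
      "\<forall>n. C n \<subseteq> interior (C (Suc n))" "\<Union>(range C) = V"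
    using compact_exhaustion[OF V(1)] by (elim exE conjE) (rule that)
  have Cb[measurable]: "C n \<in> sets borel" for n using C(1) by (simp add: borel_compact)
  have inc: "incseq C" using C(3) interior_subset by (intro incseq_SucI) blast
  have le: "(\<integral>\<^sup>+x. ennreal (lower_env w k x) * indicator (C n) x \<partial>N) \<le> e2ennreal ?S" for k n
  proof -
    obtain \<eta> W where \<eta>: "\<eta> \<in> lipc V" "\<And>x. 0 \<le> \<eta> x" "\<And>x. \<eta> x \<le> (1::real)"
      "open W" "C n \<subseteq> W" "\<And>x. x \<in> W \<Longrightarrow> \<eta> x = 1"
      by (rule lipc_cutoff[OF C(1)[rule_format] V(1) C(2)[rule_format], of n]) (rule that)
    define g where "g = (\<lambda>x. \<eta> x *\<^sub>R lower_env w k x)"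
    have g: "g \<in> lipc V" unfolding g_def
      by (rule lipc_mult[OF \<eta>(1) lower_env_lipschitz, of _ _ "real k"])
         (simp add: lower_env_nonneg lower_env_le_nat)
    have g0: "0 \<le> g x" for x using \<eta>(2)[of x] lower_env_nonneg[of w k x] by (simp add: g_def)
    have gl: "g x \<le> lower_env w k x" for x
      using \<eta>(2,3)[of x] lower_env_nonneg[of w k x] by (simp add: g_def mult_left_le_one_le)
    have gw: "ennreal (g x) \<le> w x" for x
      by (rule order_trans[OF ennreal_leI[OF gl] lower_env_le_weight])
    have "(\<integral>\<^sup>+x. ennreal (lower_env w k x) * indicator (C n) x \<partial>N) \<le> (\<integral>\<^sup>+x. ennreal (g x) \<partial>N)"
    proof (rule nn_integral_mono)
      show "ennreal (lower_env w k x) * indicator (C n) x \<le> ennreal (g x)" for x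
        using \<eta>(5,6) by (cases "x \<in> C n") (auto simp: g_def)
    qed
    also have "\<dots> \<le> e2ennreal ?S" by (rule core_enn[OF g g0 gw])
    finally show ?thesis .
  qed
  have [measurable]: "lower_env w k \<in> borel_measurable borel" for k
    using lipschitz_on_continuous_on[OF lower_env_lipschitz] by (rule borel_measurable_continuous_onI)
  have "(\<integral>\<^sup>+x. w x * indicator V x \<partial>N) = (\<integral>\<^sup>+x. (SUP k. ennreal (lower_env w k x) * indicator (C k) x) \<partial>N)"
  proof (rule nn_integral_cong)
    fix x
    show "w x * indicator V x = (SUP k. ennreal (lower_env w k x) * indicator (C k) x)"
    proof (cases "x \<in> V")
      case True
      then obtain n where n: "x \<in> C n" using C(4) by auto
      have mono: "incseq (\<lambda>k. ennreal (lower_env w k x))"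
        by (intro incseq_SucI ennreal_leI lower_env_mono) simp
      have in_k: "x \<in> C k" if "n \<le> k" for k using n that inc by (auto simp: incseq_def)
      have "w x \<le> (SUP k. ennreal (lower_env w k x) * indicator (C k) x)"
        unfolding lower_env_SUP[OF w, of x, symmetric]
      proof (rule SUP_least)
        fix k
        have "ennreal (lower_env w k x) \<le> ennreal (lower_env w (max k n) x) * indicator (C (max k n)) x"
          using in_k[of "max k n"] by (simp add: ennreal_leI lower_env_mono)
        then show "ennreal (lower_env w k x) \<le> (SUP k. ennreal (lower_env w k x) * indicator (C k) x)"
          by (rule SUP_upper2[OF UNIV_I])
      qed
      moreover have "(SUP k. ennreal (lower_env w k x) * indicator (C k) x) \<le> w x"
        using lower_env_le_weight[of w _ x] by (intro SUP_least) (auto simp: indicator_def)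
      ultimately have "w x = (SUP k. ennreal (lower_env w k x) * indicator (C k) x)" by (rule antisym)
      then show ?thesis using True by simp
    next
      case False
      then have "x \<notin> C k" for k using C(2) by auto
      then show ?thesis using False by simp
    qed
  qed
  also have "\<dots> = (SUP k. \<integral>\<^sup>+x. ennreal (lower_env w k x) * indicator (C k) x \<partial>N)"
  proof (rule nn_integral_monotone_convergence_SUP)
    show "incseq (\<lambda>k x. ennreal (lower_env w k x) * indicator (C k) x)"
    proof (intro incseq_SucI le_funI mult_mono)
      fix k x
      show "ennreal (lower_env w k x) \<le> ennreal (lower_env w (Suc k) x)"
        by (intro ennreal_leI lower_env_mono) simp
      have "C k \<subseteq> C (Suc k)" using incseq_SucD[OF inc] .
      then show "indicator (C k) x \<le> (indicator (C (Suc k)) x :: ennreal)"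
        by (auto simp: indicator_def)
    qed auto
  qed measurable
  also have "\<dots> \<le> e2ennreal ?S" by (intro SUP_least le)
  finally have fin: "?I \<le> e2ennreal ?S" .
  have "0 \<le> ?S"
    using core[of "\<lambda>x. 0"] lipc_zero[of V] by (simp add: zero_ereal_def)
  then have "enn2ereal (e2ennreal ?S) = ?S" by (rule enn2ereal_e2ennreal)
  then show "enn2ereal ?I \<le> ?S"
    using iffD1[OF less_eq_ennreal.rep_eq fin] by (simp only:)
qed

section \<open>Differentiability of Lipschitz functions along lines\<close>

text \<open>An increasing bi-Lipschitz \<open>G\<close> is a homeomorphism that maps null sets to null sets. Hence the
  image of Lebesgue measure under \<open>G\<^sup>-\<^sup>1\<close>, which assigns \<open>G b - G a\<close> to \<open>[a, b]\<close>, is absolutely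
  continuous, and \<open>g\<close> is its density.\<close>

lemma bilipschitz_indefinite_integral:
  fixes G :: "real \<Rightarrow> real"
  assumes lo: "\<And>x y. x \<le> y \<Longrightarrow> y - x \<le> G y - G x"
    and up: "\<And>x y. x \<le> y \<Longrightarrow> G y - G x \<le> L * (y - x)"
  obtains g where "\<And>a b. a \<le> b \<Longrightarrow> (g has_integral (G b - G a)) {a..b}"
proof -
  have ab: "\<bar>x - y\<bar> \<le> \<bar>G x - G y\<bar>" "\<bar>G x - G y\<bar> \<le> L * \<bar>x - y\<bar>" for x y
    using lo[of x y] up[of x y] lo[of y x] up[of y x] by (cases "x \<le> y"; simp)+
  have L: "0 \<le> L" using ab[of 0 1] by simp
  have lip: "L-lipschitz_on UNIV G"
    using ab(2) L by (intro lipschitz_onI) (auto simp: dist_real_def)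
  have cont: "continuous_on S G" for S
    using lipschitz_on_continuous_on[OF lip] by (rule continuous_on_subset) simp
  have inj: "inj G"
    using ab(1) by (intro injI) (metis abs_0 abs_le_zero_iff diff_self eq_iff_diff_eq_0)
  have surj: "surj G"
  proof -
    have "\<exists>x. G x = y" for y
    proof -
      define r where "r = \<bar>y - G 0\<bar>"
      \<comment> \<open>\<open>G\<close> grows at least as fast as the identity.\<close>
      have "G (- r) \<le> y" "y \<le> G r"
        using lo[of "-r" 0] lo[of 0 r] by (auto simp: r_def)
      then show ?thesis using IVT'[of G "-r" y r] cont by (auto simp: r_def)
    qed
    then show ?thesis by (metis surjI)
  qed
  define H where "H = inv G"
  have GH: "G (H y) = y" for y unfolding H_def using surj by (rule surj_f_inv_f)
  have HG: "H (G x) = x" for x unfolding H_def using inj by (rule inv_f_f)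
  have "1-lipschitz_on UNIV H"
    using ab(1)[of "H _" "H _"] by (intro lipschitz_onI) (auto simp: dist_real_def GH)
  then have Hm[measurable]: "H \<in> borel_measurable borel"
    using lipschitz_on_continuous_on borel_measurable_continuous_onI by blast
  define \<mu> where "\<mu> = distr lborel borel H"
  have em: "emeasure \<mu> A = emeasure lborel (G ` A)" if "A \<in> sets borel" for A
  proof -
    have "H -` A = G ` A" using GH HG by (auto simp: image_def) metis
    then show ?thesis using that by (simp add: \<mu>_def emeasure_distr)
  qed
  have Icc: "emeasure \<mu> {a..b} = ennreal (G b - G a)" if "a \<le> b" for a b
  proof -
    have "G ` {a..b} = {G a..G b}"
    proof
      show "G ` {a..b} \<subseteq> {G a..G b}" using lo[of a] lo[of _ b] by fastforce
      show "{G a..G b} \<subseteq> G ` {a..b}"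
        using IVT'[of G a _ b] that cont by (auto simp: image_def) (metis atLeastAtMost_iff)
    qed
    then show ?thesis using em[of "{a..b}"] lo[OF that] that by simp
  qed
  have "absolutely_continuous lborel \<mu>"
    unfolding absolutely_continuous_def
  proof
    fix A :: "real set" assume A: "A \<in> null_sets lborel"
    then have "negligible A" by (metis null_sets_completionI negligible_iff_null_sets)
    then have "negligible (G ` A)"
    proof (rule negligible_locally_Lipschitz_image[rotated])
      show "\<exists>T B. open T \<and> x \<in> T \<and> (\<forall>y\<in>A \<inter> T. norm (G y - G x) \<le> B * norm (y - x))" for x
        using ab(2) by (intro exI[of _ UNIV] exI[of _ L]) auto
    qed simp
    moreover have GA: "G ` A \<in> sets borel"
    proof -
      have "H -` A \<in> sets borel" using Hm A by (auto simp: null_sets_def measurable_def)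
      moreover have "H -` A = G ` A" using GH HG by (auto simp: image_def) metis
      ultimately show ?thesis by simp
    qed
    ultimately have "emeasure lborel (G ` A) = 0"
      by (simp add: negligible_iff_null_sets null_sets_def)
    then show "A \<in> null_sets \<mu>" using A em[of A] by (auto simp: null_sets_def \<mu>_def)
  qed
  then obtain u where u: "u \<in> borel_measurable lborel" "density lborel u = \<mu>"
    using sigma_finite_measure.Radon_Nikodym[OF sigma_finite_lborel, of \<mu>] by (auto simp: \<mu>_def)
  have [measurable]: "u \<in> borel_measurable borel" using u(1) by simp
  have "sigma_finite_measure \<mu>"
  proof
    show "\<exists>A. countable A \<and> A \<subseteq> sets \<mu> \<and> \<Union>A = space \<mu> \<and> (\<forall>a\<in>A. emeasure \<mu> a \<noteq> \<infinity>)"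
    proof (intro exI conjI ballI)
      show "countable (range (\<lambda>n::nat. {- real n..real n}))" by simp
      show "range (\<lambda>n::nat. {- real n..real n}) \<subseteq> sets \<mu>" by (auto simp: \<mu>_def)
      have "\<exists>n. x \<in> {- real n..real n}" for x
        using real_arch_simple[of "\<bar>x\<bar>"] by (auto simp: abs_le_iff) (metis minus_le_iff)
      then show "\<Union>(range (\<lambda>n::nat. {- real n..real n})) = space \<mu>" by (auto simp: \<mu>_def)
      show "emeasure \<mu> a \<noteq> \<infinity>" if "a \<in> range (\<lambda>n::nat. {- real n..real n})" for a
        using that Icc by auto
    qed
  qed
  then have "AE x in lborel. u x \<noteq> \<infinity>"
    using sigma_finite_measure.sigma_finite_iff_density_finite[OF sigma_finite_lborel u(1)] u(2) by simp
  then have eq: "\<mu> = density lborel (\<lambda>x. ennreal (enn2real (u x)))"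
    unfolding u(2)[symmetric] by (intro density_cong) (auto simp: ennreal_enn2real_if)
  define g where "g = (\<lambda>x. enn2real (u x))"
  have gm[measurable]: "g \<in> borel_measurable borel" unfolding g_def by measurable
  have "(g has_integral (G b - G a)) {a..b}" if "a \<le> b" for a b
  proof -
    have "(\<integral>\<^sup>+x. ennreal (indicator {a..b} x * g x) \<partial>lborel) = (\<integral>\<^sup>+x. ennreal (g x) * indicator {a..b} x \<partial>lborel)"
      by (intro nn_integral_cong) (auto simp: indicator_def)
    also have "\<dots> = emeasure \<mu> {a..b}"
      unfolding eq g_def by (subst emeasure_density) auto
    finally have nn: "(\<integral>\<^sup>+x. ennreal (indicator {a..b} x * g x) \<partial>lborel) = ennreal (G b - G a)"
      using Icc[OF that] by simp
    have "has_bochner_integral lborel (\<lambda>x. indicator {a..b} x * g x) (G b - G a)"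
      using lo[OF that] that nn by (intro has_bochner_integral_nn_integral) (auto simp: g_def)
    then have "((\<lambda>x. indicator {a..b} x * g x) has_integral (G b - G a)) UNIV"
      using has_integral_integral_lborel has_bochner_integral_iff by metis
    moreover have "(\<lambda>x. indicator {a..b} x * g x) = (\<lambda>x. if x \<in> {a..b} then g x else 0)"
      by (auto simp: indicator_def)
    ultimately have "((\<lambda>x. if x \<in> {a..b} then g x else 0) has_integral (G b - G a)) UNIV" by simp
    then show ?thesis by (simp only: has_integral_restrict_UNIV)
  qed
  then show ?thesis by (rule that)
qed

text \<open>Lebesgue's differentiation theorem for averages over the intervals \<open>[x, x + h]\<close>.\<close>

lemma lebesgue_right_derivative:
  fixes g :: "real \<Rightarrow> real"
  assumes "\<And>a b. a \<le> b \<Longrightarrow> (g has_integral (G b - G a)) {a..b}"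
  shows "\<exists>N. negligible N \<and> (\<forall>x. x \<notin> N \<longrightarrow> ((\<lambda>h. (G (x + h) - G x) / h) \<longlongrightarrow> g x) (at_right 0))"
proof -
  have "g integrable_on cbox a b" for a b
    using assms[of a b] by (cases "a \<le> b") (auto simp: integrable_on_def)
  then obtain N where N: "negligible N" "\<And>x e. \<lbrakk>x \<notin> N; 0 < e\<rbrakk> \<Longrightarrow> \<exists>d>0. \<forall>h. 0 < h \<and> h < d \<longrightarrow>
      norm (integral (cbox x (x + h *\<^sub>R One)) g /\<^sub>R h ^ DIM(real) - g x) < e"
    by (rule integrable_ccontinuous_explicit, blast)
  show ?thesis
  proof (intro exI conjI allI impI)
    show "negligible N" by (rule N(1))
    fix x assume x: "x \<notin> N"
    show "((\<lambda>h. (G (x + h) - G x) / h) \<longlongrightarrow> g x) (at_right 0)"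
    proof (rule tendstoI)
      fix e :: real assume "0 < e"
      then obtain d where d: "d > 0" "\<And>h. 0 < h \<Longrightarrow> h < d \<Longrightarrow> norm (integral (cbox x (x + h *\<^sub>R One)) g /\<^sub>R h ^ DIM(real) - g x) < e"
        using N(2)[OF x] by blast
      have "dist ((G (x + h) - G x) / h) (g x) < e" if "0 < h" "h < d" for h
      proof -
        have "integral {x..x + h} g = G (x + h) - G x"
          using assms[of x "x + h"] that by (intro integral_unique) auto
        then show ?thesis using d(2)[OF that] by (simp add: dist_real_def divide_inverse mult.commute)
      qed
      then show "\<forall>\<^sub>F h in at_right 0. dist ((G (x + h) - G x) / h) (g x) < e"
        using d(1) unfolding eventually_at_right_field by (intro exI[of _ d]) auto
    qed
  qed
qed

text \<open>Adding a large linear function makes \<open>F\<close> increasing and bi-Lipschitz, hence an indefinite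
  integral. Left derivatives come from the same integrand by reflection, so both one-sided
  derivatives agree with it almost everywhere.\<close>

theorem lipschitz_real_differentiable_AE:
  fixes F :: "real \<Rightarrow> real"
  assumes lip: "L-lipschitz_on UNIV F"
  shows "AE x in lborel. \<exists>D. (F has_real_derivative D) (at x)"
proof -
  \<comment> \<open>The slopes of \<open>G\<close> lie between \<open>1\<close> and \<open>2 L + 1\<close>.\<close>
  define G where "G = (\<lambda>x. F x + (L + 1) * x)"
  have Fd: "\<bar>F x - F y\<bar> \<le> L * \<bar>x - y\<bar>" for x y
    using lipschitz_onD[OF lip, of x y] by (simp add: dist_real_def)
  have b: "y - x \<le> G y - G x" "G y - G x \<le> (2 * L + 1) * (y - x)" if "x \<le> y" for x y
    using Fd[of y x] that by (auto simp: G_def algebra_simps abs_le_iff)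
  obtain g where g: "\<And>a b. a \<le> b \<Longrightarrow> (g has_integral (G b - G a)) {a..b}"
    using bilipschitz_indefinite_integral[OF b] by blast
  obtain N where N: "negligible N"
    "\<And>x. x \<notin> N \<Longrightarrow> ((\<lambda>h. (G (x + h) - G x) / h) \<longlongrightarrow> g x) (at_right 0)"
    using lebesgue_right_derivative[of g G, OF g] by blast
  define G' where "G' = (\<lambda>x. - G (- x))"
  have g': "((\<lambda>x. g (- x)) has_integral (G' b - G' a)) {a..b}" if "a \<le> b" for a b
  proof -
    have "(g has_integral (G (- a) - G (- b))) {- b..- a}" using g[of "- b" "- a"] that by simp
    then have "((\<lambda>x. g (- x)) has_integral (G (- a) - G (- b))) {- (- a)..- (- b)}"
      by (subst has_integral_reflect_real)
    then show ?thesis by (simp add: G'_def)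
  qed
  obtain N' where N': "negligible N'"
    "\<And>x. x \<notin> N' \<Longrightarrow> ((\<lambda>h. (G' (x + h) - G' x) / h) \<longlongrightarrow> g (- x)) (at_right 0)"
    using lebesgue_right_derivative[of "\<lambda>x. g (- x)" G', OF g'] by blast
  define M where "M = N \<union> uminus ` N'"
  have "negligible (uminus ` N')"
    using N'(1) by (intro negligible_differentiable_image_negligible)
      (auto intro!: derivative_intros differentiable_on_minus)
  then have M: "negligible M" unfolding M_def using N(1) by (rule negligible_Un[rotated])
  have D: "\<exists>D. (F has_real_derivative D) (at x)" if "x \<notin> M" for x
  proof -
    have "x \<notin> N" "- x \<notin> N'" using that by (auto simp: M_def image_iff)
    have r: "((\<lambda>h. (G (x + h) - G x) / h) \<longlongrightarrow> g x) (at_right 0)" using N(2) \<open>x \<notin> N\<close> .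
    have "(G' (- x + h) - G' (- x)) / h = (G (x + - h) - G x) / (- h)" for h
    proof -
      have "G' (- x + h) - G' (- x) = - (G (x + - h) - G x)" by (simp add: G'_def)
      then show ?thesis by (simp only: minus_divide_left minus_divide_right)
    qed
    then have "((\<lambda>h. (G (x + - h) - G x) / (- h)) \<longlongrightarrow> g x) (at_right 0)"
      using N'(2)[OF \<open>- x \<notin> N'\<close>] by (simp only: minus_minus)
    then have "((\<lambda>h. (G (x + h) - G x) / h) \<longlongrightarrow> g x) (at_left 0)"
      unfolding at_left_minus[of 0] filterlim_filtermap by (simp only: minus_zero)
    with r have "((\<lambda>h. (G (x + h) - G x) / h) \<longlongrightarrow> g x) (at 0)" by (rule filterlim_split_at_real[rotated])
    then have "(G has_real_derivative g x) (at x)" by (simp add: DERIV_def)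
    then have "((\<lambda>x. G x - (L + 1) * x) has_real_derivative g x - (L + 1)) (at x)"
      by (intro DERIV_diff) (auto intro!: derivative_eq_intros)
    then show ?thesis by (auto simp: G_def)
  qed
  have "AE x in lebesgue. \<exists>D. (F has_real_derivative D) (at x)"
    using M D unfolding negligible_iff_null_sets by (intro AE_I'[of M]) auto
  then show ?thesis by (simp add: AE_completion_iff)
qed

definition differentiable_along :: "('a::real_normed_vector \<Rightarrow> real) \<Rightarrow> 'a \<Rightarrow> 'a \<Rightarrow> bool" where
  "differentiable_along f e x \<longleftrightarrow> (\<exists>D. ((\<lambda>t. f (x + t *\<^sub>R e)) has_real_derivative D) (at 0))"

text \<open>Avoiding the value of the derivative turns differentiability into countably many
  conditions, each of which is closed in \<open>x\<close> for continuous \<open>f\<close>.\<close>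

lemma differentiable_along_iff_Cauchy:
  "differentiable_along f e x \<longleftrightarrow> (\<forall>n. \<exists>m. \<forall>h k. 0 < \<bar>h\<bar> \<and> \<bar>h\<bar> < 1 / real (Suc m) \<and> 0 < \<bar>k\<bar> \<and> \<bar>k\<bar> < 1 / real (Suc m) \<longrightarrow>
     \<bar>(f (x + h *\<^sub>R e) - f x) / h - (f (x + k *\<^sub>R e) - f x) / k\<bar> \<le> 1 / real (Suc n))"
   (is "_ \<longleftrightarrow> (\<forall>n. \<exists>m. \<forall>h k. ?S m h k \<longrightarrow> \<bar>?q h - ?q k\<bar> \<le> _)")
proof
  assume "differentiable_along f e x"
  then obtain D where "(?q \<longlongrightarrow> D) (at 0)" by (auto simp: differentiable_along_def DERIV_def)
  note lim = tendstoD[OF this]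
  have aux: "\<bar>a - D\<bar> < c \<Longrightarrow> \<bar>b - D\<bar> < c \<Longrightarrow> \<bar>a - b\<bar> < c + c" for a b c :: real by linarith
  show "\<forall>n. \<exists>m. \<forall>h k. ?S m h k \<longrightarrow> \<bar>?q h - ?q k\<bar> \<le> 1 / real (Suc n)"
  proof
    fix n
    have "0 < 1 / real (Suc n) / 2" by simp
    from lim[OF this] obtain d where d: "d > 0" "\<And>h. h \<noteq> 0 \<Longrightarrow> \<bar>h\<bar> < d \<Longrightarrow> \<bar>?q h - D\<bar> < 1 / real (Suc n) / 2"
      unfolding eventually_at dist_real_def by auto
    obtain m where m: "1 / real (Suc m) < d" using d(1) nat_approx_posE by metis
    have "\<bar>?q h - ?q k\<bar> \<le> 1 / real (Suc n)" if "?S m h k" for h k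
    proof -
      have "\<bar>?q h - D\<bar> < 1 / real (Suc n) / 2" "\<bar>?q k - D\<bar> < 1 / real (Suc n) / 2"
        using that m by (intro d(2); linarith)+
      then have "\<bar>?q h - ?q k\<bar> < 1 / real (Suc n) / 2 + 1 / real (Suc n) / 2"
        by (rule aux)
      then show ?thesis by (simp del: of_nat_Suc)
    qed
    then show "\<exists>m. \<forall>h k. ?S m h k \<longrightarrow> \<bar>?q h - ?q k\<bar> \<le> 1 / real (Suc n)" by blast
  qed
next
  assume A: "\<forall>n. \<exists>m. \<forall>h k. ?S m h k \<longrightarrow> \<bar>?q h - ?q k\<bar> \<le> 1 / real (Suc n)"
  define s where "s = (\<lambda>j. ?q (1 / real (Suc j)))"
  have "Cauchy s"
  proof (rule metric_CauchyI)
    fix \<epsilon> :: real assume "0 < \<epsilon>"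
    then obtain n where n: "1 / real (Suc n) < \<epsilon>" using nat_approx_posE by metis
    obtain m where m: "\<And>h k. ?S m h k \<Longrightarrow> \<bar>?q h - ?q k\<bar> \<le> 1 / real (Suc n)" using A by blast
    have "dist (s i) (s j) < \<epsilon>" if "Suc m \<le> i" "Suc m \<le> j" for i j
    proof -
      have "\<bar>s i - s j\<bar> \<le> 1 / real (Suc n)"
        unfolding s_def using that by (intro m) (auto simp: field_simps)
      then show ?thesis using n by (simp add: dist_real_def)
    qed
    then show "\<exists>M. \<forall>i\<ge>M. \<forall>j\<ge>M. dist (s i) (s j) < \<epsilon>" by blast
  qed
  then obtain D where D: "s \<longlonglongrightarrow> D" using Cauchy_convergent_iff convergent_def by blast
  have "(?q \<longlongrightarrow> D) (at 0)"
  proof (rule tendstoI)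
    fix \<epsilon> :: real assume "0 < \<epsilon>"
    then obtain n where n: "1 / real (Suc n) < \<epsilon>" using nat_approx_posE by metis
    obtain m where m: "\<And>h k. ?S m h k \<Longrightarrow> \<bar>?q h - ?q k\<bar> \<le> 1 / real (Suc n)" using A by blast
    have "dist (?q h) D < \<epsilon>" if h: "h \<noteq> 0" "\<bar>h\<bar> < 1 / real (Suc m)" for h
    proof -
      have "\<bar>?q h - s j\<bar> \<le> 1 / real (Suc n)" if "Suc m \<le> j" for j
        unfolding s_def using that h by (intro m) (auto simp: field_simps)
      then have ev: "eventually (\<lambda>j. \<bar>?q h - s j\<bar> \<le> 1 / real (Suc n)) sequentially"
        by (auto simp: eventually_sequentially)
      have "(\<lambda>j. \<bar>?q h - s j\<bar>) \<longlonglongrightarrow> \<bar>?q h - D\<bar>" by (intro tendsto_intros D)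
      then have "\<bar>?q h - D\<bar> \<le> 1 / real (Suc n)"
        using ev by (rule tendsto_upperbound) simp
      then show ?thesis using n by (simp add: dist_real_def)
    qed
    then show "\<forall>\<^sub>F h in at 0. dist (?q h) D < \<epsilon>"
      unfolding eventually_at by (intro exI[of _ "1 / real (Suc m)"]) auto
  qed
  then show "differentiable_along f e x" by (auto simp: differentiable_along_def DERIV_def)
qed

lemma differentiable_along_borel:
  fixes f :: "'a::euclidean_space \<Rightarrow> real"
  assumes "continuous_on UNIV f"
  shows "{x. differentiable_along f e x} \<in> sets borel"
proof -
  have cont: "continuous_on UNIV (\<lambda>x. f (x + h *\<^sub>R e))" for h
    by (rule continuous_on_compose2[OF assms]) (auto intro!: continuous_intros)
  define C where "C = (\<lambda>n m. {x. \<forall>h k. 0 < \<bar>h\<bar> \<and> \<bar>h\<bar> < 1 / real (Suc m) \<and> 0 < \<bar>k\<bar> \<and> \<bar>k\<bar> < 1 / real (Suc m) \<longrightarrow>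
     \<bar>(f (x + h *\<^sub>R e) - f x) / h - (f (x + k *\<^sub>R e) - f x) / k\<bar> \<le> 1 / real (Suc n)})"
  have "closed (C n m)" for n m
    unfolding C_def
    by (intro closed_Collect_all closed_Collect_imp open_Collect_const closed_Collect_le)
       (use cont assms in \<open>auto intro!: continuous_intros simp: divide_inverse\<close>)
  then have "(\<Inter>n. \<Union>m. C n m) \<in> sets borel" by (intro sets.countable_INT sets.countable_UN) auto
  moreover have "{x. differentiable_along f e x} = (\<Inter>n. \<Union>m. C n m)"
    unfolding differentiable_along_iff_Cauchy C_def by auto
  ultimately show ?thesis by simp
qed

text \<open>On every line in direction \<open>e\<close> the exceptional set is null. By Fubini, for almost every \<open>t\<close>
  almost every \<open>x\<close> is such that \<open>x + t e\<close> is not exceptional; a single such \<open>t\<close> suffices, since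
  Lebesgue measure is translation invariant. This avoids splitting the space into the line and
  a complement.\<close>

theorem lipschitz_differentiable_along_AE:
  fixes f :: "'a::euclidean_space \<Rightarrow> real"
  assumes lip: "L-lipschitz_on UNIV f"
  shows "AE x in lborel. differentiable_along f e x"
proof -
  define G where "G = {x. differentiable_along f e x}"
  have G[measurable]: "G \<in> sets borel" unfolding G_def
    by (rule differentiable_along_borel) (rule lipschitz_on_continuous_on[OF lip])
  have line: "AE t in lborel. x + t *\<^sub>R e \<in> G" for x
  proof -
    have "(L * norm e)-lipschitz_on UNIV (\<lambda>t. f (x + t *\<^sub>R e))"
    proof (rule lipschitz_onI)
      fix s t :: real
      have "dist (f (x + s *\<^sub>R e)) (f (x + t *\<^sub>R e)) \<le> L * dist (x + s *\<^sub>R e) (x + t *\<^sub>R e)"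
        using lip by (rule lipschitz_onD) auto
      also have "dist (x + s *\<^sub>R e) (x + t *\<^sub>R e) = norm e * dist s t"
        by (simp add: dist_norm scaleR_left_diff_distrib[symmetric] mult.commute)
      finally show "dist (f (x + s *\<^sub>R e)) (f (x + t *\<^sub>R e)) \<le> L * norm e * dist s t" by simp
    qed (use lipschitz_on_nonneg[OF lip] in simp)
    from lipschitz_real_differentiable_AE[OF this] show ?thesis
    proof eventually_elim
      case (elim t)
      then obtain D where "((\<lambda>t. f (x + t *\<^sub>R e)) has_real_derivative D) (at (0 + t))" by auto
      then have "((\<lambda>s. f (x + (s + t) *\<^sub>R e)) has_real_derivative D) (at 0)"
        by (simp only: DERIV_shift)
      then show ?case by (auto simp: G_def differentiable_along_def algebra_simps)
    qed
  qed
  have meas: "{p \<in> space (lborel \<Otimes>\<^sub>M lborel). fst p + snd p *\<^sub>R e \<in> G} \<in> sets (lborel \<Otimes>\<^sub>M (lborel :: real measure))"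
    by measurable
  have "AE x in lborel. AE t in (lborel :: real measure). x + t *\<^sub>R e \<in> G" using line by simp
  then have "AE t in (lborel :: real measure). AE x in lborel. x + t *\<^sub>R e \<in> G"
    using meas by (subst (asm) lborel_pair.AE_commute) (simp_all add: case_prod_beta)
  \<comment> \<open>What holds almost everywhere holds somewhere, as Lebesgue measure is not zero.\<close>
  then have "\<exists>t. AE x in lborel. x + t *\<^sub>R e \<in> G"
  proof -
    assume *: "AE t in (lborel :: real measure). AE x in lborel. x + t *\<^sub>R e \<in> G"
    show ?thesis
    proof (rule ccontr)
      assume "\<not> ?thesis"
      with * have "AE t in (lborel :: real measure). False" by simp
      then show False by (simp add: AE_iff_measurable[of UNIV] emeasure_lborel_UNIV)
    qed
  qed
  then obtain t where t: "AE x in lborel. t *\<^sub>R e + x \<in> G" by (auto simp: add.commute)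
  have "AE x in distr lborel borel ((+) (t *\<^sub>R e)). x \<in> G"
    using t by (subst AE_distr_iff) auto
  then have "AE x in lborel. x \<in> G" unfolding lborel_distr_plus .
  then show ?thesis by (simp add: G_def)
qed

section \<open>The divergence pairing\<close>

text \<open>Points outside \<open>V\<close> have a positive distance from the support, so there the bound of \<open>\<phi>\<close>
  controls the difference quotients.\<close>

lemma Lip_c_eq_lipc:
  fixes V :: "(real^'n) set"
  assumes "open V"
  shows "Lip_c V = lipc V"
proof (intro equalityI subsetI)
  fix \<phi> :: "real^'n \<Rightarrow> real^'n" assume \<phi>: "\<phi> \<in> lipc V"
  then obtain L where "L-lipschitz_on UNIV \<phi>" by (rule lipcE, blast)
  then have "L-lipschitz_on V \<phi>" by (rule lipschitz_on_subset) simp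
  then show "\<phi> \<in> Lip_c V" unfolding Lip_c_def using lipc_support[OF \<phi>] by blast
next
  fix \<phi> :: "real^'n \<Rightarrow> real^'n" assume "\<phi> \<in> Lip_c V"
  then obtain L where L: "L-lipschitz_on V \<phi>"
    and K: "compact (closure {x. \<phi> x \<noteq> 0})" "closure {x. \<phi> x \<noteq> 0} \<subseteq> V"
    unfolding Lip_c_def by blast
  define K where "K = closure {x. \<phi> x \<noteq> 0}"
  have Kc: "compact K" "K \<subseteq> V" using K by (auto simp: K_def)
  have z: "\<phi> x = 0" if "x \<notin> K" for x using that closure_subset[of "{x. \<phi> x \<noteq> 0}"] unfolding K_def by blast
  show "\<phi> \<in> lipc V"
  proof (cases "K = {}")
    case True
    then have "\<phi> = (\<lambda>x. 0)" using z by auto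
    then show ?thesis by (simp add: lipc_zero)
  next
    case False
    obtain \<delta> where \<delta>: "\<delta> > 0" "{x. infdist x K \<le> \<delta>} \<subseteq> V"
      using compact_in_open_separated[OF False Kc(1) assms Kc(2)] .
    have "continuous_on K \<phi>" using lipschitz_on_continuous_on[OF L] Kc(2) by (rule continuous_on_subset)
    then have "bounded (\<phi> ` K)" using Kc(1) by (intro compact_imp_bounded compact_continuous_image)
    then obtain B where B: "B > 0" "\<And>x. x \<in> K \<Longrightarrow> norm (\<phi> x) \<le> B" unfolding bounded_pos by auto
    have near: "norm (\<phi> x - \<phi> y) \<le> (B / \<delta>) * dist x y" if "x \<in> K" "y \<notin> V" for x y
    proof -
      have "y \<notin> K" using that Kc(2) by auto
      have "\<not> infdist y K \<le> \<delta>" using that(2) \<delta>(2) by blast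
      then have "\<delta> < infdist y K" by simp
      also have "\<dots> \<le> dist y x" using that(1) by (rule infdist_le)
      finally have "B * \<delta> \<le> B * dist x y" using B(1) by (intro mult_left_mono) (auto simp: dist_commute)
      then have "B \<le> (B / \<delta>) * dist x y" using \<delta>(1) by (simp add: field_simps)
      then show ?thesis using z[OF \<open>y \<notin> K\<close>] B(2)[OF that(1)] by simp
    qed
    have far: "norm (\<phi> x - \<phi> y) \<le> (B / \<delta>) * dist x y" if "y \<notin> V" for x y
    proof (cases "x \<in> K")
      case False
      have "y \<notin> K" using that Kc(2) by blast
      then show ?thesis using z[OF False] z[of y] B(1) \<delta>(1) by simp
    qed (rule near[OF _ that])
    have L0: "0 \<le> L" using L by (rule lipschitz_on_nonneg)
    have "(max L (B / \<delta>))-lipschitz_on UNIV \<phi>"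
    proof (rule lipschitz_onI)
      fix x y
      have "dist (\<phi> x) (\<phi> y) \<le> L * dist x y \<or> dist (\<phi> x) (\<phi> y) \<le> (B / \<delta>) * dist x y"
      proof (cases "x \<in> V \<and> y \<in> V")
        case True
        then show ?thesis using lipschitz_onD[OF L] by blast
      next
        case False
        then have "dist (\<phi> x) (\<phi> y) \<le> (B / \<delta>) * dist x y"
          using far[of y x] far[of x y] by (metis dist_commute dist_norm)
        then show ?thesis ..
      qed
      moreover have "L * dist x y \<le> max L (B / \<delta>) * dist x y" "(B / \<delta>) * dist x y \<le> max L (B / \<delta>) * dist x y"
        by (intro mult_right_mono; simp)+
      ultimately show "dist (\<phi> x) (\<phi> y) \<le> max L (B / \<delta>) * dist x y" by linarith
    qed (use L0 in simp)
    then show ?thesis by (rule lipcI[OF _ Kc z])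
  qed
qed

definition partials_exist :: "(real^'n \<Rightarrow> real^'n) \<Rightarrow> real^'n \<Rightarrow> bool" where
  "partials_exist \<phi> x \<longleftrightarrow> (\<forall>i. differentiable_along (\<lambda>y. \<phi> y $ i) (axis i 1) x)"

lemma lipschitz_component:
  fixes \<phi> :: "'a::metric_space \<Rightarrow> real^'n"
  assumes "L-lipschitz_on UNIV \<phi>"
  shows "L-lipschitz_on UNIV (\<lambda>y. \<phi> y $ i)"
proof (rule lipschitz_onI)
  fix x y
  have "dist (\<phi> x $ i) (\<phi> y $ i) \<le> dist (\<phi> x) (\<phi> y)" by (rule dist_vec_nth_le)
  also have "\<dots> \<le> L * dist x y" using assms by (rule lipschitz_onD) auto
  finally show "dist (\<phi> x $ i) (\<phi> y $ i) \<le> L * dist x y" .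
qed (rule lipschitz_on_nonneg[OF assms])

lemma partials_exist_borel: "continuous_on UNIV \<phi> \<Longrightarrow> {x. partials_exist \<phi> x} \<in> sets borel"
proof -
  assume c: "continuous_on UNIV \<phi>"
  have "{x. partials_exist \<phi> x} = (\<Inter>i. {x. differentiable_along (\<lambda>y. \<phi> y $ i) (axis i 1) x})"
    by (auto simp: partials_exist_def)
  also have "\<dots> \<in> sets borel"
    by (intro sets.finite_INT differentiable_along_borel continuous_on_component c) auto
  finally show ?thesis .
qed

lemma partials_exist_AE:
  assumes "L-lipschitz_on UNIV \<phi>"
  shows "AE x in lebesgue. partials_exist \<phi> x"
proof -
  have "AE x in lborel. partials_exist \<phi> x"
    unfolding partials_exist_def
    using lipschitz_differentiable_along_AE[OF lipschitz_component[OF assms]]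
    by (subst AE_all_countable) blast
  then show ?thesis by (simp add: AE_completion_iff)
qed

lemma partials_existD:
  assumes "partials_exist \<phi> x"
  shows "((\<lambda>t. \<phi> (x + t *\<^sub>R axis i 1) $ i) has_real_derivative
      deriv (\<lambda>t. \<phi> (x + t *\<^sub>R axis i 1) $ i) 0) (at 0)"
proof -
  obtain D where D: "((\<lambda>t. \<phi> (x + t *\<^sub>R axis i 1) $ i) has_real_derivative D) (at 0)"
    using assms unfolding partials_exist_def differentiable_along_def by blast
  then show ?thesis using DERIV_imp_deriv[OF D] by simp
qed

lemma divergence_add:
  assumes "partials_exist \<phi> x" "partials_exist \<psi> x"
  shows "divergence (\<lambda>y. \<phi> y + \<psi> y) x = divergence \<phi> x + divergence \<psi> x"
  unfolding divergence_def vector_add_component sum.distrib[symmetric]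
  by (intro sum.cong refl DERIV_imp_deriv DERIV_add partials_existD assms)

lemma divergence_scaleR:
  assumes "partials_exist \<phi> x"
  shows "divergence (\<lambda>y. c *\<^sub>R \<phi> y) x = c * divergence \<phi> x"
  unfolding divergence_def vector_scaleR_component sum_distrib_left real_scaleR_def
  by (intro sum.cong refl DERIV_imp_deriv DERIV_cmult partials_existD assms)

lemma divergence_outside:
  fixes \<phi> :: "real^'n \<Rightarrow> real^'n"
  assumes K: "closed K" and z: "\<And>x. x \<notin> K \<Longrightarrow> \<phi> x = 0" and x: "x \<notin> K"
  shows "divergence \<phi> x = 0"
proof -
  have "deriv (\<lambda>t. \<phi> (x + t *\<^sub>R axis i 1) $ i) 0 = 0" for i
  proof (rule DERIV_imp_deriv)
    have "open (- K)" using K by auto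
    then obtain r where r: "r > 0" "ball x r \<subseteq> - K" using x open_contains_ball by blast
    have "\<phi> (x + t *\<^sub>R axis i 1) $ i = 0" if "dist t 0 < r" for t
    proof -
      have "dist x (x + t *\<^sub>R axis i 1) < r" using that by (simp add: dist_norm)
      then have "x + t *\<^sub>R axis i 1 \<notin> K" using r(2) by (meson ComplD mem_ball subsetD)
      then show ?thesis by (simp add: z)
    qed
    then have ev: "\<forall>\<^sub>F t in nhds 0. 0 = \<phi> (x + t *\<^sub>R axis i 1) $ i"
      using r(1) unfolding eventually_nhds_metric by (intro exI[of _ r]) auto
    have "((\<lambda>t. 0) has_real_derivative 0) (at (0::real))" by simp
    then show "((\<lambda>t. \<phi> (x + t *\<^sub>R axis i 1) $ i) has_real_derivative 0) (at 0)"
      using DERIV_cong_ev[OF refl ev refl] by simp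
  qed
  then show ?thesis by (simp add: divergence_def)
qed

lemma partials_exist_LIMSEQ:
  fixes \<phi> :: "real^'n \<Rightarrow> real^'n"
  assumes "partials_exist \<phi> x"
  shows "(\<lambda>n. \<Sum>i\<in>UNIV. (\<phi> (x + (1 / real (Suc n)) *\<^sub>R axis i 1) $ i - \<phi> x $ i) / (1 / real (Suc n)))
     \<longlonglongrightarrow> divergence \<phi> x"
  unfolding divergence_def
proof (rule tendsto_sum)
  fix i :: 'n
  have "(\<lambda>h. (\<phi> (x + h *\<^sub>R axis i 1) $ i - \<phi> x $ i) / h) \<midarrow>0\<rightarrow> deriv (\<lambda>t. \<phi> (x + t *\<^sub>R axis i 1) $ i) 0"
    using partials_existD[OF assms, of i] by (simp add: DERIV_def)
  moreover have "filterlim (\<lambda>n. 1 / real (Suc n)) (at 0) sequentially"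
    using LIMSEQ_inverse_real_of_nat by (auto simp: filterlim_at inverse_eq_divide)
  ultimately show "(\<lambda>n. (\<phi> (x + (1 / real (Suc n)) *\<^sub>R axis i 1) $ i - \<phi> x $ i) / (1 / real (Suc n)))
     \<longlonglongrightarrow> deriv (\<lambda>t. \<phi> (x + t *\<^sub>R axis i 1) $ i) 0"
    by (rule filterlim_compose)
qed

lemma divergence_bound:
  fixes \<phi> :: "real^'n \<Rightarrow> real^'n"
  assumes L: "L-lipschitz_on UNIV \<phi>" and p: "partials_exist \<phi> x"
  shows "\<bar>divergence \<phi> x\<bar> \<le> real CARD('n) * L"
proof -
  have "\<bar>\<Sum>i\<in>UNIV. (\<phi> (x + (1 / real (Suc n)) *\<^sub>R axis i 1) $ i - \<phi> x $ i) / (1 / real (Suc n))\<bar> \<le> real CARD('n) * L" for n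
  proof -
    have "\<bar>(\<phi> (x + (1 / real (Suc n)) *\<^sub>R axis i 1) $ i - \<phi> x $ i) / (1 / real (Suc n))\<bar> \<le> L" for i
    proof -
      have "dist (\<phi> (x + (1 / real (Suc n)) *\<^sub>R axis i 1) $ i) (\<phi> x $ i) \<le> L * dist (x + (1 / real (Suc n)) *\<^sub>R axis i 1) x"
        using lipschitz_component[OF L] by (rule lipschitz_onD) auto
      also have "dist (x + (1 / real (Suc n)) *\<^sub>R axis i 1) x = 1 / real (Suc n)"
        by (simp add: dist_norm)
      finally have "\<bar>\<phi> (x + (1 / real (Suc n)) *\<^sub>R axis i 1) $ i - \<phi> x $ i\<bar> \<le> L * (1 / real (Suc n))"
        by (simp only: dist_real_def)
      then show ?thesis unfolding abs_divide by (subst pos_divide_le_eq) auto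
    qed
    then have "(\<Sum>i\<in>(UNIV::'n set). \<bar>(\<phi> (x + (1 / real (Suc n)) *\<^sub>R axis i 1) $ i - \<phi> x $ i) / (1 / real (Suc n))\<bar>) \<le> (\<Sum>i\<in>(UNIV::'n set). L)"
      by (intro sum_mono)
    from order_trans[OF sum_abs this] show ?thesis by simp
  qed
  then show ?thesis
    by (intro tendsto_upperbound[OF tendsto_rabs[OF partials_exist_LIMSEQ[OF p]]] always_eventually allI) simp_all
qed

text \<open>Off \<open>G\<close> every set is a null set of the complete Lebesgue measure.\<close>

lemma lebesgue_measurable_if_AE_eq:
  fixes f d :: "'a::euclidean_space \<Rightarrow> 'b::topological_space"
  assumes G: "G \<in> sets lebesgue" "AE x in lebesgue. x \<in> G"
    and d: "d \<in> borel_measurable lebesgue" and eq: "\<And>x. x \<in> G \<Longrightarrow> f x = d x"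
  shows "f \<in> borel_measurable lebesgue"
proof (rule measurableI)
  fix S :: "'b set" assume S: "S \<in> sets borel"
  have dS: "d -` S \<in> sets lebesgue" using measurable_sets[OF d S] by simp
  have "- G \<in> null_sets lebesgue"
    using G(2) Compl_in_sets_lebesgue[of G] G(1) AE_iff_null_sets[of "- G" lebesgue] by simp
  then have "f -` S \<inter> - G \<in> null_sets lebesgue"
    by (rule null_sets_completion_subset[rotated]) simp
  then have "f -` S \<inter> - G \<in> sets lebesgue" by auto
  moreover have "f -` S \<inter> space lebesgue = (d -` S \<inter> G) \<union> (f -` S \<inter> - G)" using eq by auto
  moreover have "d -` S \<inter> G \<in> sets lebesgue" using dS G(1) by (rule sets.Int)
  ultimately show "f -` S \<inter> space lebesgue \<in> sets lebesgue" by (simp only: sets.Un)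
qed simp

text \<open>Where the partial derivatives exist the divergence is a limit of difference quotients,
  which are continuous; the remaining points form a null set.\<close>

lemma divergence_measurable:
  fixes \<phi> :: "real^'n \<Rightarrow> real^'n"
  assumes L: "L-lipschitz_on UNIV \<phi>"
  shows "divergence \<phi> \<in> borel_measurable lebesgue"
proof -
  have c: "continuous_on UNIV \<phi>" using L by (rule lipschitz_on_continuous_on)
  define G where "G = {x. partials_exist \<phi> x}"
  have Gb[measurable]: "G \<in> sets borel" unfolding G_def using c by (rule partials_exist_borel)
  define d where "d = (\<lambda>x. if x \<in> G then divergence \<phi> x else 0)"
  define u where "u = (\<lambda>n x. if x \<in> G then \<Sum>i\<in>UNIV. (\<phi> (x + (1 / real (Suc n)) *\<^sub>R axis i 1) $ i - \<phi> x $ i) / (1 / real (Suc n)) else 0)"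
  have cont: "continuous_on UNIV (\<lambda>x. \<phi> (x + v) $ i)" for v i
    by (rule continuous_on_component, rule continuous_on_compose2[OF c])
       (intro continuous_on_add continuous_on_id continuous_on_const, simp)
  have bm: "(\<lambda>x. \<phi> (x + v) $ i) \<in> borel_measurable borel" for v i
    by (rule borel_measurable_continuous_onI[OF cont])
  have bm0: "(\<lambda>x. \<phi> x $ i) \<in> borel_measurable borel" for i
    using bm[of 0 i] by simp
  have "u n \<in> borel_measurable borel" for n
    unfolding u_def
    by (intro measurable_If_set borel_measurable_sum borel_measurable_divide borel_measurable_diff
        borel_measurable_const bm bm0) simp
  moreover have "(\<lambda>n. u n x) \<longlonglongrightarrow> d x" for x
  proof (cases "x \<in> G")
    case True
    then show ?thesis
      using partials_exist_LIMSEQ[of \<phi> x] unfolding u_def d_def by (simp only: G_def mem_Collect_eq if_True)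
  next
    case False
    then show ?thesis by (simp only: u_def d_def if_False tendsto_const)
  qed
  ultimately have "d \<in> borel_measurable borel"
    by (rule borel_measurable_LIMSEQ_real[rotated])
  then have d: "d \<in> borel_measurable lebesgue" by (intro measurable_completion) simp
  have G: "G \<in> sets lebesgue" using Gb by simp
  have AE: "AE x in lebesgue. x \<in> G" using partials_exist_AE[OF L] by (simp add: G_def)
  show ?thesis
    by (rule lebesgue_measurable_if_AE_eq[OF G AE d]) (simp add: d_def)
qed

definition div_pairing :: "(real^'n) set \<Rightarrow> (real^'n \<Rightarrow> real) \<Rightarrow> (real^'n \<Rightarrow> real^'n) \<Rightarrow> real" where
  "div_pairing \<Omega> f \<phi> = (LINT x:\<Omega>|lebesgue. f x * divergence \<phi> x)"

lemma zero_extension_measurable: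
  assumes "open \<Omega>" "f \<in> borel_measurable (lebesgue_on \<Omega>)"
  shows "(\<lambda>x. indicat_real \<Omega> x *\<^sub>R f x :: real) \<in> borel_measurable lebesgue"
  using assms borel_measurable_restrict_space_iff[of \<Omega> lebesgue f] by simp

text \<open>Almost everywhere the divergence is bounded by the dimension times the Lipschitz constant, and
  it vanishes off the support, where \<open>f\<close> need not be integrable.\<close>

lemma div_pairing_integrable:
  fixes \<phi> :: "real^'n \<Rightarrow> real^'n"
  assumes op: "open \<Omega>" and f: "f \<in> L1_loc \<Omega> (\<lambda>_. 1)" and \<phi>: "\<phi> \<in> lipc \<Omega>"
  shows "integrable lebesgue (\<lambda>x. indicat_real \<Omega> x *\<^sub>R (f x * divergence \<phi> x))"
proof -
  obtain L K where K: "L-lipschitz_on UNIV \<phi>" "compact K" "K \<subseteq> \<Omega>" "\<And>x. x \<notin> K \<Longrightarrow> \<phi> x = 0"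
    using \<phi> by (rule lipcE, blast)
  have fm: "f \<in> borel_measurable (lebesgue_on \<Omega>)" and
    fK: "(\<integral>\<^sup>+x\<in>K. ennreal \<bar>f x\<bar> * 1 \<partial>lebesgue) < \<infinity>"
    using f K(2,3) unfolding L1_loc_def mem_Collect_eq by blast+
  note fm' = zero_extension_measurable[OF op fm]
  have dm: "divergence \<phi> \<in> borel_measurable lebesgue" using K(1) by (rule divergence_measurable)
  define C where "C = real CARD('n) * L"
  have C0: "0 \<le> C" using lipschitz_on_nonneg[OF K(1)] by (simp add: C_def)
  have meas: "(\<lambda>x. indicat_real \<Omega> x *\<^sub>R (f x * divergence \<phi> x)) \<in> borel_measurable lebesgue"
    using borel_measurable_times[OF fm' dm] by (simp add: mult.assoc)
  have "(\<integral>\<^sup>+x. ennreal (norm (indicat_real \<Omega> x *\<^sub>R (f x * divergence \<phi> x))) \<partial>lebesgue)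
      \<le> (\<integral>\<^sup>+x. ennreal C * (ennreal \<bar>indicat_real \<Omega> x *\<^sub>R f x\<bar> * indicator K x) \<partial>lebesgue)"
  proof (rule nn_integral_mono_AE)
    show "AE x in lebesgue. ennreal (norm (indicat_real \<Omega> x *\<^sub>R (f x * divergence \<phi> x)))
        \<le> ennreal C * (ennreal \<bar>indicat_real \<Omega> x *\<^sub>R f x\<bar> * indicator K x)"
      using partials_exist_AE[OF K(1)]
    proof eventually_elim
      case (elim x)
      show ?case
      proof (cases "x \<in> K")
        case True
        have "\<bar>f x * divergence \<phi> x\<bar> \<le> C * \<bar>f x\<bar>"
          using divergence_bound[OF K(1) elim] by (simp only: abs_mult C_def mult.commute[of _ "\<bar>f x\<bar>"], intro mult_left_mono, simp_all)
        then have "ennreal \<bar>f x * divergence \<phi> x\<bar> \<le> ennreal C * ennreal \<bar>f x\<bar>"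
          using C0 by (simp add: ennreal_mult[symmetric] ennreal_leI)
        then show ?thesis using True subsetD[OF K(3) True] by simp
      next
        case False
        then have "divergence \<phi> x = 0"
          by (intro divergence_outside[OF compact_imp_closed[OF K(2)] K(4)])
        then show ?thesis by simp
      qed
    qed
  qed
  also have "\<dots> = ennreal C * (\<integral>\<^sup>+x. ennreal \<bar>indicat_real \<Omega> x *\<^sub>R f x\<bar> * indicator K x \<partial>lebesgue)"
  proof (rule nn_integral_cmult)
    have "K \<in> sets lebesgue" using borel_compact[OF K(2)] by simp
    then show "(\<lambda>x. ennreal \<bar>indicat_real \<Omega> x *\<^sub>R f x\<bar> * indicator K x) \<in> borel_measurable lebesgue"
      using fm' by measurable
  qed
  also have "(\<integral>\<^sup>+x. ennreal \<bar>indicat_real \<Omega> x *\<^sub>R f x\<bar> * indicator K x \<partial>lebesgue)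
      = (\<integral>\<^sup>+x\<in>K. ennreal \<bar>f x\<bar> * 1 \<partial>lebesgue)"
    using K(3) by (intro nn_integral_cong) (auto simp: indicator_def)
  also have "ennreal C * \<dots> < \<infinity>" using fK by (simp add: ennreal_mult_less_top)
  finally show ?thesis using meas by (simp add: integrable_iff_bounded)
qed

lemma div_pairing_add:
  assumes "open \<Omega>" "f \<in> L1_loc \<Omega> (\<lambda>_. 1)" "\<phi> \<in> lipc \<Omega>" "\<psi> \<in> lipc \<Omega>"
  shows "div_pairing \<Omega> f (\<lambda>x. \<phi> x + \<psi> x) = div_pairing \<Omega> f \<phi> + div_pairing \<Omega> f \<psi>"
proof -
  obtain L where L: "L-lipschitz_on UNIV \<phi>" using assms(3) by (rule lipcE, blast)
  obtain M where M: "M-lipschitz_on UNIV \<psi>" using assms(4) by (rule lipcE, blast)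
  note i = div_pairing_integrable[OF assms(1,2,3)] div_pairing_integrable[OF assms(1,2,4)]
    div_pairing_integrable[OF assms(1,2) lipc_add[OF assms(3,4)]]
  have "div_pairing \<Omega> f (\<lambda>x. \<phi> x + \<psi> x) =
      (LINT x|lebesgue. indicat_real \<Omega> x *\<^sub>R (f x * divergence \<phi> x) + indicat_real \<Omega> x *\<^sub>R (f x * divergence \<psi> x))"
    unfolding div_pairing_def set_lebesgue_integral_def
  proof (rule integral_cong_AE)
    show "AE x in lebesgue. indicat_real \<Omega> x *\<^sub>R (f x * divergence (\<lambda>x. \<phi> x + \<psi> x) x) =
        indicat_real \<Omega> x *\<^sub>R (f x * divergence \<phi> x) + indicat_real \<Omega> x *\<^sub>R (f x * divergence \<psi> x)"
      using partials_exist_AE[OF L] partials_exist_AE[OF M]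
      by eventually_elim (simp add: divergence_add algebra_simps)
  qed (use i in auto)
  then show ?thesis
    unfolding div_pairing_def set_lebesgue_integral_def using i by simp
qed

lemma div_pairing_scaleR:
  assumes "open \<Omega>" "f \<in> L1_loc \<Omega> (\<lambda>_. 1)" "\<phi> \<in> lipc \<Omega>"
  shows "div_pairing \<Omega> f (\<lambda>x. c *\<^sub>R \<phi> x) = c * div_pairing \<Omega> f \<phi>"
proof -
  obtain L where L: "L-lipschitz_on UNIV \<phi>" using assms(3) by (rule lipcE, blast)
  note i = div_pairing_integrable[OF assms] div_pairing_integrable[OF assms(1,2) lipc_scaleR[OF assms(3)]]
  have "div_pairing \<Omega> f (\<lambda>x. c *\<^sub>R \<phi> x) = (LINT x|lebesgue. c * (indicat_real \<Omega> x *\<^sub>R (f x * divergence \<phi> x)))"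
    unfolding div_pairing_def set_lebesgue_integral_def
  proof (rule integral_cong_AE)
    show "AE x in lebesgue. indicat_real \<Omega> x *\<^sub>R (f x * divergence (\<lambda>x. c *\<^sub>R \<phi> x) x) =
        c * (indicat_real \<Omega> x *\<^sub>R (f x * divergence \<phi> x))"
      using partials_exist_AE[OF L] by eventually_elim (simp add: divergence_scaleR)
  qed (use i in auto)
  then show ?thesis
    unfolding div_pairing_def set_lebesgue_integral_def using i by simp
qed

lemma div_pairing_local:
  assumes "\<phi> \<in> lipc V" "V \<subseteq> \<Omega>"
  shows "div_pairing \<Omega> f \<phi> = div_pairing V f \<phi>"
proof -
  obtain L K where K: "L-lipschitz_on UNIV \<phi>" "compact K" "K \<subseteq> V" "\<And>x. x \<notin> K \<Longrightarrow> \<phi> x = 0"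
    using assms(1) by (rule lipcE, blast)
  have "divergence \<phi> x = 0" if "x \<notin> V" for x
    using that K(3) by (intro divergence_outside[OF compact_imp_closed[OF K(2)] K(4)]) auto
  then show ?thesis
    unfolding div_pairing_def set_lebesgue_integral_def using assms(2)
    by (intro Bochner_Integration.integral_cong) (auto simp: indicator_def)
qed

lemma weighted_variation_eq:
  assumes "open V" "V \<subseteq> \<Omega>"
  shows "weighted_variation w f V =
     (SUP \<phi>\<in>{\<phi>\<in>lipc V. \<forall>x\<in>V. ennreal (norm (\<phi> x)) \<le> w x}. ereal (div_pairing \<Omega> f \<phi>))"
  unfolding weighted_variation_def Lip_c_eq_lipc[OF assms(1)]
  by (intro SUP_cong refl) (simp add: div_pairing_local[OF _ assms(2)] flip: div_pairing_def)

section \<open>The weighted variation measure\<close>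

lemma compactly_contained_nbhd:
  fixes \<Omega> :: "'a::heine_borel set"
  assumes "compact K" "open \<Omega>" "K \<subseteq> \<Omega>"
  obtains V where "compactly_contained V \<Omega>" "K \<subseteq> V"
proof -
  obtain h W where h: "h \<in> lipc \<Omega>" "\<And>x. 0 \<le> h x" "\<And>x. h x \<le> (1::real)"
    "open W" "K \<subseteq> W" "\<And>x. x \<in> W \<Longrightarrow> h x = 1"
    by (rule lipc_cutoff[OF assms]) (rule that)
  define V where "V = {x. 1 / 2 < h x}"
  have V: "V \<subseteq> {x. h x \<noteq> 0}" by (auto simp: V_def)
  have op: "open V"
    unfolding V_def by (intro open_Collect_less continuous_on_const lipc_continuous[OF h(1)])
  have sub: "closure V \<subseteq> closure {x. h x \<noteq> 0}" using V by (rule closure_mono)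
  have "compact (closure {x. h x \<noteq> 0} \<inter> closure V)"
    using lipc_support(1)[OF h(1)] by (rule compact_Int_closed) simp
  then have "compact (closure V)" using sub by (simp add: Int_absorb1)
  moreover have "closure V \<subseteq> \<Omega>" using sub lipc_support(2)[OF h(1)] by (rule order_trans)
  ultimately have "compactly_contained V \<Omega>" using op by (simp add: compactly_contained_def)
  moreover have "K \<subseteq> V"
  proof
    fix x assume "x \<in> K"
    then have "h x = 1" using h(5,6) by blast
    then show "x \<in> V" by (simp add: V_def)
  qed
  ultimately show ?thesis by (rule that)
qed

text \<open>The open sets \<open>{w > 1 / Suc n}\<close> increase and cover \<open>K\<close>.\<close>

lemma lower_semicontinuous_lower_bound:
  fixes w :: "'a::topological_space \<Rightarrow> ennreal"
  assumes lsc: "lower_semicontinuous w" and pos: "\<And>x. 0 < w x" and K: "compact K"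
  obtains c :: real where "0 < c" "\<And>x. x \<in> K \<Longrightarrow> ennreal c \<le> w x"
proof -
  define U where "U = (\<lambda>n::nat. {x. ennreal (1 / real (Suc n)) < w x})"
  have op: "open (U n)" for n using lsc by (simp add: U_def lower_semicontinuous_def)
  have cov: "K \<subseteq> (\<Union>n\<in>UNIV. U n)"
  proof
    fix x assume "x \<in> K"
    obtain r where r: "0 < r" "ennreal r < w x"
    proof (cases "w x")
      case (real t)
      then have "0 < t" using pos[of x] by simp
      then show ?thesis using real by (intro that[of "t / 2"]) (auto simp: ennreal_less_iff)
    next
      case top
      then show ?thesis by (intro that[of 1]) auto
    qed
    obtain n where "1 / real (Suc n) < r" using r(1) nat_approx_posE by metis
    then have "ennreal (1 / real (Suc n)) < w x"
      using r ennreal_leI[of "1 / real (Suc n)" r] by (meson le_less_trans less_imp_le)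
    then show "x \<in> (\<Union>n\<in>UNIV. U n)" by (auto simp: U_def)
  qed
  obtain C where C: "finite C" "K \<subseteq> (\<Union>n\<in>C. U n)"
    by (rule compactE_image[OF K, of UNIV U]) (use op cov in auto)
  define m where "m = Max (insert 0 C)"
  show ?thesis
  proof (rule that)
    show "0 < 1 / real (Suc m)" by simp
    fix x assume "x \<in> K"
    then obtain n where n: "n \<in> C" "x \<in> U n" using C(2) by blast
    have "n \<le> m" using n(1) C(1) by (simp add: m_def)
    then have "ennreal (1 / real (Suc m)) \<le> ennreal (1 / real (Suc n))"
      by (intro ennreal_leI) (simp add: field_simps)
    also have "\<dots> \<le> w x" using n(2) by (simp add: U_def)
    finally show "ennreal (1 / real (Suc m)) \<le> w x" .
  qed
qed

text \<open>If \<open>w \<ge> c > 0\<close> on the closure of \<open>V\<close>, then \<open>c \<phi>\<close> is admissible for \<open>w\<close> whenever \<open>|\<phi>| \<le> 1\<close>.\<close>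

lemma BV_loc_subset_unweighted:
  fixes \<Omega> :: "(real^'n) set"
  assumes op: "open \<Omega>" and pos: "\<And>x. 0 < w x" and lsc: "lower_semicontinuous w"
    and f: "f \<in> BV_loc \<Omega> w"
  shows "f \<in> BV_loc \<Omega> (\<lambda>_. 1)"
proof -
  have fm: "f \<in> borel_measurable (lebesgue_on \<Omega>)"
    and fK: "\<And>K. compact K \<Longrightarrow> K \<subseteq> \<Omega> \<Longrightarrow> (\<integral>\<^sup>+x\<in>K. ennreal \<bar>f x\<bar> * w x \<partial>lebesgue) < \<infinity>"
    and fV: "\<And>V. compactly_contained V \<Omega> \<Longrightarrow> weighted_variation w f V < \<infinity>"
    using f unfolding BV_loc_def L1_loc_def by blast+
  have "(\<integral>\<^sup>+x\<in>K. ennreal \<bar>f x\<bar> * 1 \<partial>lebesgue) < \<infinity>" if K: "compact K" "K \<subseteq> \<Omega>" for K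
  proof -
    obtain c :: real where c: "0 < c" "\<And>x. x \<in> K \<Longrightarrow> ennreal c \<le> w x"
      by (rule lower_semicontinuous_lower_bound[OF lsc pos K(1)]) (rule that)
    note fm' = zero_extension_measurable[OF op fm]
    have Km: "K \<in> sets lebesgue" using borel_compact[OF K(1)] by simp
    have eq: "(\<integral>\<^sup>+x\<in>K. ennreal \<bar>f x\<bar> * 1 \<partial>lebesgue) = (\<integral>\<^sup>+x. ennreal \<bar>indicat_real \<Omega> x *\<^sub>R f x\<bar> * indicator K x \<partial>lebesgue)"
      using K(2) by (intro nn_integral_cong) (auto simp: indicator_def)
    have "ennreal c * (\<integral>\<^sup>+x\<in>K. ennreal \<bar>f x\<bar> * 1 \<partial>lebesgue)
        = (\<integral>\<^sup>+x. ennreal c * (ennreal \<bar>indicat_real \<Omega> x *\<^sub>R f x\<bar> * indicator K x) \<partial>lebesgue)"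
      unfolding eq
    proof (rule nn_integral_cmult[symmetric])
      show "(\<lambda>x. ennreal \<bar>indicat_real \<Omega> x *\<^sub>R f x\<bar> * indicator K x) \<in> borel_measurable lebesgue"
        using fm' Km by measurable
    qed
    also have "\<dots> \<le> (\<integral>\<^sup>+x\<in>K. ennreal \<bar>f x\<bar> * w x \<partial>lebesgue)"
    proof (rule nn_integral_mono)
      fix x
      show "ennreal c * (ennreal \<bar>indicat_real \<Omega> x *\<^sub>R f x\<bar> * indicator K x) \<le> ennreal \<bar>f x\<bar> * w x * indicator K x"
      proof (cases "x \<in> K")
        case True
        have "ennreal c * ennreal \<bar>f x\<bar> \<le> ennreal \<bar>f x\<bar> * w x"
          unfolding mult.commute[of "ennreal c"] by (intro mult_left_mono c True) simp
        then show ?thesis using True subsetD[OF K(2) True] by simp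
      qed simp
    qed
    also have "\<dots> < \<infinity>" by (rule fK[OF K])
    finally have "ennreal c * (\<integral>\<^sup>+x\<in>K. ennreal \<bar>f x\<bar> * 1 \<partial>lebesgue) < \<infinity>" .
    then show ?thesis using c(1) by (auto simp: ennreal_mult_less_top)
  qed
  then have L1: "f \<in> L1_loc \<Omega> (\<lambda>_. 1)" unfolding L1_loc_def using fm by blast
  have "weighted_variation (\<lambda>_. 1) f V < \<infinity>" if V: "compactly_contained V \<Omega>" for V
  proof -
    have cV: "open V" "compact (closure V)" "V \<subseteq> \<Omega>"
      using V closure_subset[of V] unfolding compactly_contained_def by auto
    obtain c :: real where c: "0 < c" "\<And>x. x \<in> closure V \<Longrightarrow> ennreal c \<le> w x"
      by (rule lower_semicontinuous_lower_bound[OF lsc pos cV(2)]) (rule that)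
    let ?B = "weighted_variation w f V"
    have B: "?B < \<infinity>" using fV[OF V] .
    have "ereal (div_pairing \<Omega> f \<phi>) \<le> ereal (1 / c) * ?B"
      if \<phi>: "\<phi> \<in> lipc V" "\<forall>x\<in>V. ennreal (norm (\<phi> x)) \<le> 1" for \<phi> :: "real^'n \<Rightarrow> real^'n"
    proof -
      have adm: "ennreal (norm (c *\<^sub>R \<phi> x)) \<le> w x" if x: "x \<in> V" for x
      proof -
        have "norm (\<phi> x) \<le> 1" using \<phi>(2) x by (simp add: ennreal_le_1)
        then have "norm (c *\<^sub>R \<phi> x) \<le> c" using c(1) by (simp add: mult_left_le)
        then have "ennreal (norm (c *\<^sub>R \<phi> x)) \<le> ennreal c" by (rule ennreal_leI)
        also have "\<dots> \<le> w x" using x closure_subset[of V] by (intro c(2)) blast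
        finally show ?thesis .
      qed
      have "ereal (div_pairing \<Omega> f (\<lambda>x. c *\<^sub>R \<phi> x)) \<le> ?B"
        unfolding weighted_variation_eq[OF cV(1,3)]
        using adm lipc_scaleR[OF \<phi>(1)] by (intro SUP_upper) blast
      moreover have "div_pairing \<Omega> f (\<lambda>x. c *\<^sub>R \<phi> x) = c * div_pairing \<Omega> f \<phi>"
        by (rule div_pairing_scaleR[OF op L1 lipc_mono[OF \<phi>(1) cV(3)]])
      ultimately have "ereal (c * div_pairing \<Omega> f \<phi>) \<le> ?B" by simp
      then have "ereal (1 / c) * ereal (c * div_pairing \<Omega> f \<phi>) \<le> ereal (1 / c) * ?B"
        using c(1) by (intro ereal_mult_left_mono) auto
      then show ?thesis using c(1) by simp
    qed
    then have "weighted_variation (\<lambda>_. 1) f V \<le> ereal (1 / c) * ?B"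
      unfolding weighted_variation_eq[OF cV(1,3), of "\<lambda>_. 1"] by (intro SUP_least) blast
    also have "\<dots> < \<infinity>" using B c(1) by (cases ?B) auto
    finally show ?thesis .
  qed
  then show ?thesis using L1 by (simp add: BV_loc_def)
qed

lemma div_pairing_functional:
  fixes \<Omega> :: "(real^'n) set"
  assumes op: "open \<Omega>" and f: "f \<in> BV_loc \<Omega> (\<lambda>_. 1)"
  shows "local_vector_functional \<Omega> (div_pairing \<Omega> f)"
proof
  have L1: "f \<in> L1_loc \<Omega> (\<lambda>_. 1)" using f by (simp add: BV_loc_def)
  show "open \<Omega>" by (rule op)
  show "div_pairing \<Omega> f (\<lambda>x. \<phi> x + \<psi> x) = div_pairing \<Omega> f \<phi> + div_pairing \<Omega> f \<psi>"
    if "\<phi> \<in> lipc \<Omega>" "\<psi> \<in> lipc \<Omega>" for \<phi> \<psi> using div_pairing_add[OF op L1 that] .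
  show "div_pairing \<Omega> f (\<lambda>x. c *\<^sub>R \<phi> x) = c * div_pairing \<Omega> f \<phi>"
    if "\<phi> \<in> lipc \<Omega>" for \<phi> c using div_pairing_scaleR[OF op L1 that] .
  fix K assume K: "compact K" "K \<subseteq> \<Omega>"
  obtain V where V: "compactly_contained V \<Omega>" "K \<subseteq> V"
    by (rule compactly_contained_nbhd[OF K(1) op K(2)]) (rule that)
  have cV: "open V" "V \<subseteq> \<Omega>"
    using V closure_subset[of V] unfolding compactly_contained_def by auto
  let ?B = "weighted_variation (\<lambda>_. 1) f V"
  have B: "?B < \<infinity>" using f V(1) by (simp add: BV_loc_def)
  have "div_pairing \<Omega> f \<phi> \<le> real_of_ereal ?B"
    if \<phi>: "\<phi> \<in> lipc \<Omega>" "\<forall>x. x \<notin> K \<longrightarrow> \<phi> x = 0" "\<forall>x. norm (\<phi> x) \<le> 1" for \<phi>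
  proof -
    obtain L where L: "L-lipschitz_on UNIV \<phi>" using \<phi>(1) by (rule lipcE, blast)
    have "\<phi> \<in> lipc V" by (rule lipcI[OF L K(1) V(2)]) (use \<phi>(2) in blast)
    then have "ereal (div_pairing \<Omega> f \<phi>) \<le> ?B"
      unfolding weighted_variation_eq[OF cV] using \<phi>(3) by (intro SUP_upper) (simp add: ennreal_le_1)
    then show ?thesis using B by (cases ?B) auto
  qed
  then show "\<exists>C. \<forall>\<phi>\<in>lipc \<Omega>. (\<forall>x. x \<notin> K \<longrightarrow> \<phi> x = 0) \<longrightarrow> (\<forall>x. norm (\<phi> x) \<le> 1) \<longrightarrow> div_pairing \<Omega> f \<phi> \<le> C"
    by (intro exI[of _ "real_of_ereal ?B"]) blast
qed

lemma variation_measure_exists: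
  fixes \<Omega> :: "(real^'n) set"
  assumes op: "open \<Omega>" and f: "f \<in> BV_loc \<Omega> (\<lambda>_. 1)"
  shows "\<exists>\<mu>. is_variation_measure \<Omega> f \<mu>"
proof -
  interpret local_vector_functional \<Omega> "div_pairing \<Omega> f" by (rule div_pairing_functional[OF assms])
  obtain N h where N: "locally_finite_on \<Omega> N" and h: "h \<in> borel_measurable borel"
    and h1: "AE x in N. norm (h x) = 1"
    and rep: "\<And>\<phi>. \<phi> \<in> lipc \<Omega> \<Longrightarrow> div_pairing \<Omega> f \<phi> = (\<integral>x. \<phi> x \<bullet> h x \<partial>N)"
    by (rule vector_riesz) (rule that)
  have sN: "sets N = sets borel" "space N = UNIV" using N by (rule locally_finite_onD)+
  have hN: "h \<in> borel_measurable N" using h sN(1) by (simp cong: measurable_cong_sets)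
  have Om: "\<Omega> \<inter> space N \<in> sets N" using op sN by simp
  let ?\<mu> = "restrict_space N \<Omega>"
  have "(\<lambda>x. - h x) \<in> borel_measurable ?\<mu>"
    using hN by (intro measurable_restrict_space1) simp
  moreover have "AE x in ?\<mu>. norm (- h x) = 1"
    using h1 Om by (subst AE_restrict_space_iff) auto
  moreover have "(LINT x:\<Omega>|lebesgue. f x * divergence \<phi> x) = - (LINT x|?\<mu>. \<phi> x \<bullet> - h x)"
    if "\<phi> \<in> Lip_c \<Omega>" for \<phi>
  proof -
    have \<phi>: "\<phi> \<in> lipc \<Omega>" using that by (simp add: Lip_c_eq_lipc[OF op])
    have z: "\<phi> x = 0" if "x \<notin> \<Omega>" for x using \<phi> that by (auto elim!: lipcE)
    have "(LINT x|?\<mu>. \<phi> x \<bullet> - h x) = (LINT x|N. indicat_real \<Omega> x *\<^sub>R (\<phi> x \<bullet> - h x))"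
      using Om by (rule integral_restrict_space)
    also have "\<dots> = (LINT x|N. - (\<phi> x \<bullet> h x))"
      using z by (intro Bochner_Integration.integral_cong refl) (auto simp: indicator_def)
    also have "\<dots> = - div_pairing \<Omega> f \<phi>" by (simp add: rep[OF \<phi>])
    finally show ?thesis by (simp add: div_pairing_def)
  qed
  ultimately show ?thesis
    unfolding is_variation_measure_def using locally_finite_imp_radon[OF N op]
    by (intro exI[of _ ?\<mu>] conjI bexI[of _ "\<lambda>x. - h x"]) auto
qed

text \<open>The supremum formula for an arbitrary pair \<open>(\<mu>, \<sigma>)\<close> representing the divergence pairing, which
  serves both for the uniqueness of the variation measure and for the weighted statement.\<close>

lemma nn_integral_eq_weighted_variation:
  fixes \<Omega> :: "(real^'n) set"
  assumes op: "open \<Omega>" and \<mu>: "radon_measure_on \<Omega> \<mu>" and s: "\<sigma> \<in> borel_measurable \<mu>"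
    and s1: "AE x in \<mu>. norm (\<sigma> x) = 1"
    and rep: "\<And>\<phi>. \<phi> \<in> Lip_c \<Omega> \<Longrightarrow> (LINT x:\<Omega>|lebesgue. f x * divergence \<phi> x) = - (LINT x|\<mu>. \<phi> x \<bullet> \<sigma> x)"
    and V: "open V" "V \<subseteq> \<Omega>" and lsc: "lower_semicontinuous w"
  shows "enn2ereal (\<integral>\<^sup>+x. w x * indicator V x \<partial>\<mu>) = weighted_variation w f V"
proof -
  define h where "h = (\<lambda>x. indicat_real \<Omega> x *\<^sub>R - \<sigma> x)"
  have s\<mu>: "sets \<mu> = sets (restrict_space borel \<Omega>)" "space \<mu> = \<Omega>" using radon_measure_onD[OF \<mu>] by auto
  have "(\<lambda>x. - \<sigma> x) \<in> borel_measurable \<mu>" using s by simp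
  then have "(\<lambda>x. - \<sigma> x) \<in> borel_measurable (restrict_space borel \<Omega>)"
    using s\<mu>(1) by (simp cong: measurable_cong_sets)
  then have h: "h \<in> borel_measurable borel"
    using borel_measurable_restrict_space_iff[of \<Omega> borel "\<lambda>x. - \<sigma> x"] op by (simp add: h_def)
  have idm: "(\<lambda>x. x) \<in> measurable \<mu> borel" by (rule measurable_id_radon[OF \<mu>])
  let ?N = "extend \<mu>"
  have N: "locally_finite_on \<Omega> ?N" by (rule extend_properties(1)[OF \<mu> op])
  have "AE x in \<mu>. norm (h x) = 1"
    using s1 AE_space by eventually_elim (simp add: h_def s\<mu>(2))
  then have h1: "AE x in ?N. norm (h x) = 1"
    unfolding extend_def using h by (subst AE_distr_iff[OF idm]) auto
  have rep': "div_pairing \<Omega> f \<phi> = (\<integral>x. \<phi> x \<bullet> h x \<partial>?N)" if \<phi>: "\<phi> \<in> lipc \<Omega>" for \<phi>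
  proof -
    have "\<phi> \<in> Lip_c \<Omega>" using \<phi> by (simp add: Lip_c_eq_lipc[OF op])
    then have "div_pairing \<Omega> f \<phi> = (LINT x|\<mu>. - (\<phi> x \<bullet> \<sigma> x))"
      using rep by (simp add: div_pairing_def)
    also have "\<dots> = (LINT x|\<mu>. \<phi> x \<bullet> h x)"
      by (intro Bochner_Integration.integral_cong refl) (simp add: h_def s\<mu>(2))
    also have "\<dots> = (\<integral>x. \<phi> x \<bullet> h x \<partial>?N)"
      unfolding extend_def
      by (rule integral_distr[OF idm, symmetric]) (intro borel_measurable_inner lipc_borel[OF \<phi>] h)
    finally show ?thesis .
  qed
  have wm: "w \<in> borel_measurable borel" using lsc by (rule lower_semicontinuous_borel)
  have "(\<integral>\<^sup>+x. w x * indicator V x \<partial>\<mu>) = (\<integral>\<^sup>+x. w x * indicator V x \<partial>?N)"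
    unfolding extend_def using wm V(1) by (intro nn_integral_distr[OF idm, symmetric]) simp
  then have "enn2ereal (\<integral>\<^sup>+x. w x * indicator V x \<partial>\<mu>) =
      (SUP \<phi>\<in>{\<phi>\<in>lipc V. \<forall>x\<in>V. ennreal (norm (\<phi> x)) \<le> w x}. ereal (\<integral>x. \<phi> x \<bullet> h x \<partial>?N))"
    using SUP_weighted_fields[OF N h h1 V lsc] by simp
  also have "\<dots> = weighted_variation w f V"
    unfolding weighted_variation_eq[OF V]
    by (intro SUP_cong refl) (simp add: rep' lipc_mono[OF _ V(2)])
  finally show ?thesis .
qed

lemma lower_semicontinuous_const: "lower_semicontinuous (\<lambda>_. c)"
  by (simp add: lower_semicontinuous_def)

text \<open>The formula with weight 1 determines the values on open sets, and outer regularity the rest.\<close>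

lemma variation_measure_unique:
  fixes \<Omega> :: "(real^'n) set"
  assumes op: "open \<Omega>" and "is_variation_measure \<Omega> f \<mu>" "is_variation_measure \<Omega> f \<mu>'"
  shows "\<mu> = \<mu>'"
proof -
  have em: "enn2ereal (emeasure \<mu> U) = weighted_variation (\<lambda>_. 1) f U"
    if \<mu>: "is_variation_measure \<Omega> f \<mu>" and U: "open U" "U \<subseteq> \<Omega>" for \<mu> U
  proof -
    have r: "radon_measure_on \<Omega> \<mu>" using \<mu> by (simp add: is_variation_measure_def)
    obtain \<sigma> where s: "\<sigma> \<in> borel_measurable \<mu>" "AE x in \<mu>. norm (\<sigma> x) = 1"
      "\<And>\<phi>. \<phi> \<in> Lip_c \<Omega> \<Longrightarrow> (LINT x:\<Omega>|lebesgue. f x * divergence \<phi> x) = - (LINT x|\<mu>. \<phi> x \<bullet> \<sigma> x)"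
      using \<mu> unfolding is_variation_measure_def by blast
    have "U \<in> sets \<mu>"
      unfolding radon_measure_onD(2)[OF r] using U op by (subst sets_restrict_space_iff) auto
    then have "emeasure \<mu> U = (\<integral>\<^sup>+x. 1 * indicator U x \<partial>\<mu>)" by simp
    then show ?thesis
      by (simp only:) (rule nn_integral_eq_weighted_variation[OF op r s U lower_semicontinuous_const])
  qed
  show ?thesis
  proof (rule radon_measure_eq_on_open)
    show "radon_measure_on \<Omega> \<mu>" "radon_measure_on \<Omega> \<mu>'"
      using assms by (auto simp: is_variation_measure_def)
    show "emeasure \<mu> U = emeasure \<mu>' U" if "open U" "U \<subseteq> \<Omega>" for U
      using em[OF assms(2) that] em[OF assms(3) that] by (metis enn2ereal_inject)
  qed
qed

lemma variation_measure_is_variation_measure: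
  fixes \<Omega> :: "(real^'n) set"
  assumes op: "open \<Omega>" and f: "f \<in> BV_loc \<Omega> (\<lambda>_. 1)"
  shows "is_variation_measure \<Omega> f (variation_measure \<Omega> f)"
proof -
  obtain \<mu> where \<mu>: "is_variation_measure \<Omega> f \<mu>" using variation_measure_exists[OF assms] by blast
  show ?thesis
    unfolding variation_measure_def using \<mu> variation_measure_unique[OF op _ \<mu>] by (rule theI)
qed

lemma density_radon_measure:
  fixes \<Omega> :: "'a::euclidean_space set"
  assumes op: "open \<Omega>" and \<mu>: "radon_measure_on \<Omega> \<mu>" and w: "w \<in> borel_measurable borel"
    and fin: "\<And>V. compactly_contained V \<Omega> \<Longrightarrow> (\<integral>\<^sup>+x. w x * indicator V x \<partial>\<mu>) < \<infinity>"
  shows "radon_measure_on \<Omega> (density \<mu> w)" "AE x in \<mu>. w x \<noteq> \<infinity>"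
proof -
  have s\<mu>: "sets \<mu> = sets (restrict_space borel \<Omega>)" "space \<mu> = \<Omega>" using radon_measure_onD[OF \<mu>] by auto
  have idm: "(\<lambda>x. x) \<in> measurable \<mu> borel" by (rule measurable_id_radon[OF \<mu>])
  let ?N = "extend \<mu>"
  have N: "locally_finite_on \<Omega> ?N" by (rule extend_properties(1)[OF \<mu> op])
  have sN: "sets ?N = sets borel" using N by (rule locally_finite_onD)
  have wN: "w \<in> borel_measurable ?N" using w sN by (simp cong: measurable_cong_sets)
  have w\<mu>: "w \<in> borel_measurable \<mu>" using measurable_compose[OF idm w] by simp
  have em: "emeasure (density ?N w) A = (\<integral>\<^sup>+x. w x * indicator A x \<partial>\<mu>)" if A: "A \<in> sets borel" for A
  proof -
    have "emeasure (density ?N w) A = (\<integral>\<^sup>+x. w x * indicator A x \<partial>?N)"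
      using wN A sN by (intro emeasure_density) auto
    also have "\<dots> = (\<integral>\<^sup>+x. w x * indicator A x \<partial>\<mu>)"
      unfolding extend_def using w A by (intro nn_integral_distr[OF idm]) simp
    finally show ?thesis .
  qed
  have D: "locally_finite_on \<Omega> (density ?N w)"
    unfolding locally_finite_on_def
  proof (intro conjI allI impI)
    show "sets (density ?N w) = sets borel" by (simp add: sN)
    have "emeasure (density ?N w) (- \<Omega>) = (\<integral>\<^sup>+x. w x * indicator (- \<Omega>) x \<partial>\<mu>)"
      using op by (intro em) simp
    also have "\<dots> = (\<integral>\<^sup>+x. 0 \<partial>\<mu>)"
      by (intro nn_integral_cong) (simp add: s\<mu>(2))
    finally show "emeasure (density ?N w) (- \<Omega>) = 0" by simp
    fix K assume K: "compact K \<and> K \<subseteq> \<Omega>"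
    obtain V where V: "compactly_contained V \<Omega>" "K \<subseteq> V"
      by (rule compactly_contained_nbhd[OF _ op, of K]) (use K in blast)+
    have "emeasure (density ?N w) K = (\<integral>\<^sup>+x. w x * indicator K x \<partial>\<mu>)"
      using K by (intro em borel_compact) simp
    also have "\<dots> \<le> (\<integral>\<^sup>+x. w x * indicator V x \<partial>\<mu>)"
      using V(2) by (intro nn_integral_mono mult_left_mono) (auto simp: indicator_def)
    also have "\<dots> < \<infinity>" using V(1) by (rule fin)
    finally show "emeasure (density ?N w) K < \<infinity>" .
  qed
  \<comment> \<open>Regularity is known for measures on all Borel sets of the space, so the density is taken there.\<close>
  have "density \<mu> w = restrict_space (density ?N w) \<Omega>"
  proof (rule measure_eqI)
    have "sets (restrict_space (density ?N w) \<Omega>) = sets (restrict_space borel \<Omega>)"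
      by (rule sets_restrict_space_cong) (simp add: sN)
    then show "sets (density \<mu> w) = sets (restrict_space (density ?N w) \<Omega>)" by (simp add: s\<mu>(1))
    fix A assume "A \<in> sets (density \<mu> w)"
    then have A\<mu>: "A \<in> sets \<mu>" by simp
    then have A: "A \<in> sets borel" "A \<subseteq> \<Omega>"
      unfolding s\<mu>(1) using op by (subst (asm) sets_restrict_space_iff; simp)+
    have "emeasure (restrict_space (density ?N w) \<Omega>) A = emeasure (density ?N w) A"
      using op A(2) by (intro emeasure_restrict_space) (simp_all add: sN)
    also have "\<dots> = (\<integral>\<^sup>+x. w x * indicator A x \<partial>\<mu>)" by (rule em[OF A(1)])
    also have "\<dots> = emeasure (density \<mu> w) A" using w\<mu> A\<mu> by (rule emeasure_density[symmetric])
    finally show "emeasure (density \<mu> w) A = emeasure (restrict_space (density ?N w) \<Omega>) A" ..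
  qed
  then show "radon_measure_on \<Omega> (density \<mu> w)" using locally_finite_imp_radon[OF D op] by simp
  have "sigma_finite_measure ?N" using N op by (rule locally_finite_sigma_finite)
  moreover have "sigma_finite_measure (density ?N w)" using D op by (rule locally_finite_sigma_finite)
  ultimately have "AE x in ?N. w x \<noteq> \<infinity>"
    using sigma_finite_measure.sigma_finite_iff_density_finite[OF _ wN] by blast
  then show "AE x in \<mu>. w x \<noteq> \<infinity>"
    unfolding extend_def using w by (subst (asm) AE_distr_iff[OF idm]) auto
qed

theorem theorem1p1:
  fixes \<Omega> :: "(real^'n) set"
    and w :: "real^'n \<Rightarrow> ennreal"
    and f :: "real^'n \<Rightarrow> real"
  assumes "open \<Omega>"
    and "\<And>x. 0 < w x"
    and "lower_semicontinuous w"
    and "f \<in> BV_loc \<Omega> w"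
  shows "\<exists>\<mu> \<nu>. radon_measure_on \<Omega> \<mu> \<and>
    (\<forall>V. compactly_contained V \<Omega> \<longrightarrow> enn2ereal (emeasure \<mu> V) = weighted_variation w f V) \<and>
    \<nu> \<in> borel_measurable \<mu> \<and>
    (AE x in \<mu>. norm (\<nu> x) = 1) \<and>
    (\<forall>\<phi>\<in>Lip_c \<Omega>. (LINT x:\<Omega>|lebesgue. f x * divergence \<phi> x)
                  = - (LINT x|\<mu>. (\<phi> x \<bullet> \<nu> x) * enn2real (1 / w x))) \<and>
    \<mu> = density (variation_measure \<Omega> f) w"
proof -
  have f1: "f \<in> BV_loc \<Omega> (\<lambda>_. 1)" by (rule BV_loc_subset_unweighted[OF assms])
  let ?\<mu> = "variation_measure \<Omega> f"
  have isv: "is_variation_measure \<Omega> f ?\<mu>" by (rule variation_measure_is_variation_measure[OF assms(1) f1])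
  then have r: "radon_measure_on \<Omega> ?\<mu>" by (simp add: is_variation_measure_def)
  obtain \<sigma> where s: "\<sigma> \<in> borel_measurable ?\<mu>" "AE x in ?\<mu>. norm (\<sigma> x) = 1"
    "\<And>\<phi>. \<phi> \<in> Lip_c \<Omega> \<Longrightarrow> (LINT x:\<Omega>|lebesgue. f x * divergence \<phi> x) = - (LINT x|?\<mu>. \<phi> x \<bullet> \<sigma> x)"
    using isv unfolding is_variation_measure_def by blast
  have w: "w \<in> borel_measurable borel" by (rule lower_semicontinuous_borel[OF assms(3)])
  have idm: "(\<lambda>x. x) \<in> measurable ?\<mu> borel" by (rule measurable_id_radon[OF r])
  have w\<mu>[measurable]: "w \<in> borel_measurable ?\<mu>" using measurable_compose[OF idm w] by simp
  note [measurable] = s(1)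
  have wv: "enn2ereal (\<integral>\<^sup>+x. w x * indicator V x \<partial>?\<mu>) = weighted_variation w f V"
    if "compactly_contained V \<Omega>" for V
  proof -
    have "open V" "V \<subseteq> \<Omega>" using that closure_subset[of V] unfolding compactly_contained_def by auto
    then show ?thesis using nn_integral_eq_weighted_variation[OF assms(1) r s _ _ assms(3)] by blast
  qed
  have fin: "(\<integral>\<^sup>+x. w x * indicator V x \<partial>?\<mu>) < \<infinity>" if V: "compactly_contained V \<Omega>" for V
  proof -
    have "weighted_variation w f V < \<infinity>" using assms(4) V by (simp add: BV_loc_def)
    then have "enn2ereal (\<integral>\<^sup>+x. w x * indicator V x \<partial>?\<mu>) < enn2ereal \<infinity>" by (simp add: wv[OF V])
    then show ?thesis by (simp only: less_ennreal.rep_eq)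
  qed
  have rd1: "radon_measure_on \<Omega> (density ?\<mu> w)" by (rule density_radon_measure(1)[OF assms(1) r w]) (rule fin)
  have rd2: "AE x in ?\<mu>. w x \<noteq> \<infinity>" by (rule density_radon_measure(2)[OF assms(1) r w]) (rule fin)
  show ?thesis
  proof (intro exI conjI allI impI ballI)
    show "radon_measure_on \<Omega> (density ?\<mu> w)" by (rule rd1)
    show "\<sigma> \<in> borel_measurable (density ?\<mu> w)" using s(1) by simp
    show "AE x in density ?\<mu> w. norm (\<sigma> x) = 1" using s(2) by (subst AE_density[OF w\<mu>]) auto
    show "enn2ereal (emeasure (density ?\<mu> w) V) = weighted_variation w f V" if V: "compactly_contained V \<Omega>" for V
    proof -
      have "open V" "V \<subseteq> \<Omega>" using V closure_subset[of V] unfolding compactly_contained_def by auto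
      then have "V \<in> sets ?\<mu>"
        unfolding radon_measure_onD(2)[OF r] using assms(1) by (subst sets_restrict_space_iff) auto
      then show ?thesis using wv[OF V] by (simp add: emeasure_density[OF w\<mu>])
    qed
    fix \<phi> assume \<phi>: "\<phi> \<in> Lip_c \<Omega>"
    have "\<phi> \<in> lipc \<Omega>" using \<phi> by (simp add: Lip_c_eq_lipc[OF assms(1)])
    from measurable_compose[OF idm lipc_borel[OF this]]
    have [measurable]: "\<phi> \<in> borel_measurable ?\<mu>" by simp
    have eq: "density ?\<mu> w = density ?\<mu> (\<lambda>x. ennreal (enn2real (w x)))"
      using rd2 by (intro density_cong) (auto simp: ennreal_enn2real_if)
    have "(LINT x|density ?\<mu> w. (\<phi> x \<bullet> \<sigma> x) * enn2real (1 / w x)) =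
        (LINT x|?\<mu>. enn2real (w x) *\<^sub>R ((\<phi> x \<bullet> \<sigma> x) * enn2real (1 / w x)))"
      unfolding eq by (rule integral_density) measurable
    also have "\<dots> = (LINT x|?\<mu>. \<phi> x \<bullet> \<sigma> x)"
    proof (rule integral_cong_AE)
      show "AE x in ?\<mu>. enn2real (w x) *\<^sub>R ((\<phi> x \<bullet> \<sigma> x) * enn2real (1 / w x)) = \<phi> x \<bullet> \<sigma> x"
        using rd2
      proof eventually_elim
        case (elim x)
        then obtain t where t: "w x = ennreal t" "0 \<le> t" by (cases "w x") auto
        have "0 < t" using assms(2)[of x] t by simp
        then have "enn2real (1 / w x) = 1 / t"
          unfolding t(1) ennreal_1[symmetric] by (subst divide_ennreal) auto
        then show ?case using t \<open>0 < t\<close> by simp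
      qed
    qed measurable
    finally show "(LINT x:\<Omega>|lebesgue. f x * divergence \<phi> x)
                  = - (LINT x|density ?\<mu> w. (\<phi> x \<bullet> \<sigma> x) * enn2real (1 / w x))"
      using s(3)[OF \<phi>] by simp
  qed (rule refl)
qed

end
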